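(* Let $K$ be a field and let $(E,w)$ be a row-finite (LPA) weighted graph with $\lambda(E,w)<\infty$. Then there exist a row-finite unweighted graph $F$ and a $\mathbb Z^{\lambda(E,w)}$-grading on $L_K(F)$ such that $L_K(E,w)\cong_{\mathrm{gr}}L_K(F)$ as $\mathbb Z^{\lambda(E,w)}$-graded $K$-algebras, where $L_K(E,w)$ carries its standard $\mathbb Z^{\lambda(E,w)}$-grading.
   Context: A directed graph is $E=(E^0,E^1,s,r)$; $v\in E^0$ is regular if $0<|s^{-1}(v)|<\infty$; $E$ is row-finite if $|s^{-1}(v)|<\infty$ for all $v$. Paths are sequences of edges $e_1\cdots e_n$ with $r(e_i)=s(e_{i+1})$; vertices are paths of length $0$. $u\ge v$ means there is a path from $u$ to $v$; $T(u)=\{x:u\ge x\}$, $T(X)=\bigcup_{v\in X}T(v)$. A cycle based at $s(e_1)$ is a path $e_1\cdots e_n$, $n\ge1$, with $s(e_1)=r(e_n)$ and the $s(e_i)$ pairwise distinct. Edges $e,f$ are in line if $e=f$, $r(e)\ge s(f)$ or $r(f)\ge s(e)$. A weighted graph $(E,w)$ is a directed graph with $w:E^1\to\{1,2,\dots\}$; standing assumption: nonempty, row-finite, connected. $E_w=\{e:w(e)>1\}$ (weighted edges). Condition (LPA): (LPA1) every vertex emits at most one weighted edge; (LPA2) every vertex in $T(r(E_w))$ emits at most one edge; (LPA3) if $e,f\in E_w$ are not in line then $T(r(e))\cap T(r(f))=\varnothing$; (LPA4) if $e\in E_w$ and $C$ is a cycle based at some $v\in T(r(e))$, then $e$ is an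 edge of $C$. An (LPA) weighted graph is one satisfying these. For regular $v$ let $w(v)=\max\{w(e):e\in s^{-1}(v)\}$, and $w(v)=0$ for a sink. $\lambda(E,w)=\sup\{w(v):v\in E^0\}$ if this supremum is finite (otherwise $\lambda(E,w)$ is infinite). Weighted Leavitt path algebra $L_K(E,w)$: the $K$-algebra generated by $v$ ($v\in E^0$) and $e_i,e_i^*$ ($e\in E^1$, $1\le i\le w(e)$) with relations $uv=\delta_{uv}u$ for vertices; $s(e)e_i=e_i=e_ir(e)$; $r(e)e_i^*=e_i^*=e_i^*s(e)$; $\sum_{1\le i\le w(v)}e_i^*f_i=\delta_{ef}r(e)$ for regular $v$ and $e,f\in s^{-1}(v)$; $\sum_{e\in s^{-1}(v)}e_ie_j^*=\delta_{ij}v$ for regular $v$ and $1\le i,j\le w(v)$; here $e_i=e_i^*=0$ for $i>w(e)$. For an unweighted graph $F$ (all weights $1$) this is the Leavitt path algebra $L_K(F)$. The standard $\mathbb Z^{\lambda(E,w)}$-grading of $L_K(E,w)$ is given by $\deg(v)=0$, $\deg(e_i)=\epsilon_i$, $\deg(e_i^* )=-\epsilon_i$, with $\epsilon_i$ the $i$-th standard basis vector. $\cong_{\mathrm{gr}}$ denotes isomorphism of $K$-algebras preserving homogeneous degrees. *)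

theory Defs
  imports
    "Graph_Theory.Digraph_Component"
    "HOL-Library.Poly_Mapping"
    "Jordan_Normal_Form.Matrix"
begin

section \<open>Weighted graphs\<close>

text \<open>
  Directed graphs are those of Graph_Theory: the source of an edge is \<open>tail\<close>, the range is
  \<open>head\<close>, and the set of edges emitted by \<open>v\<close> is \<open>out_arcs E v\<close>. The relation \<open>u \<ge> v\<close> is
  \<open>u \<rightarrow>\<^sup>*\<^bsub>E\<^esub> v\<close>.
\<close>

definition row_finite :: "('v, 'e) pre_digraph \<Rightarrow> bool" where
  "row_finite E \<longleftrightarrow> (\<forall>v\<in>verts E. finite (out_arcs E v))"

definition regular :: "('v, 'e) pre_digraph \<Rightarrow> 'v \<Rightarrow> bool" where
  "regular E v \<longleftrightarrow> v \<in> verts E \<and> out_arcs E v \<noteq> {} \<and> finite (out_arcs E v)"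

text \<open>The notion \<open>connected\<close> of Graph_Theory refers to the underlying undirected graph.\<close>

locale weighted_graph = wf_digraph E
  for E :: "('v, 'e) pre_digraph" and w :: "'e \<Rightarrow> nat" +
  assumes weight_pos: "e \<in> arcs E \<Longrightarrow> 1 \<le> w e"
    and nonempty: "verts E \<noteq> {}"
    and row_finite: "row_finite E"
    and connected: "connected E"

definition weighted_edges :: "('v, 'e) pre_digraph \<Rightarrow> ('e \<Rightarrow> nat) \<Rightarrow> 'e set" where
  "weighted_edges E w = {e \<in> arcs E. 1 < w e}"

definition tree :: "('v, 'e) pre_digraph \<Rightarrow> 'v \<Rightarrow> 'v set" where
  "tree E u = {x. u \<rightarrow>\<^sup>*\<^bsub>E\<^esub> x}"

definition tree_set :: "('v, 'e) pre_digraph \<Rightarrow> 'v set \<Rightarrow> 'v set" where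
  "tree_set E X = (\<Union>v\<in>X. tree E v)"

definition in_line :: "('v, 'e) pre_digraph \<Rightarrow> 'e \<Rightarrow> 'e \<Rightarrow> bool" where
  "in_line E e f \<longleftrightarrow> e = f \<or> head E e \<rightarrow>\<^sup>*\<^bsub>E\<^esub> tail E f \<or> head E f \<rightarrow>\<^sup>*\<^bsub>E\<^esub> tail E e"

definition cycle_based_at :: "('v, 'e) pre_digraph \<Rightarrow> 'v \<Rightarrow> 'e list \<Rightarrow> bool" where
  "cycle_based_at E v C \<longleftrightarrow>
     C \<noteq> [] \<and> pre_digraph.awalk E v C v \<and> distinct (map (tail E) C)"

locale LPA_weighted_graph = weighted_graph E w
  for E :: "('v, 'e) pre_digraph" and w :: "'e \<Rightarrow> nat" +
  assumes LPA1: "\<lbrakk>v \<in> verts E; e \<in> out_arcs E v \<inter> weighted_edges E w;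
                  f \<in> out_arcs E v \<inter> weighted_edges E w\<rbrakk> \<Longrightarrow> e = f"
    and LPA2: "\<lbrakk>v \<in> tree_set E (head E ` weighted_edges E w);
                  e \<in> out_arcs E v; f \<in> out_arcs E v\<rbrakk> \<Longrightarrow> e = f"
    and LPA3: "\<lbrakk>e \<in> weighted_edges E w; f \<in> weighted_edges E w; \<not> in_line E e f\<rbrakk>
                 \<Longrightarrow> tree E (head E e) \<inter> tree E (head E f) = {}"
    and LPA4: "\<lbrakk>e \<in> weighted_edges E w; v \<in> tree E (head E e); cycle_based_at E v C\<rbrakk>
                 \<Longrightarrow> e \<in> set C"

definition vertex_weight :: "('v, 'e) pre_digraph \<Rightarrow> ('e \<Rightarrow> nat) \<Rightarrow> 'v \<Rightarrow> nat" where
  "vertex_weight E w v = (if out_arcs E v = {} then 0 else Max (w ` out_arcs E v))"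

definition weight_sup :: "('v, 'e) pre_digraph \<Rightarrow> ('e \<Rightarrow> nat) \<Rightarrow> enat" where
  "weight_sup E w = (SUP v\<in>verts E. enat (vertex_weight E w v))"


section \<open>Associative algebras without unit over a field\<close>

text \<open>
  The record \<open>module\<close> of HOL-Algebra is reused for algebras over the field \<open>'k\<close>; its field
  \<open>one\<close> is never referred to, because the algebras considered here need not be unital.
\<close>

locale assoc_algebra = abelian_group A
  for A :: "('k :: field, 'a) module" (structure) +
  assumes mult_closed: "\<lbrakk>x \<in> carrier A; y \<in> carrier A\<rbrakk> \<Longrightarrow> x \<otimes> y \<in> carrier A"
    and mult_assoc: "\<lbrakk>x \<in> carrier A; y \<in> carrier A; z \<in> carrier A\<rbrakk>
                       \<Longrightarrow> (x \<otimes> y) \<otimes> z = x \<otimes> (y \<otimes> z)"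
    and left_distrib: "\<lbrakk>x \<in> carrier A; y \<in> carrier A; z \<in> carrier A\<rbrakk>
                       \<Longrightarrow> (x \<oplus> y) \<otimes> z = x \<otimes> z \<oplus> y \<otimes> z"
    and right_distrib: "\<lbrakk>x \<in> carrier A; y \<in> carrier A; z \<in> carrier A\<rbrakk>
                       \<Longrightarrow> x \<otimes> (y \<oplus> z) = x \<otimes> y \<oplus> x \<otimes> z"
    and scale_closed: "x \<in> carrier A \<Longrightarrow> c \<odot> x \<in> carrier A"
    and scale_one: "x \<in> carrier A \<Longrightarrow> 1 \<odot> x = x"
    and scale_scale: "x \<in> carrier A \<Longrightarrow> (c * d) \<odot> x = c \<odot> (d \<odot> x)"
    and scale_left_distrib: "x \<in> carrier A \<Longrightarrow> (c + d) \<odot> x = c \<odot> x \<oplus> d \<odot> x"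
    and scale_right_distrib: "\<lbrakk>x \<in> carrier A; y \<in> carrier A\<rbrakk>
                       \<Longrightarrow> c \<odot> (x \<oplus> y) = c \<odot> x \<oplus> c \<odot> y"
    and scale_mult_left: "\<lbrakk>x \<in> carrier A; y \<in> carrier A\<rbrakk> \<Longrightarrow> c \<odot> (x \<otimes> y) = (c \<odot> x) \<otimes> y"
    and scale_mult_right: "\<lbrakk>x \<in> carrier A; y \<in> carrier A\<rbrakk> \<Longrightarrow> c \<odot> (x \<otimes> y) = x \<otimes> (c \<odot> y)"

definition algebra_iso :: "('k, 'a) module \<Rightarrow> ('k, 'b) module \<Rightarrow> ('a \<Rightarrow> 'b) set" where
  "algebra_iso A B = {\<phi>. bij_betw \<phi> (carrier A) (carrier B) \<and>
     (\<forall>x\<in>carrier A. \<forall>y\<in>carrier A. \<phi> (x \<oplus>\<^bsub>A\<^esub> y) = \<phi> x \<oplus>\<^bsub>B\<^esub> \<phi> y) \<and>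
     (\<forall>x\<in>carrier A. \<forall>y\<in>carrier A. \<phi> (x \<otimes>\<^bsub>A\<^esub> y) = \<phi> x \<otimes>\<^bsub>B\<^esub> \<phi> y) \<and>
     (\<forall>c. \<forall>x\<in>carrier A. \<phi> (c \<odot>\<^bsub>A\<^esub> x) = c \<odot>\<^bsub>B\<^esub> \<phi> x)}"

text \<open>
  A \<open>\<int>\<^sup>n\<close>-grading is the family of its homogeneous components. The group \<open>\<int>\<^sup>n\<close> is
  \<open>carrier_vec n :: int vec set\<close>; components at vectors of another dimension play no role.
\<close>

locale graded_algebra = assoc_algebra A
  for n :: nat and A :: "('k :: field, 'a) module" (structure) and \<A> :: "int vec \<Rightarrow> 'a set" +
  assumes component_subset: "g \<in> carrier_vec n \<Longrightarrow> \<A> g \<subseteq> carrier A"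
    and component_zero: "g \<in> carrier_vec n \<Longrightarrow> \<zero> \<in> \<A> g"
    and component_add: "\<lbrakk>g \<in> carrier_vec n; x \<in> \<A> g; y \<in> \<A> g\<rbrakk> \<Longrightarrow> x \<oplus> y \<in> \<A> g"
    and component_scale: "\<lbrakk>g \<in> carrier_vec n; x \<in> \<A> g\<rbrakk> \<Longrightarrow> c \<odot> x \<in> \<A> g"
    and component_mult: "\<lbrakk>g \<in> carrier_vec n; h \<in> carrier_vec n; x \<in> \<A> g; y \<in> \<A> h\<rbrakk>
                           \<Longrightarrow> x \<otimes> y \<in> \<A> (g + h)"
    and direct_sum: "a \<in> carrier A \<Longrightarrow>
           \<exists>!x. (\<forall>g\<in>carrier_vec n. x g \<in> \<A> g) \<and> (\<forall>g. g \<notin> carrier_vec n \<longrightarrow> x g = \<zero>) \<and>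
                finite {g. x g \<noteq> \<zero>} \<and> a = (\<Oplus>g\<in>{g. x g \<noteq> \<zero>}. x g)"

definition graded_isomorphic :: "nat \<Rightarrow> ('k, 'a) module \<Rightarrow> (int vec \<Rightarrow> 'a set) \<Rightarrow>
    ('k, 'b) module \<Rightarrow> (int vec \<Rightarrow> 'b set) \<Rightarrow> bool" where
  "graded_isomorphic n A \<A> B \<B> \<longleftrightarrow>
     (\<exists>\<phi>\<in>algebra_iso A B. \<forall>g\<in>carrier_vec n. \<phi> ` \<A> g = \<B> g)"


section \<open>Free algebras and presentations\<close>

text \<open>
  Words are wrapped in a datatype so that they form an additive monoid under concatenation; then
  \<open>'x fword \<Rightarrow>\<^sub>0 'k\<close>, with the convolution product of Poly_Mapping, is the free unital algebra
  over \<open>'k\<close> on \<open>'x\<close>, and \<open>free_algebra X\<close> is the free algebra without unit on the set \<open>X\<close>.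
\<close>

datatype 'x fword = FWord (letters: "'x list")

instantiation fword :: (type) monoid_add
begin
definition zero_fword :: "'a fword" where "0 = FWord []"
definition plus_fword :: "'a fword \<Rightarrow> 'a fword \<Rightarrow> 'a fword" where
  "u + v = FWord (letters u @ letters v)"
instance by standard (auto simp: zero_fword_def plus_fword_def)
end

type_synonym ('x, 'k) free = "'x fword \<Rightarrow>\<^sub>0 'k"

definition letter :: "'x \<Rightarrow> ('x, 'k :: field) free" where
  "letter x = Poly_Mapping.single (FWord [x]) 1"

definition scalar :: "'k :: field \<Rightarrow> ('x, 'k) free" where
  "scalar c = Poly_Mapping.single 0 c"

definition free_algebra :: "'x set \<Rightarrow> ('x, 'k :: field) free set" where
  "free_algebra X = {p. \<forall>u\<in>Poly_Mapping.keys p. u \<noteq> 0 \<and> set (letters u) \<subseteq> X}"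

inductive_set ideal_generated :: "('x, 'k :: field) free set \<Rightarrow> ('x, 'k) free set \<Rightarrow> ('x, 'k) free set"
  for A R where
  base: "r \<in> R \<Longrightarrow> r \<in> ideal_generated A R"
| zero: "0 \<in> ideal_generated A R"
| add: "\<lbrakk>p \<in> ideal_generated A R; q \<in> ideal_generated A R\<rbrakk> \<Longrightarrow> p + q \<in> ideal_generated A R"
| scale: "p \<in> ideal_generated A R \<Longrightarrow> scalar c * p \<in> ideal_generated A R"
| left: "\<lbrakk>a \<in> A; p \<in> ideal_generated A R\<rbrakk> \<Longrightarrow> a * p \<in> ideal_generated A R"
| right: "\<lbrakk>a \<in> A; p \<in> ideal_generated A R\<rbrakk> \<Longrightarrow> p * a \<in> ideal_generated A R"

definition coset :: "('x, 'k :: field) free set \<Rightarrow> ('x, 'k) free \<Rightarrow> ('x, 'k) free set" where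
  "coset I p = (\<lambda>q. p + q) ` I"

definition quotient_algebra ::
    "('x, 'k :: field) free set \<Rightarrow> ('x, 'k) free set \<Rightarrow> ('k, ('x, 'k) free set) module" where
  "quotient_algebra A I =
     \<lparr>carrier = coset I ` A,
      monoid.mult = (\<lambda>P Q. \<Union>p\<in>P. \<Union>q\<in>Q. coset I (p * q)),
      one = undefined,
      ring.zero = coset I 0,
      add = (\<lambda>P Q. \<Union>p\<in>P. \<Union>q\<in>Q. coset I (p + q)),
      smult = (\<lambda>c P. \<Union>p\<in>P. coset I (scalar c * p))\<rparr>"


section \<open>Weighted Leavitt path algebras\<close>

datatype ('v, 'e) gen = Vert 'v | Edge 'e nat | Ghost 'e nat

definition wlpa_gens :: "('v, 'e) pre_digraph \<Rightarrow> ('e \<Rightarrow> nat) \<Rightarrow> ('v, 'e) gen set" where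
  "wlpa_gens E w = Vert ` verts E \<union>
     {Edge e i | e i. e \<in> arcs E \<and> 1 \<le> i \<and> i \<le> w e} \<union>
     {Ghost e i | e i. e \<in> arcs E \<and> 1 \<le> i \<and> i \<le> w e}"

abbreviation (input) vert :: "'v \<Rightarrow> (('v, 'e) gen, 'k :: field) free" where
  "vert v \<equiv> letter (Vert v)"

text \<open>The elements \<open>e\<^sub>i\<close> and \<open>e\<^sub>i\<^sup>*\<close>, with the convention that they vanish for \<open>i > w e\<close>.\<close>

definition edge :: "('e \<Rightarrow> nat) \<Rightarrow> 'e \<Rightarrow> nat \<Rightarrow> (('v, 'e) gen, 'k :: field) free" where
  "edge w e i = (if 1 \<le> i \<and> i \<le> w e then letter (Edge e i) else 0)"

definition ghost :: "('e \<Rightarrow> nat) \<Rightarrow> 'e \<Rightarrow> nat \<Rightarrow> (('v, 'e) gen, 'k :: field) free" where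
  "ghost w e i = (if 1 \<le> i \<and> i \<le> w e then letter (Ghost e i) else 0)"

text \<open>Each relation \<open>p = q\<close> is encoded by the element \<open>p - q\<close>.\<close>

inductive_set wlpa_relations ::
    "('v, 'e) pre_digraph \<Rightarrow> ('e \<Rightarrow> nat) \<Rightarrow> (('v, 'e) gen, 'k :: field) free set"
  for E w where
  vertices: "\<lbrakk>u \<in> verts E; v \<in> verts E\<rbrakk> \<Longrightarrow>
     vert u * vert v - (if u = v then vert u else 0) \<in> wlpa_relations E w"
| source_edge: "\<lbrakk>e \<in> arcs E; 1 \<le> i; i \<le> w e\<rbrakk> \<Longrightarrow>
     vert (tail E e) * edge w e i - edge w e i \<in> wlpa_relations E w"
| edge_range: "\<lbrakk>e \<in> arcs E; 1 \<le> i; i \<le> w e\<rbrakk> \<Longrightarrow>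
     edge w e i * vert (head E e) - edge w e i \<in> wlpa_relations E w"
| range_ghost: "\<lbrakk>e \<in> arcs E; 1 \<le> i; i \<le> w e\<rbrakk> \<Longrightarrow>
     vert (head E e) * ghost w e i - ghost w e i \<in> wlpa_relations E w"
| ghost_source: "\<lbrakk>e \<in> arcs E; 1 \<le> i; i \<le> w e\<rbrakk> \<Longrightarrow>
     ghost w e i * vert (tail E e) - ghost w e i \<in> wlpa_relations E w"
| ghost_edge: "\<lbrakk>regular E v; e \<in> out_arcs E v; f \<in> out_arcs E v\<rbrakk> \<Longrightarrow>
     (\<Sum>i=1..vertex_weight E w v. ghost w e i * edge w f i) -
       (if e = f then vert (head E e) else 0) \<in> wlpa_relations E w"
| edge_ghost: "\<lbrakk>regular E v; 1 \<le> i; i \<le> vertex_weight E w v; 1 \<le> j; j \<le> vertex_weight E w v\<rbrakk> \<Longrightarrow>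
     (\<Sum>e\<in>out_arcs E v. edge w e i * ghost w e j) -
       (if i = j then vert v else 0) \<in> wlpa_relations E w"

definition wlpa_ideal ::
    "('v, 'e) pre_digraph \<Rightarrow> ('e \<Rightarrow> nat) \<Rightarrow> (('v, 'e) gen, 'k :: field) free set" where
  "wlpa_ideal E w = ideal_generated (free_algebra (wlpa_gens E w)) (wlpa_relations E w)"

definition wlpa :: "'k :: field itself \<Rightarrow> ('v, 'e) pre_digraph \<Rightarrow> ('e \<Rightarrow> nat) \<Rightarrow>
    ('k, (('v, 'e) gen, 'k) free set) module" where
  "wlpa K E w = quotient_algebra (free_algebra (wlpa_gens E w)) (wlpa_ideal E w)"

definition lpa :: "'k :: field itself \<Rightarrow> ('v, 'e) pre_digraph \<Rightarrow>
    ('k, (('v, 'e) gen, 'k) free set) module" where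
  "lpa K F = wlpa K F (\<lambda>_. 1)"

text \<open>Coordinates of \<open>int vec\<close> are numbered from 0, whence \<open>\<epsilon>\<^sub>i\<close> is \<open>unit_vec n (i - 1)\<close>.\<close>

fun gen_degree :: "nat \<Rightarrow> ('v, 'e) gen \<Rightarrow> int vec" where
  "gen_degree n (Vert v) = 0\<^sub>v n"
| "gen_degree n (Edge e i) = unit_vec n (i - 1)"
| "gen_degree n (Ghost e i) = - unit_vec n (i - 1)"

definition word_degree :: "nat \<Rightarrow> ('v, 'e) gen fword \<Rightarrow> int vec" where
  "word_degree n u = foldr (\<lambda>x g. gen_degree n x + g) (letters u) (0\<^sub>v n)"

definition standard_grading :: "'k :: field itself \<Rightarrow> ('v, 'e) pre_digraph \<Rightarrow> ('e \<Rightarrow> nat) \<Rightarrow>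
    nat \<Rightarrow> int vec \<Rightarrow> (('v, 'e) gen, 'k) free set set" where
  "standard_grading K E w n g =
     coset (wlpa_ideal E w) ` {p \<in> free_algebra (wlpa_gens E w).
                                \<forall>u\<in>Poly_Mapping.keys p. word_degree n u = g}"


section \<open>The quotient operations are well defined\<close>

lemma scalar_mult_commute: "scalar c * p = p * scalar c" for p :: "('x, 'k :: field) free"
proof (induction p rule: update_induct)
  case const
  then show ?case by simp
next
  case (update p k v)
  have "Poly_Mapping.update k v p = p + Poly_Mapping.single k v"
    using update.hyps
    by (intro poly_mapping_eqI) (auto simp: lookup_update lookup_add lookup_single when_def in_keys_iff)
  then show ?case using update.IH
    by (simp add: distrib_left distrib_right scalar_def mult_single mult.commute)
qed

lemma scalar_left_commute: "p * (scalar c * q) = scalar c * (p * q)" for p q :: "('x, 'k :: field) free"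
  by (metis mult.assoc scalar_mult_commute)

lemma scalar_simps:
  "scalar 1 = (1 :: ('x, 'k :: field) free)"
  "scalar (c * d) = (scalar c * scalar d :: ('x, 'k :: field) free)"
  "scalar (c + d) = (scalar c + scalar d :: ('x, 'k :: field) free)"
  by (simp_all add: scalar_def mult_single single_add)

lemma fword_add_eq_0_iff: "u + v = 0 \<longleftrightarrow> u = 0 \<and> v = (0 :: 'x fword)"
  by (cases u; cases v) (simp add: plus_fword_def zero_fword_def)

lemma set_letters_add: "set (letters (u + v)) = set (letters u) \<union> set (letters v)"
  by (simp add: plus_fword_def)

lemma free_algebra_closed:
  fixes p q :: "('x, 'k :: field) free"
  shows "0 \<in> free_algebra X"
    and "\<lbrakk>p \<in> free_algebra X; q \<in> free_algebra X\<rbrakk> \<Longrightarrow> p + q \<in> free_algebra X"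
    and "\<lbrakk>p \<in> free_algebra X; q \<in> free_algebra X\<rbrakk> \<Longrightarrow> p * q \<in> free_algebra X"
    and "p \<in> free_algebra X \<Longrightarrow> scalar c * p \<in> free_algebra X"
    and "p \<in> free_algebra X \<Longrightarrow> - p \<in> free_algebra X"
proof -
  show "0 \<in> free_algebra X" by (simp add: free_algebra_def)
  show "p + q \<in> free_algebra X" if "p \<in> free_algebra X" "q \<in> free_algebra X"
    using that keys_add[of p q] unfolding free_algebra_def by blast
  show "p * q \<in> free_algebra X" if "p \<in> free_algebra X" "q \<in> free_algebra X"
    using that keys_mult[of p q] unfolding free_algebra_def
    by (fastforce simp: fword_add_eq_0_iff set_letters_add)
  show "scalar c * p \<in> free_algebra X" if "p \<in> free_algebra X"
    using that keys_mult[of "scalar c" p] unfolding free_algebra_def scalar_def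
    by (fastforce split: if_splits)
  show "- p \<in> free_algebra X" if "p \<in> free_algebra X"
    using that by (simp add: free_algebra_def)
qed

lemma ideal_generated_uminus:
  "p \<in> ideal_generated A R \<Longrightarrow> - p \<in> ideal_generated A R" for p :: "('x, 'k :: field) free"
proof -
  assume "p \<in> ideal_generated A R"
  then have "scalar (-1) * p \<in> ideal_generated A R" by (rule ideal_generated.scale)
  moreover have "scalar (-1) = (-1 :: ('x, 'k) free)" by (simp add: scalar_def single_uminus)
  ultimately show ?thesis by simp
qed

lemma coset_eq_iff:
  "coset (ideal_generated A R) p = coset (ideal_generated A R) q \<longleftrightarrow> p - q \<in> ideal_generated A R"
  (is "coset ?I p = coset ?I q \<longleftrightarrow> _")
proof
  assume eq: "coset ?I p = coset ?I q"
  have "p \<in> coset ?I p" unfolding coset_def by (rule image_eqI[of _ _ 0]) (auto intro: ideal_generated.zero)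
  with eq show "p - q \<in> ?I" by (auto simp: coset_def)
next
  have sub: "coset ?I p \<subseteq> coset ?I q" if "p - q \<in> ?I" for p q
  proof
    fix x assume "x \<in> coset ?I p"
    then obtain i where "i \<in> ?I" "x = p + i" by (auto simp: coset_def)
    then show "x \<in> coset ?I q" unfolding coset_def using that
      by (intro image_eqI[of _ _ "(p - q) + i"]) (auto intro: ideal_generated.add)
  qed
  assume "p - q \<in> ?I"
  moreover have "q - p \<in> ?I" using ideal_generated_uminus[OF calculation] by simp
  ultimately show "coset ?I p = coset ?I q" using sub by blast
qed

lemma quotient_algebra_ops:
  fixes R :: "('x, 'k :: field) free set"
  assumes R: "R \<subseteq> free_algebra X"
  defines "A \<equiv> free_algebra X" and "I \<equiv> ideal_generated (free_algebra X) R"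
  assumes p: "p \<in> free_algebra X" and q: "q \<in> free_algebra X"
  shows "coset I p \<oplus>\<^bsub>quotient_algebra A I\<^esub> coset I q = coset I (p + q)"
    and "coset I p \<otimes>\<^bsub>quotient_algebra A I\<^esub> coset I q = coset I (p * q)"
    and "c \<odot>\<^bsub>quotient_algebra A I\<^esub> coset I p = coset I (scalar c * p)"
proof -
  have IA: "i \<in> free_algebra X" if "i \<in> I" for i
    using that unfolding I_def
    by induction (use R in \<open>auto intro: free_algebra_closed\<close>)
  have z: "0 \<in> I" unfolding I_def by (rule ideal_generated.zero)
  have in_coset: "r \<in> coset I s \<longleftrightarrow> r - s \<in> I" for r s
    by (auto simp: coset_def intro!: image_eqI[of _ _ "r - s"])
  have self: "r \<in> coset I r" for r by (simp add: in_coset z)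
  have UN1: "(\<Union>r\<in>coset I p. f r) = B" if "\<And>r. r \<in> coset I p \<Longrightarrow> f r = B" for f :: "_ \<Rightarrow> ('x, 'k) free set" and B p
    using that self[of p] by auto
  have a: "coset I (r + s) = coset I (p + q)" if "r \<in> coset I p" "s \<in> coset I q" for r s
  proof -
    have "(r - p) + (s - q) \<in> I"
      using that unfolding in_coset unfolding I_def by (rule ideal_generated.add)
    then show ?thesis unfolding I_def coset_eq_iff by (simp add: algebra_simps)
  qed
  have m: "coset I (r * s) = coset I (p * q)" if "r \<in> coset I p" "s \<in> coset I q" for r s
  proof -
    have rp: "r - p \<in> I" and sq: "s - q \<in> I" using that by (auto simp: in_coset)
    have "s \<in> free_algebra X" using free_algebra_closed(2)[OF IA[OF sq] q] by simp
    then have "(r - p) * s + p * (s - q) \<in> I"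
      using rp sq p unfolding I_def by (intro ideal_generated.add ideal_generated.left ideal_generated.right)
    then show ?thesis unfolding I_def coset_eq_iff by (simp add: algebra_simps)
  qed
  have s: "coset I (scalar c * r) = coset I (scalar c * p)" if "r \<in> coset I p" for r
  proof -
    have "scalar c * (r - p) \<in> I"
      using that unfolding in_coset unfolding I_def by (rule ideal_generated.scale)
    then show ?thesis unfolding I_def coset_eq_iff by (simp add: algebra_simps)
  qed
  show "coset I p \<oplus>\<^bsub>quotient_algebra A I\<^esub> coset I q = coset I (p + q)"
    unfolding quotient_algebra_def by (simp, intro UN1 a)
  show "coset I p \<otimes>\<^bsub>quotient_algebra A I\<^esub> coset I q = coset I (p * q)"
    unfolding quotient_algebra_def by (simp, intro UN1 m)
  show "c \<odot>\<^bsub>quotient_algebra A I\<^esub> coset I p = coset I (scalar c * p)"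
    unfolding quotient_algebra_def by (simp, intro UN1 s)
qed

lemma assoc_algebra_quotient_algebra:
  fixes R :: "('x, 'k :: field) free set"
  assumes R: "R \<subseteq> free_algebra X"
  shows "assoc_algebra (quotient_algebra (free_algebra X) (ideal_generated (free_algebra X) R))"
    (is "assoc_algebra ?Q")
proof -
  let ?I = "ideal_generated (free_algebra X) R"
  note ops = quotient_algebra_ops[OF R]
  have car: "x \<in> carrier ?Q \<longleftrightarrow> (\<exists>p\<in>free_algebra X. x = coset ?I p)" for x
    by (auto simp: quotient_algebra_def)
  have z: "\<zero>\<^bsub>?Q\<^esub> = coset ?I 0" by (simp add: quotient_algebra_def)
  note cl = free_algebra_closed
  have grp: "abelian_group ?Q"
  proof (rule abelian_groupI)
    fix x assume "x \<in> carrier ?Q"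
    then obtain p where p: "p \<in> free_algebra X" "x = coset ?I p" by (auto simp: car)
    then show "\<exists>y\<in>carrier ?Q. y \<oplus>\<^bsub>?Q\<^esub> x = \<zero>\<^bsub>?Q\<^esub>"
      by (intro bexI[of _ "coset ?I (- p)"]) (auto simp: car z ops cl)
  qed (auto simp: car z ops cl algebra_simps)
  show ?thesis
  proof (rule assoc_algebra.intro[OF grp], rule assoc_algebra_axioms.intro, goal_cases)
    case (11 x y c)
    then show ?case by (auto simp: car ops cl scalar_left_commute)
  qed (auto simp: car ops cl distrib_left distrib_right mult.assoc scalar_simps)
qed

lemma wlpa_relations_subset:
  assumes "wf_digraph E"
  shows "wlpa_relations E w \<subseteq> free_algebra (wlpa_gens E w)"
proof
  interpret wf_digraph E by fact
  let ?A = "free_algebra (wlpa_gens E w) :: (('a, 'b) gen, 'c) free set"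
  have diff: "p - q \<in> ?A" if "p \<in> ?A" "q \<in> ?A" for p q
    using free_algebra_closed(2)[OF that(1) free_algebra_closed(5)[OF that(2)]] by simp
  have sum: "sum f S \<in> ?A" if "\<And>x. x \<in> S \<Longrightarrow> f x \<in> ?A" for f :: "nat \<Rightarrow> _" and S
    using that by (induction S rule: infinite_finite_induct) (auto intro: free_algebra_closed)
  have sum': "sum f S \<in> ?A" if "\<And>x. x \<in> S \<Longrightarrow> f x \<in> ?A" for f :: "'b \<Rightarrow> _" and S
    using that by (induction S rule: infinite_finite_induct) (auto intro: free_algebra_closed)
  have l: "letter x \<in> ?A" if "x \<in> wlpa_gens E w" for x
    using that by (simp add: letter_def free_algebra_def zero_fword_def)
  have v: "vert u \<in> ?A" if "u \<in> verts E" for u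
    using that by (intro l) (simp add: wlpa_gens_def)
  have e: "edge w e i \<in> ?A" "ghost w e i \<in> ?A" if "e \<in> arcs E" for e i
    using that l[of "Edge e i"] l[of "Ghost e i"]
    by (auto simp: edge_def ghost_def free_algebra_closed wlpa_gens_def)
  fix r :: "(('a, 'b) gen, 'c) free" assume "r \<in> wlpa_relations E w"
  then show "r \<in> ?A"
  proof cases
    case (vertices u v)
    then have "vert u * vert v \<in> ?A" by (intro free_algebra_closed(3) v)
    then show ?thesis unfolding vertices(1)
      by (rule diff) (use vertices(2) in \<open>auto intro: v free_algebra_closed(1)\<close>)
  next
    case (source_edge f i)
    show ?thesis unfolding source_edge(1) using source_edge(2) by (intro diff free_algebra_closed(3) v e) auto
  next
    case (edge_range f i)
    show ?thesis unfolding edge_range(1) using edge_range(2) by (intro diff free_algebra_closed(3) v e) auto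
  next
    case (range_ghost f i)
    show ?thesis unfolding range_ghost(1) using range_ghost(2) by (intro diff free_algebra_closed(3) v e) auto
  next
    case (ghost_source f i)
    show ?thesis unfolding ghost_source(1) using ghost_source(2) by (intro diff free_algebra_closed(3) v e) auto
  next
    case (ghost_edge u f g)
    then have "f \<in> arcs E" "g \<in> arcs E" by auto
    then show ?thesis unfolding ghost_edge(1)
      by (intro diff sum free_algebra_closed(3) e) (simp_all add: v free_algebra_closed(1))
  next
    case (edge_ghost u i j)
    then have "u \<in> verts E" by (simp add: regular_def)
    then show ?thesis unfolding edge_ghost(1)
      by (intro diff sum' free_algebra_closed(3) e) (simp_all add: v free_algebra_closed(1))
  qed
qed

lemma assoc_algebra_wlpa: "wf_digraph E \<Longrightarrow> assoc_algebra (wlpa K E w)"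
  unfolding wlpa_def wlpa_ideal_def
  by (rule assoc_algebra_quotient_algebra[OF wlpa_relations_subset])

end

theory Submission
  imports Defs
begin

text \<open>
  Let \<open>e\<close> be an edge of weight \<open>k > 1\<close> from \<open>v\<close> to \<open>x\<close>. By (LPA1) every other edge \<open>f\<close> emitted by
  \<open>v\<close> has weight 1, so that the defining relations read
  \<open>e\<^sub>i e\<^sub>j\<^sup>* = \<delta>\<^sub>i\<^sub>j v\<close> unless \<open>i = j = 1\<close>, further \<open>e\<^sub>1 e\<^sub>1\<^sup>* + \<Sum> f f\<^sup>* = v\<close>, and
  \<open>\<Sum> e\<^sub>i\<^sup>* e\<^sub>i = x\<close>. If \<open>e\<^sub>i\<^sup>*\<close> is read as an edge from \<open>x\<close> to \<open>v\<close>, these are the relations of an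
  unweighted Leavitt path algebra at a vertex \<open>x\<close> that emits \<open>k\<close> edges, with one defect: \<open>e\<^sub>1\<^sup>*\<close> does
  not end at \<open>v\<close> but at the smaller idempotent \<open>e\<^sub>1 e\<^sub>1\<^sup>*\<close>. Splitting \<open>v\<close> into the two pieces
  \<open>e\<^sub>1 e\<^sub>1\<^sup>*\<close> and \<open>v - e\<^sub>1 e\<^sub>1\<^sup>*\<close> repairs this: \<open>e\<^sub>1\<^sup>*\<close> ends at the first piece, the other edges emitted by
  \<open>v\<close> start at the second one, and every other edge that ends at \<open>v\<close> (reversed or not) is cut into one edge
  for each piece. The graph \<open>F\<close> arises in this way.

  Since \<open>x\<close> now emits the reversed edges, any edge of \<open>E\<close> emitted by \<open>x\<close> has to be
  reversed too. The edges to be reversed, called special, are therefore the weighted ones and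
  those that start in \<open>T(r(E\<^sub>w))\<close>. The construction makes sense because condition (LPA) forces the
  special edges to form disjoint lines and cycles: a vertex emits at most one of them
  (\<open>special_tail_unique\<close>, from (LPA1) and (LPA2)), receives at most one of them
  (\<open>special_head_unique\<close>, from (LPA2), (LPA3) and (LPA4)), and if it receives one then all the edges
  that it emits are special (\<open>special_after_special\<close>).

  The two assignments \<open>to_unweighted\<close> and \<open>to_weighted\<close> of generators respect the defining
  relations and are inverse to each other, so that the algebras are isomorphic
  (\<open>presentation_iso\<close>). The relations of the weighted algebra are homogeneous, hence its standard
  grading is a grading (\<open>graded_algebra_quotient\<close>); its image under the isomorphism is the required
  grading of \<open>L\<^sub>K(F)\<close>.
\<close>

section \<open>Substitution homomorphisms between free algebras\<close>

lemma keys_subset_induct [consumes 1, case_names zero single add]: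
  fixes p :: "'a \<Rightarrow>\<^sub>0 'b :: comm_monoid_add"
  assumes "Poly_Mapping.keys p \<subseteq> U"
    and "P 0"
    and "\<And>u c. u \<in> U \<Longrightarrow> P (Poly_Mapping.single u c)"
    and "\<And>p q. \<lbrakk>P p; P q\<rbrakk> \<Longrightarrow> P (p + q)"
  shows "P p"
  using assms(1)
proof (induction p rule: update_induct)
  case const
  show ?case by (rule assms(2))
next
  case (update p k v)
  have "Poly_Mapping.update k v p = p + Poly_Mapping.single k v"
    using update.hyps
    by (intro poly_mapping_eqI) (auto simp: lookup_update lookup_add lookup_single when_def in_keys_iff)
  moreover have "Poly_Mapping.keys (Poly_Mapping.update k v p) = insert k (Poly_Mapping.keys p)"
    using update.hyps by (simp add: keys_update)
  ultimately show ?case using update assms(3,4) by auto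
qed

definition substitute :: "('x \<Rightarrow> ('y, 'k :: field) free) \<Rightarrow> ('x, 'k) free \<Rightarrow> ('y, 'k) free" where
  "substitute \<sigma> p =
     (\<Sum>u\<in>Poly_Mapping.keys p. scalar (Poly_Mapping.lookup p u) * prod_list (map \<sigma> (letters u)))"

lemma scalar_0 [simp]: "scalar 0 = 0"
  by (simp add: scalar_def)

lemma substitute_superset:
  assumes "finite U" "Poly_Mapping.keys p \<subseteq> U"
  shows "substitute \<sigma> p =
    (\<Sum>u\<in>U. scalar (Poly_Mapping.lookup p u) * prod_list (map \<sigma> (letters u)))"
  unfolding substitute_def using assms
  by (intro sum.mono_neutral_left) (auto simp: in_keys_iff)

lemma substitute_0 [simp]: "substitute \<sigma> 0 = 0"
  by (simp add: substitute_def)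

lemma substitute_add [simp]: "substitute \<sigma> (p + q) = substitute \<sigma> p + substitute \<sigma> q"
proof -
  let ?U = "Poly_Mapping.keys p \<union> Poly_Mapping.keys q"
  have "Poly_Mapping.keys (p + q) \<subseteq> ?U" by (rule keys_add)
  then show ?thesis
    by (simp add: substitute_superset[of ?U] lookup_add scalar_simps distrib_right sum.distrib)
qed

lemma substitute_single:
  "substitute \<sigma> (Poly_Mapping.single u c) = scalar c * prod_list (map \<sigma> (letters u))"
  by (cases "c = 0") (simp_all add: substitute_def)

lemma substitute_letter [simp]: "substitute \<sigma> (letter x) = \<sigma> x"
  by (simp add: letter_def substitute_single scalar_simps)

lemma substitute_scalar [simp]: "substitute \<sigma> (scalar c) = scalar c"
  by (simp add: scalar_def[of c] substitute_single zero_fword_def) 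

lemma substitute_1 [simp]: "substitute \<sigma> 1 = 1"
  using substitute_scalar[of \<sigma> 1] by (simp add: scalar_simps)

lemma substitute_uminus [simp]: "substitute \<sigma> (- p) = - substitute \<sigma> p"
  using substitute_add[of \<sigma> p "- p"] by (simp add: eq_neg_iff_add_eq_0 add.commute)

lemma substitute_diff [simp]: "substitute \<sigma> (p - q) = substitute \<sigma> p - substitute \<sigma> q"
  using substitute_add[of \<sigma> p "- q"] by simp

lemma substitute_sum [simp]: "substitute \<sigma> (sum f S) = (\<Sum>i\<in>S. substitute \<sigma> (f i))"
  by (induction S rule: infinite_finite_induct) auto

lemma substitute_mult [simp]: "substitute \<sigma> (p * q) = substitute \<sigma> p * substitute \<sigma> q"
proof (rule keys_subset_induct[of p UNIV], goal_cases)
  case (3 u c)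
  show ?case
  proof (rule keys_subset_induct[of q UNIV], goal_cases)
    case (3 v d)
    have "(scalar c * scalar d) * (prod_list (map \<sigma> (letters u)) * prod_list (map \<sigma> (letters v)))
        = (scalar c * prod_list (map \<sigma> (letters u))) * (scalar d * prod_list (map \<sigma> (letters v)))"
      by (simp add: mult.assoc scalar_left_commute[of "prod_list (map \<sigma> (letters u))"])
    then show ?case
      by (simp add: mult_single substitute_single plus_fword_def scalar_simps)
  qed (simp_all add: distrib_left)
qed (simp_all add: distrib_right)

lemma single_conv_prod_list:
  "Poly_Mapping.single (FWord xs) c = scalar c * prod_list (map letter xs)"
proof -
  have "prod_list (map letter xs) = (Poly_Mapping.single (FWord xs) 1 :: ('a, 'b) free)"
    by (induction xs)
      (auto simp: letter_def mult_single plus_fword_def simp flip: zero_fword_def)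
  then show ?thesis by (simp add: scalar_def mult_single)
qed

lemma free_algebra_sum: "(\<And>i. i \<in> S \<Longrightarrow> f i \<in> free_algebra X) \<Longrightarrow> sum f S \<in> free_algebra X"
  by (induction S rule: infinite_finite_induct) (auto intro: free_algebra_closed)

lemma free_algebra_diff:
  "p \<in> free_algebra X \<Longrightarrow> q \<in> free_algebra X \<Longrightarrow> p - q \<in> free_algebra X"
  using free_algebra_closed(2)[of p X "- q"] free_algebra_closed(5)[of q X] by simp

lemma letter_in_free_algebra [simp]: "letter x \<in> free_algebra X \<longleftrightarrow> x \<in> X"
  by (simp add: letter_def free_algebra_def zero_fword_def)

lemma free_algebra_induct [consumes 1, case_names zero word add]:
  assumes "p \<in> free_algebra X"
    and "P 0"
    and "\<And>xs c. \<lbrakk>xs \<noteq> []; set xs \<subseteq> X\<rbrakk> \<Longrightarrow> P (scalar c * prod_list (map letter xs))"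
    and "\<And>p q. \<lbrakk>P p; P q\<rbrakk> \<Longrightarrow> P (p + q)"
  shows "P p"
proof (rule keys_subset_induct[of p "{u. u \<noteq> 0 \<and> set (letters u) \<subseteq> X}"])
  show "Poly_Mapping.keys p \<subseteq> {u. u \<noteq> 0 \<and> set (letters u) \<subseteq> X}"
    using assms(1) by (auto simp: free_algebra_def)
next
  fix u c assume "u \<in> {u. u \<noteq> 0 \<and> set (letters u) \<subseteq> X}"
  then show "P (Poly_Mapping.single u c)"
    using assms(3)[of "letters u" c] by (cases u) (auto simp: zero_fword_def single_conv_prod_list)
qed (use assms in auto)

lemma prod_list_in_free_algebra:
  "xs \<noteq> [] \<Longrightarrow> (\<And>x. x \<in> set xs \<Longrightarrow> f x \<in> free_algebra Y) \<Longrightarrow>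
   prod_list (map f xs) \<in> free_algebra Y"
proof (induction xs rule: list_nonempty_induct)
  case (single x)
  then show ?case by simp
next
  case (cons x xs)
  then show ?case by (auto intro: free_algebra_closed)
qed

lemma substitute_in_free_algebra:
  assumes "p \<in> free_algebra X" and "\<And>x. x \<in> X \<Longrightarrow> \<sigma> x \<in> free_algebra Y"
  shows "substitute \<sigma> p \<in> free_algebra Y"
  using assms(1)
proof (induction rule: free_algebra_induct)
  case zero
  then show ?case by (simp add: free_algebra_closed)
next
  case (word xs c)
  have "substitute \<sigma> (prod_list (map letter xs)) = prod_list (map \<sigma> xs)"
    using substitute_single[of \<sigma> "FWord xs" 1] by (simp add: single_conv_prod_list scalar_simps)
  moreover have "prod_list (map \<sigma> xs) \<in> free_algebra Y"
    using word assms(2) by (intro prod_list_in_free_algebra) auto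
  ultimately show ?case by (simp add: free_algebra_closed(4))
qed (auto intro: free_algebra_closed)


section \<open>Congruence modulo a presentation\<close>

definition restrict_letters :: "'x set \<Rightarrow> ('x, 'k :: field) free \<Rightarrow> ('x, 'k) free" where
  "restrict_letters X = substitute (\<lambda>x. if x \<in> X then letter x else 0)"

text \<open>
  Erasing the words with a letter outside \<open>X\<close> extends congruence modulo the ideal from
  \<open>free_algebra X\<close> to all elements of the free unital algebra. The result is a congruence of the
  whole unital ring, and calculations with it carry no membership side conditions.
\<close>

definition pcong :: "'x set \<Rightarrow> ('x, 'k :: field) free set \<Rightarrow> ('x, 'k) free \<Rightarrow> ('x, 'k) free \<Rightarrow> bool"
  where "pcong X R p q \<longleftrightarrow>
    restrict_letters X p - restrict_letters X q \<in> ideal_generated (free_algebra X) R"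

lemma restrict_letters_id: "p \<in> free_algebra X \<Longrightarrow> restrict_letters X p = p"
proof (induction rule: free_algebra_induct)
  case (word xs c)
  have "prod_list (map (\<lambda>x. if x \<in> X then letter x else 0) xs)
      = (prod_list (map letter xs) :: ('a, 'b) free)"
    using word by (intro arg_cong[of _ _ prod_list] map_cong) auto
  then show ?case unfolding restrict_letters_def
    using substitute_single[of "\<lambda>x. if x \<in> X then letter x else 0" "FWord xs" c]
    by (simp add: single_conv_prod_list)
qed (auto simp: restrict_letters_def)

text \<open>
  The ideal is closed under multiplication by elements of \<open>free_algebra X\<close>, which contains no
  constants; constants are harmless, because the ideal is also closed under scaling.
\<close>

lemma restrict_letters_decomp:
  fixes p :: "('x, 'k :: field) free"
  shows "\<exists>c a. a \<in> free_algebra X \<and> restrict_letters X p = scalar c + a"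
proof (rule keys_subset_induct[of p UNIV], goal_cases)
  case 2
  then show ?case
    by (rule exI[of _ 0], rule exI[of _ 0]) (simp add: restrict_letters_def free_algebra_closed)
next
  case (3 u c)
  show ?case
  proof (cases "u = 0")
    case True
    then show ?thesis
      by (intro exI[of _ c] exI[of _ 0])
        (simp add: restrict_letters_def free_algebra_closed flip: scalar_def)
  next
    case False
    then have "prod_list (map (\<lambda>x. if x \<in> X then letter x else 0) (letters u))
        \<in> (free_algebra X :: ('x, 'k) free set)"
      by (intro prod_list_in_free_algebra)
        (cases u, auto simp: zero_fword_def free_algebra_closed(1))
    then have "restrict_letters X (Poly_Mapping.single u c) \<in> free_algebra X"
      by (simp add: restrict_letters_def substitute_single free_algebra_closed(4))
    moreover have "restrict_letters X (Poly_Mapping.single u c)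
        = scalar 0 + restrict_letters X (Poly_Mapping.single u c)" by simp
    ultimately show ?thesis by blast
  qed
next
  case (4 p q)
  then obtain c a d b where "a \<in> free_algebra X" "restrict_letters X p = scalar c + a"
    "b \<in> free_algebra X" "restrict_letters X q = scalar d + b" by blast
  then show ?case
    by (intro exI[of _ "c + d"] exI[of _ "a + b"])
      (auto simp: restrict_letters_def scalar_simps free_algebra_closed)
qed auto

lemma restrict_mult_ideal:
  assumes "i \<in> ideal_generated (free_algebra X) R"
  shows "restrict_letters X p * i \<in> ideal_generated (free_algebra X) R"
    and "i * restrict_letters X p \<in> ideal_generated (free_algebra X) R"
proof -
  obtain c a where a: "a \<in> free_algebra X" "restrict_letters X p = scalar c + a"
    using restrict_letters_decomp by blast
  have "scalar c * i + a * i \<in> ideal_generated (free_algebra X) R"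
    using assms a by (intro ideal_generated.add ideal_generated.scale ideal_generated.left)
  then show "restrict_letters X p * i \<in> ideal_generated (free_algebra X) R"
    by (simp add: a distrib_right)
  have "scalar c * i + i * a \<in> ideal_generated (free_algebra X) R"
    using assms a by (intro ideal_generated.add ideal_generated.scale ideal_generated.right)
  then show "i * restrict_letters X p \<in> ideal_generated (free_algebra X) R"
    by (simp add: a distrib_left scalar_mult_commute)
qed

lemma pcong_refl [simp, intro!]: "pcong X R p p"
  by (simp add: pcong_def ideal_generated.zero)

lemma pcong_sym: "pcong X R p q \<Longrightarrow> pcong X R q p"
  unfolding pcong_def using ideal_generated_uminus by fastforce

lemma pcong_trans [trans]: "pcong X R p q \<Longrightarrow> pcong X R q r \<Longrightarrow> pcong X R p r"
  unfolding pcong_def using ideal_generated.add by fastforce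

lemma pcong_add: "pcong X R p q \<Longrightarrow> pcong X R p' q' \<Longrightarrow> pcong X R (p + p') (q + q')"
  unfolding pcong_def restrict_letters_def using ideal_generated.add
  by (fastforce simp: algebra_simps)

lemma pcong_uminus: "pcong X R p q \<Longrightarrow> pcong X R (- p) (- q)"
  unfolding pcong_def restrict_letters_def
  using ideal_generated_uminus by fastforce

lemma pcong_diff: "pcong X R p q \<Longrightarrow> pcong X R p' q' \<Longrightarrow> pcong X R (p - p') (q - q')"
  using pcong_add[OF _ pcong_uminus] by fastforce

lemma pcong_sum: "(\<And>i. i \<in> S \<Longrightarrow> pcong X R (f i) (g i)) \<Longrightarrow> pcong X R (sum f S) (sum g S)"
  by (induction S rule: infinite_finite_induct) (auto intro: pcong_add)

lemma pcong_mult: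
  assumes "pcong X R p q" "pcong X R p' q'"
  shows "pcong X R (p * p') (q * q')"
proof -
  let ?\<rho> = "restrict_letters X"
  have "?\<rho> (p * p') - ?\<rho> (q * q') = ?\<rho> p * (?\<rho> p' - ?\<rho> q') + (?\<rho> p - ?\<rho> q) * ?\<rho> q'"
    by (simp add: restrict_letters_def algebra_simps)
  then show ?thesis using assms unfolding pcong_def
    by (simp add: ideal_generated.add restrict_mult_ideal)
qed

lemma pcong_prod_list:
  "(\<And>x. x \<in> set xs \<Longrightarrow> pcong X R (f x) (g x)) \<Longrightarrow>
   pcong X R (prod_list (map f xs)) (prod_list (map g xs))"
  by (induction xs) (auto intro: pcong_mult)

lemma pcong_iff:
  "p \<in> free_algebra X \<Longrightarrow> q \<in> free_algebra X \<Longrightarrow>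
   pcong X R p q \<longleftrightarrow> p - q \<in> ideal_generated (free_algebra X) R"
  by (simp add: pcong_def restrict_letters_id)

lemma pcong_relation:
  assumes "R \<subseteq> free_algebra X" "p - q \<in> R"
  shows "pcong X R p q"
proof -
  have "restrict_letters X (p - q) = p - q" using assms by (intro restrict_letters_id) auto
  then have "restrict_letters X p - restrict_letters X q = p - q"
    by (simp add: restrict_letters_def)
  then show ?thesis using assms by (simp add: pcong_def ideal_generated.base)
qed

lemma pcong_letter_outside: "x \<notin> X \<Longrightarrow> pcong X R (letter x) 0"
  by (simp add: pcong_def restrict_letters_def ideal_generated.zero)

lemma substitute_ideal:
  assumes R: "R \<subseteq> free_algebra X" and R': "R' \<subseteq> free_algebra Y"
    and \<sigma>: "\<And>x. x \<in> X \<Longrightarrow> \<sigma> x \<in> free_algebra Y"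
    and rel: "\<And>r. r \<in> R \<Longrightarrow> pcong Y R' (substitute \<sigma> r) 0"
    and "p \<in> ideal_generated (free_algebra X) R"
  shows "substitute \<sigma> p \<in> ideal_generated (free_algebra Y) R'"
  using assms(5)
proof induction
  case (base r)
  then have "substitute \<sigma> r \<in> free_algebra Y" using R by (auto intro: substitute_in_free_algebra \<sigma>)
  with rel[OF base] show ?case by (simp add: pcong_iff free_algebra_closed(1))
qed (auto intro: ideal_generated.intros substitute_in_free_algebra \<sigma>)

lemma substitute_substitute_pcong:
  assumes "\<And>x. x \<in> X \<Longrightarrow> pcong X R (substitute \<tau> (\<sigma> x)) (letter x)"
    and "p \<in> free_algebra X"
  shows "pcong X R (substitute \<tau> (substitute \<sigma> p)) p"
  using assms(2)
proof (induction rule: free_algebra_induct)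
  case (word xs c)
  have *: "substitute \<tau> (substitute \<sigma> (prod_list (map letter xs)))
      = prod_list (map (\<lambda>x. substitute \<tau> (\<sigma> x)) xs)" for xs
    by (induction xs) auto
  have "pcong X R (prod_list (map (\<lambda>x. substitute \<tau> (\<sigma> x)) xs)) (prod_list (map letter xs))"
    using word assms(1) by (intro pcong_prod_list) auto
  then show ?case by (auto simp: * intro: pcong_mult)
qed (auto intro: pcong_add)

text \<open>
  A substitution that sends relations to relations descends to the quotients. Two of them are
  mutually inverse as soon as they are so on letters, because congruence is compatible with
  products.
\<close>

theorem presentation_iso:
  fixes R :: "('x, 'k :: field) free set" and R' :: "('y, 'k) free set"
  assumes R: "R \<subseteq> free_algebra X" and R': "R' \<subseteq> free_algebra Y"
    and \<sigma>: "\<And>x. x \<in> X \<Longrightarrow> \<sigma> x \<in> free_algebra Y"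
    and \<tau>: "\<And>y. y \<in> Y \<Longrightarrow> \<tau> y \<in> free_algebra X"
    and \<sigma>_rel: "\<And>r. r \<in> R \<Longrightarrow> pcong Y R' (substitute \<sigma> r) 0"
    and \<tau>_rel: "\<And>r. r \<in> R' \<Longrightarrow> pcong X R (substitute \<tau> r) 0"
    and \<tau>\<sigma>: "\<And>x. x \<in> X \<Longrightarrow> pcong X R (substitute \<tau> (\<sigma> x)) (letter x)"
    and \<sigma>\<tau>: "\<And>y. y \<in> Y \<Longrightarrow> pcong Y R' (substitute \<sigma> (\<tau> y)) (letter y)"
  shows "algebra_iso (quotient_algebra (free_algebra X) (ideal_generated (free_algebra X) R))
           (quotient_algebra (free_algebra Y) (ideal_generated (free_algebra Y) R')) \<noteq> {}"
proof -
  let ?I = "ideal_generated (free_algebra X) R" and ?J = "ideal_generated (free_algebra Y) R'"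
  let ?A = "quotient_algebra (free_algebra X) ?I" and ?B = "quotient_algebra (free_algebra Y) ?J"
  define \<phi> where "\<phi> P = coset ?J (substitute \<sigma> (SOME p. p \<in> free_algebra X \<and> P = coset ?I p))" for P
  have \<sigma>_closed: "substitute \<sigma> p \<in> free_algebra Y" if "p \<in> free_algebra X" for p
    using that \<sigma> by (rule substitute_in_free_algebra)
  have \<tau>_closed: "substitute \<tau> p \<in> free_algebra X" if "p \<in> free_algebra Y" for p
    using that \<tau> by (rule substitute_in_free_algebra)
  have \<phi>: "\<phi> (coset ?I p) = coset ?J (substitute \<sigma> p)" if p: "p \<in> free_algebra X" for p
  proof -
    define q where "q = (SOME q. q \<in> free_algebra X \<and> coset ?I p = coset ?I q)"
    have "q \<in> free_algebra X \<and> coset ?I p = coset ?I q"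
      unfolding q_def by (rule someI[of _ p]) (simp add: p)
    then have "substitute \<sigma> (p - q) \<in> ?J"
      using substitute_ideal[OF R R' \<sigma> \<sigma>_rel] by (simp only: coset_eq_iff)
    then show ?thesis unfolding \<phi>_def q_def[symmetric]
      by (auto simp: coset_eq_iff dest: ideal_generated_uminus)
  qed
  have car: "carrier ?A = coset ?I ` free_algebra X" "carrier ?B = coset ?J ` free_algebra Y"
    by (simp_all add: quotient_algebra_def)
  have "bij_betw \<phi> (carrier ?A) (carrier ?B)"
  proof (rule bij_betw_imageI)
    show "inj_on \<phi> (carrier ?A)"
    proof (rule inj_onI)
      fix P Q assume "P \<in> carrier ?A" "Q \<in> carrier ?A" and eq: "\<phi> P = \<phi> Q"
      then obtain p q where p: "p \<in> free_algebra X" "P = coset ?I p"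
        and q: "q \<in> free_algebra X" "Q = coset ?I q" by (auto simp: car)
      from eq p q have "substitute \<sigma> p - substitute \<sigma> q \<in> ?J"
        by (simp add: \<phi> coset_eq_iff)
      then have "substitute \<tau> (substitute \<sigma> p - substitute \<sigma> q) \<in> ?I"
        by (intro substitute_ideal[OF R' R] \<tau> \<tau>_rel)
      then have "pcong X R (substitute \<tau> (substitute \<sigma> p)) (substitute \<tau> (substitute \<sigma> q))"
        using p q by (simp add: pcong_iff \<sigma>_closed \<tau>_closed)
      then have "pcong X R p q"
        using substitute_substitute_pcong[OF \<tau>\<sigma>] p q by (meson pcong_sym pcong_trans)
      then show "P = Q" using p q by (simp add: pcong_iff coset_eq_iff)
    qed
    show "\<phi> ` carrier ?A = carrier ?B"
    proof (intro equalityI subsetI)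
      fix Q assume "Q \<in> \<phi> ` carrier ?A"
      then show "Q \<in> carrier ?B" by (auto simp: car \<phi> \<sigma>_closed)
    next
      fix Q assume "Q \<in> carrier ?B"
      then obtain q where q: "q \<in> free_algebra Y" "Q = coset ?J q" by (auto simp: car)
      have "pcong Y R' (substitute \<sigma> (substitute \<tau> q)) q"
        using substitute_substitute_pcong[OF \<sigma>\<tau>] q by blast
      then have "\<phi> (coset ?I (substitute \<tau> q)) = Q"
        using q by (simp add: \<phi> \<tau>_closed \<sigma>_closed pcong_iff coset_eq_iff)
      then show "Q \<in> \<phi> ` carrier ?A" using q by (auto simp: car \<tau>_closed)
    qed
  qed
  then have "\<phi> \<in> algebra_iso ?A ?B"
    unfolding algebra_iso_def car
    by (auto simp: \<phi> quotient_algebra_ops[OF R] quotient_algebra_ops(1,2)[OF R']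
        quotient_algebra_ops(3)[OF R' _ free_algebra_closed(1)] free_algebra_closed \<sigma>_closed)
  then show ?thesis by blast
qed


section \<open>Gradings\<close>

definition homogeneous_part :: "('a \<Rightarrow> 'g) \<Rightarrow> 'g \<Rightarrow> ('a \<Rightarrow>\<^sub>0 'b) \<Rightarrow> ('a \<Rightarrow>\<^sub>0 'b :: comm_monoid_add)" where
  "homogeneous_part d g p =
     (\<Sum>u\<in>{u \<in> Poly_Mapping.keys p. d u = g}. Poly_Mapping.single u (Poly_Mapping.lookup p u))"

lemma lookup_homogeneous_part:
  "Poly_Mapping.lookup (homogeneous_part d g p) u = (if d u = g then Poly_Mapping.lookup p u else 0)"
proof -
  have "Poly_Mapping.lookup (homogeneous_part d g p) u
      = (\<Sum>v\<in>{v \<in> Poly_Mapping.keys p. d v = g}. if v = u then Poly_Mapping.lookup p v else 0)"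
    unfolding homogeneous_part_def lookup_sum by (intro sum.cong) (auto simp: lookup_single when_def)
  also have "\<dots> = (if d u = g then Poly_Mapping.lookup p u else 0)"
    by (simp add: sum.delta' in_keys_iff)
  finally show ?thesis .
qed

lemma keys_homogeneous_part: "Poly_Mapping.keys (homogeneous_part d g p) = {u \<in> Poly_Mapping.keys p. d u = g}"
  by (auto simp: in_keys_iff lookup_homogeneous_part split: if_splits)

lemma homogeneous_part_0 [simp]: "homogeneous_part d g 0 = 0"
  by (simp add: homogeneous_part_def)

lemma homogeneous_part_add: "homogeneous_part d g (p + q) = homogeneous_part d g p + homogeneous_part d g q"
  by (rule poly_mapping_eqI) (simp add: lookup_homogeneous_part lookup_add)

lemma homogeneous_part_diff:
  fixes p q :: "'a \<Rightarrow>\<^sub>0 'b :: ab_group_add"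
  shows "homogeneous_part d g (p - q) = homogeneous_part d g p - homogeneous_part d g q"
  by (rule poly_mapping_eqI) (simp add: lookup_homogeneous_part lookup_minus)

lemma homogeneous_part_sum: "homogeneous_part d g (sum f S) = (\<Sum>i\<in>S. homogeneous_part d g (f i))"
  by (induction S rule: infinite_finite_induct) (auto simp: homogeneous_part_add)

lemma homogeneous_part_single: "homogeneous_part d g (Poly_Mapping.single u c) =
    (if d u = g then Poly_Mapping.single u c else 0)"
  by (rule poly_mapping_eqI) (auto simp: lookup_homogeneous_part lookup_single when_def)

lemma homogeneous_part_of_homogeneous:
  "\<forall>u\<in>Poly_Mapping.keys p. d u = h \<Longrightarrow> homogeneous_part d g p = (if g = h then p else 0)"
  by (rule poly_mapping_eqI) (auto simp: lookup_homogeneous_part in_keys_iff)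

lemma homogeneous_part_eq_0: "g \<notin> d ` Poly_Mapping.keys p \<Longrightarrow> homogeneous_part d g p = 0"
  unfolding homogeneous_part_def by (rule sum.neutral) auto

lemma sum_homogeneous_parts:
  assumes "finite S" "d ` Poly_Mapping.keys p \<subseteq> S"
  shows "(\<Sum>g\<in>S. homogeneous_part d g p) = p"
proof (rule poly_mapping_eqI)
  fix u
  have "Poly_Mapping.lookup p u = 0" if "d u \<notin> S"
    using assms(2) that by (meson image_subset_iff in_keys_iff)
  then have "(\<Sum>g\<in>S. if d u = g then Poly_Mapping.lookup p u else 0) = Poly_Mapping.lookup p u"
    using assms(1) by simp
  then show "Poly_Mapping.lookup (\<Sum>g\<in>S. homogeneous_part d g p) u = Poly_Mapping.lookup p u"
    by (simp add: lookup_sum lookup_homogeneous_part)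
qed

text \<open>
  The degree \<open>wdeg\<close> of words is determined by the degrees of the letters; as a parameter it can be
  instantiated by a function that is already at hand.
\<close>

locale homogeneous_presentation =
  fixes X :: "'x set" and R :: "('x, 'k :: field) free set" and n :: nat
    and deg :: "'x \<Rightarrow> int vec" and wdeg :: "'x fword \<Rightarrow> int vec"
  assumes R_subset: "R \<subseteq> free_algebra X"
    and deg_carrier: "deg x \<in> carrier_vec n"
    and wdeg_def: "wdeg u = foldr (\<lambda>x g. deg x + g) (letters u) (0\<^sub>v n)"
    and R_homogeneous: "r \<in> R \<Longrightarrow> \<exists>g. \<forall>u\<in>Poly_Mapping.keys r. wdeg u = g"
begin

abbreviation "I \<equiv> ideal_generated (free_algebra X) R"
abbreviation "Q \<equiv> quotient_algebra (free_algebra X) I"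
abbreviation "part \<equiv> homogeneous_part wdeg"

definition component :: "int vec \<Rightarrow> ('x, 'k) free set set" where
  "component g = coset I ` {p \<in> free_algebra X. \<forall>u\<in>Poly_Mapping.keys p. wdeg u = g}"

lemma wdeg_carrier [simp]: "wdeg u \<in> carrier_vec n"
proof -
  have "foldr (\<lambda>x g. deg x + g) xs (0\<^sub>v n) \<in> carrier_vec n" for xs
    by (induction xs) (auto simp: deg_carrier)
  then show ?thesis by (simp add: wdeg_def)
qed

lemma wdeg_add: "wdeg (u + v) = wdeg u + wdeg v"
proof -
  have "foldr (\<lambda>x g. deg x + g) xs h = foldr (\<lambda>x g. deg x + g) xs (0\<^sub>v n) + h
      \<and> foldr (\<lambda>x g. deg x + g) xs (0\<^sub>v n) \<in> carrier_vec n"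
    if "h \<in> carrier_vec n" for xs h
    using that by (induction xs) (auto simp: deg_carrier assoc_add_vec[of _ n])
  from this[OF wdeg_carrier[of v], of "letters u"] show ?thesis
    by (simp add: wdeg_def plus_fword_def)
qed

lemma wdeg_0: "wdeg 0 = 0\<^sub>v n"
  by (simp add: wdeg_def zero_fword_def)

lemma shift_degree_iff:
  "g \<in> carrier_vec n \<Longrightarrow> a \<in> carrier_vec n \<Longrightarrow> b \<in> carrier_vec n \<Longrightarrow>
   a + b = g \<longleftrightarrow> b = g - (a :: int vec)"
  "g \<in> carrier_vec n \<Longrightarrow> a \<in> carrier_vec n \<Longrightarrow> b \<in> carrier_vec n \<Longrightarrow>
   b + a = g \<longleftrightarrow> b = g - (a :: int vec)"
  by (auto simp: vec_eq_iff)

lemma part_single_mult: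
  assumes "g \<in> carrier_vec n"
  shows "part g (Poly_Mapping.single u c * p) = Poly_Mapping.single u c * part (g - wdeg u) p"
    and "part g (p * Poly_Mapping.single u c) = part (g - wdeg u) p * Poly_Mapping.single u c"
proof -
  show "part g (Poly_Mapping.single u c * p) = Poly_Mapping.single u c * part (g - wdeg u) p"
    by (rule keys_subset_induct[of p UNIV])
      (use assms in \<open>auto simp: mult_single homogeneous_part_single homogeneous_part_add wdeg_add
        distrib_left shift_degree_iff\<close>)
  show "part g (p * Poly_Mapping.single u c) = part (g - wdeg u) p * Poly_Mapping.single u c"
    by (rule keys_subset_induct[of p UNIV])
      (use assms in \<open>auto simp: mult_single homogeneous_part_single homogeneous_part_add wdeg_add
        distrib_right shift_degree_iff\<close>)
qed

lemma part_in_free_algebra: "p \<in> free_algebra X \<Longrightarrow> part g p \<in> free_algebra X"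
  by (auto simp: free_algebra_def keys_homogeneous_part)

text \<open>
  Multiplication by a word shifts degrees by a constant. Thus each way to build elements of the
  ideal is compatible with taking homogeneous parts, and the generators are homogeneous.
\<close>

lemma part_ideal:
  assumes "p \<in> I" "g \<in> carrier_vec n"
  shows "part g p \<in> I"
  using assms
proof (induction arbitrary: g)
  case (base r)
  then obtain h where "\<forall>u\<in>Poly_Mapping.keys r. wdeg u = h" using R_homogeneous by blast
  then have "part g r = (if g = h then r else 0)" by (rule homogeneous_part_of_homogeneous)
  then show ?case using base by (simp add: ideal_generated.intros)
next
  case (scale p c)
  have "g - wdeg 0 = g" using scale.prems by (simp add: wdeg_0)
  then have "part g (scalar c * p) = scalar c * part g p"
    using part_single_mult(1)[OF scale.prems, of 0 c p] by (simp add: scalar_def)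
  then show ?case using scale by (simp add: ideal_generated.scale)
next
  case (left a p)
  from left.hyps(1) show ?case
  proof (induction rule: free_algebra_induct)
    case (word xs c)
    have "Poly_Mapping.single (FWord xs) c \<in> free_algebra X"
      using word by (simp add: free_algebra_def zero_fword_def)
    then show ?case using left.IH[of "g - wdeg (FWord xs)"] left.prems
      by (simp add: part_single_mult ideal_generated.left flip: single_conv_prod_list)
  qed (auto simp: distrib_right homogeneous_part_add intro: ideal_generated.intros)
next
  case (right a p)
  from right.hyps(1) show ?case
  proof (induction rule: free_algebra_induct)
    case (word xs c)
    have "Poly_Mapping.single (FWord xs) c \<in> free_algebra X"
      using word by (simp add: free_algebra_def zero_fword_def)
    then show ?case using right.IH[of "g - wdeg (FWord xs)"] right.prems
      by (simp add: part_single_mult ideal_generated.right flip: single_conv_prod_list)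
  qed (auto simp: distrib_left homogeneous_part_add intro: ideal_generated.intros)
qed (auto simp: homogeneous_part_add intro: ideal_generated.intros)

lemma finsum_coset:
  assumes "finite S" "\<And>g. g \<in> S \<Longrightarrow> f g \<in> free_algebra X"
  shows "(\<Oplus>\<^bsub>Q\<^esub>g\<in>S. coset I (f g)) = coset I (sum f S)"
proof -
  interpret Q: assoc_algebra Q by (rule assoc_algebra_quotient_algebra[OF R_subset])
  have car: "coset I p \<in> carrier Q" if "p \<in> free_algebra X" for p
    using that by (simp add: quotient_algebra_def)
  show ?thesis using assms
  proof (induction S rule: finite_induct)
    case empty
    show ?case unfolding Q.finsum_empty by (simp add: quotient_algebra_def)
  next
    case (insert g S)
    then have "sum f S \<in> free_algebra X" by (intro free_algebra_sum) auto
    with insert show ?case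
      by (subst Q.finsum_insert) (auto simp: car quotient_algebra_ops(1)[OF R_subset])
  qed
qed

text \<open>
  A coset is decomposed by decomposing a representative. The decomposition is unique because the
  difference of two representatives lies in the ideal, and hence so do its homogeneous parts.
\<close>

theorem graded_algebra_quotient: "graded_algebra n Q component"
proof -
  interpret Q: assoc_algebra Q by (rule assoc_algebra_quotient_algebra[OF R_subset])
  have car: "carrier Q = coset I ` free_algebra X" and zero: "\<zero>\<^bsub>Q\<^esub> = coset I 0"
    by (simp_all add: quotient_algebra_def)
  note ops = quotient_algebra_ops[OF R_subset]
  show ?thesis
  proof (unfold_locales, goal_cases)
    case (1 g)
    then show ?case by (auto simp: component_def car)
  next
    case (2 g)
    then show ?case unfolding component_def zero by (intro imageI) (simp add: free_algebra_closed)
  next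
    case (3 g x y)
    then obtain p q where "p \<in> free_algebra X" "q \<in> free_algebra X" "x = coset I p" "y = coset I q"
      "\<forall>u\<in>Poly_Mapping.keys p. wdeg u = g" "\<forall>u\<in>Poly_Mapping.keys q. wdeg u = g"
      by (auto simp: component_def)
    then show ?case unfolding component_def using keys_add[of p q]
      by (auto simp: ops intro!: imageI free_algebra_closed(2,3))
  next
    case (4 g x c)
    then obtain p where "p \<in> free_algebra X" "x = coset I p" "\<forall>u\<in>Poly_Mapping.keys p. wdeg u = g"
      by (auto simp: component_def)
    moreover from this have "\<forall>u\<in>Poly_Mapping.keys (scalar c * p). wdeg u = g"
      using keys_mult[of "scalar c" p] by (fastforce simp: scalar_def split: if_splits)
    ultimately show ?case unfolding component_def
      by (auto simp: ops intro!: imageI free_algebra_closed(4))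
  next
    case (5 g h x y)
    then obtain p q where "p \<in> free_algebra X" "q \<in> free_algebra X" "x = coset I p" "y = coset I q"
      "\<forall>u\<in>Poly_Mapping.keys p. wdeg u = g" "\<forall>u\<in>Poly_Mapping.keys q. wdeg u = h"
      by (auto simp: component_def)
    moreover from this have "\<forall>u\<in>Poly_Mapping.keys (p * q). wdeg u = g + h"
      using keys_mult[of p q] by (fastforce simp: wdeg_add)
    ultimately show ?case unfolding component_def
      by (auto simp: ops intro!: imageI free_algebra_closed(2,3))
  next
    case (6 a)
    then obtain p where p: "p \<in> free_algebra X" "a = coset I p" by (auto simp: car)
    define x where "x g = (if g \<in> carrier_vec n then coset I (part g p) else \<zero>\<^bsub>Q\<^esub>)" for g
    let ?S = "wdeg ` Poly_Mapping.keys p"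
    have "x g = \<zero>\<^bsub>Q\<^esub>" if "g \<notin> ?S" for g
      using homogeneous_part_eq_0[OF that] by (simp add: x_def zero)
    then have supp: "{g. x g \<noteq> \<zero>\<^bsub>Q\<^esub>} \<subseteq> ?S" by blast
    then have fin: "finite {g. x g \<noteq> \<zero>\<^bsub>Q\<^esub>}" by (rule finite_subset) simp
    have "(\<Oplus>\<^bsub>Q\<^esub>g\<in>{g. x g \<noteq> \<zero>\<^bsub>Q\<^esub>}. x g) = (\<Oplus>\<^bsub>Q\<^esub>g\<in>?S. coset I (part g p))"
    proof -
      have "(\<Oplus>\<^bsub>Q\<^esub>g\<in>{g. x g \<noteq> \<zero>\<^bsub>Q\<^esub>}. x g) = (\<Oplus>\<^bsub>Q\<^esub>g\<in>?S. x g)"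
        using supp p by (intro Q.add.finprod_mono_neutral_cong_left)
          (auto simp: x_def car intro!: imageI part_in_free_algebra)
      also have "\<dots> = (\<Oplus>\<^bsub>Q\<^esub>g\<in>?S. coset I (part g p))"
        using p by (intro Q.finsum_cong') (auto simp: x_def car intro!: imageI part_in_free_algebra)
      finally show ?thesis .
    qed
    also have "\<dots> = a"
      using p by (subst finsum_coset) (auto simp: part_in_free_algebra sum_homogeneous_parts)
    finally have sum: "a = (\<Oplus>\<^bsub>Q\<^esub>g\<in>{g. x g \<noteq> \<zero>\<^bsub>Q\<^esub>}. x g)" by simp
    show ?case
    proof (rule ex1I[of _ x], intro conjI)
      show "\<forall>g\<in>carrier_vec n. x g \<in> component g"
        using p by (auto simp: x_def component_def keys_homogeneous_part intro!: imageI part_in_free_algebra)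
      show "\<forall>g. g \<notin> carrier_vec n \<longrightarrow> x g = \<zero>\<^bsub>Q\<^esub>" by (simp add: x_def)
      show "finite {g. x g \<noteq> \<zero>\<^bsub>Q\<^esub>}" by (rule fin)
      show "a = (\<Oplus>\<^bsub>Q\<^esub>g\<in>{g. x g \<noteq> \<zero>\<^bsub>Q\<^esub>}. x g)" by (rule sum)
    next
      fix y assume y: "(\<forall>g\<in>carrier_vec n. y g \<in> component g) \<and> (\<forall>g. g \<notin> carrier_vec n \<longrightarrow> y g = \<zero>\<^bsub>Q\<^esub>) \<and>
        finite {g. y g \<noteq> \<zero>\<^bsub>Q\<^esub>} \<and> a = (\<Oplus>\<^bsub>Q\<^esub>g\<in>{g. y g \<noteq> \<zero>\<^bsub>Q\<^esub>}. y g)"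
      let ?T = "{g. y g \<noteq> \<zero>\<^bsub>Q\<^esub>}"
      have T: "?T \<subseteq> carrier_vec n" using y by auto
      have "\<forall>g\<in>carrier_vec n. \<exists>q. q \<in> free_algebra X \<and> (\<forall>u\<in>Poly_Mapping.keys q. wdeg u = g) \<and> y g = coset I q"
        using y by (fastforce simp: component_def)
      then obtain q where q: "\<And>g. g \<in> carrier_vec n \<Longrightarrow> q g \<in> free_algebra X"
        "\<And>g. g \<in> carrier_vec n \<Longrightarrow> \<forall>u\<in>Poly_Mapping.keys (q g). wdeg u = g"
        "\<And>g. g \<in> carrier_vec n \<Longrightarrow> y g = coset I (q g)"
        by (metis (no_types, lifting))
      have "a = (\<Oplus>\<^bsub>Q\<^esub>g\<in>?T. y g)" using y by blast
      also have "\<dots> = (\<Oplus>\<^bsub>Q\<^esub>g\<in>?T. coset I (q g))"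
        by (rule Q.finsum_cong') (use T q in \<open>auto simp: car subset_iff\<close>)
      also have "\<dots> = coset I (sum q ?T)" using y T q by (intro finsum_coset) auto
      finally have diff: "p - sum q ?T \<in> I" using p by (simp add: coset_eq_iff)
      show "y = x"
      proof
        fix h
        show "y h = x h"
        proof (cases "h \<in> carrier_vec n")
          case True
          have "part h (sum q ?T) = (\<Sum>g\<in>?T. if g = h then q h else 0)"
            unfolding homogeneous_part_sum
          proof (rule sum.cong[OF refl])
            fix g assume "g \<in> ?T"
            then show "part h (q g) = (if g = h then q h else 0)"
              using homogeneous_part_of_homogeneous[OF q(2)[of g], of h] T by auto
          qed
          also have "\<dots> = (if y h \<noteq> \<zero>\<^bsub>Q\<^esub> then q h else 0)"
            using y by (simp add: sum.delta)
          finally have "part h (sum q ?T) = (if y h \<noteq> \<zero>\<^bsub>Q\<^esub> then q h else 0)" .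
          with part_ideal[OF diff True] have "coset I (part h p) = coset I (if y h \<noteq> \<zero>\<^bsub>Q\<^esub> then q h else 0)"
            by (simp add: homogeneous_part_diff coset_eq_iff)
          then show ?thesis using True q(3) by (auto simp: x_def zero split: if_splits)
        qed (use y in \<open>simp add: x_def\<close>)
      qed
    qed
  qed
qed

end

lemma graded_algebra_transport:
  fixes A :: "('k :: field, 'a) module" and B :: "('k, 'b) module"
  assumes "graded_algebra n A \<A>" "assoc_algebra B" "\<phi> \<in> algebra_iso A B"
  shows "graded_algebra n B (\<lambda>g. \<phi> ` \<A> g)"
proof -
  interpret A: graded_algebra n A \<A> by fact
  interpret B: assoc_algebra B by fact
  from assms(3) have bij: "bij_betw \<phi> (carrier A) (carrier B)"
    and add: "\<And>x y. x \<in> carrier A \<Longrightarrow> y \<in> carrier A \<Longrightarrow> \<phi> (x \<oplus>\<^bsub>A\<^esub> y) = \<phi> x \<oplus>\<^bsub>B\<^esub> \<phi> y"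
    and mult: "\<And>x y. x \<in> carrier A \<Longrightarrow> y \<in> carrier A \<Longrightarrow> \<phi> (x \<otimes>\<^bsub>A\<^esub> y) = \<phi> x \<otimes>\<^bsub>B\<^esub> \<phi> y"
    and smult: "\<And>x c. x \<in> carrier A \<Longrightarrow> \<phi> (c \<odot>\<^bsub>A\<^esub> x) = c \<odot>\<^bsub>B\<^esub> \<phi> x"
    by (auto simp: algebra_iso_def)
  have closed: "\<phi> x \<in> carrier B" if "x \<in> carrier A" for x
    using bij that by (auto simp: bij_betw_def)
  have inj: "\<phi> x = \<phi> y \<longleftrightarrow> x = y" if "x \<in> carrier A" "y \<in> carrier A" for x y
    using bij that by (auto simp: bij_betw_def inj_on_def)
  have zero: "\<phi> \<zero>\<^bsub>A\<^esub> = \<zero>\<^bsub>B\<^esub>"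
    using add[of "\<zero>\<^bsub>A\<^esub>" "\<zero>\<^bsub>A\<^esub>"] closed[of "\<zero>\<^bsub>A\<^esub>"] by simp
  have comp: "x \<in> carrier A" if "g \<in> carrier_vec n" "x \<in> \<A> g" for x g
    using A.component_subset that by blast
  have sum: "\<phi> (\<Oplus>\<^bsub>A\<^esub>g\<in>S. x g) = (\<Oplus>\<^bsub>B\<^esub>g\<in>S. \<phi> (x g))" if "finite S" "\<And>g. g \<in> S \<Longrightarrow> x g \<in> carrier A" for S x
    using that
  proof (induction S rule: finite_induct)
    case (insert g S)
    then show ?case
      by (subst A.finsum_insert) (auto simp: add closed Pi_def B.finsum_insert intro!: A.finsum_closed)
  qed (simp add: zero)
  show ?thesis
  proof (unfold_locales, goal_cases)
    case (1 g)
    then show ?case using comp closed by auto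
  next
    case (2 g)
    then show ?case using A.component_zero zero by (metis imageI)
  next
    case (3 g x y)
    then obtain a b where "x = \<phi> a" "y = \<phi> b" "a \<in> \<A> g" "b \<in> \<A> g" by auto
    then show ?case using 3(1) A.component_add comp add by (metis imageI)
  next
    case (4 g x c)
    then obtain a where "x = \<phi> a" "a \<in> \<A> g" by auto
    then show ?case using 4(1) A.component_scale comp smult by (metis imageI)
  next
    case (5 g h x y)
    then obtain a b where "x = \<phi> a" "y = \<phi> b" "a \<in> \<A> g" "b \<in> \<A> h" by auto
    then show ?case using 5(1,2) A.component_mult comp mult by (metis imageI)
  next
    case (6 b)
    then obtain a where a: "a \<in> carrier A" "b = \<phi> a" using bij by (auto simp: bij_betw_def)
    have in_carrier: "x g \<in> carrier A"
      if "\<forall>g\<in>carrier_vec n. x g \<in> \<A> g" "\<forall>g. g \<notin> carrier_vec n \<longrightarrow> x g = \<zero>\<^bsub>A\<^esub>" for x g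
      using that comp[of g] by (cases "g \<in> carrier_vec n") auto
    have supp: "{g. \<phi> (x g) \<noteq> \<zero>\<^bsub>B\<^esub>} = {g. x g \<noteq> \<zero>\<^bsub>A\<^esub>}" if "\<And>g. x g \<in> carrier A" for x :: "int vec \<Rightarrow> 'a"
      using that inj by (metis zero A.zero_closed)
    from A.direct_sum[OF a(1)] obtain x where x: "\<forall>g\<in>carrier_vec n. x g \<in> \<A> g"
      "\<forall>g. g \<notin> carrier_vec n \<longrightarrow> x g = \<zero>\<^bsub>A\<^esub>" "finite {g. x g \<noteq> \<zero>\<^bsub>A\<^esub>}"
      "a = (\<Oplus>\<^bsub>A\<^esub>g\<in>{g. x g \<noteq> \<zero>\<^bsub>A\<^esub>}. x g)"
      and unique: "\<And>y. (\<forall>g\<in>carrier_vec n. y g \<in> \<A> g) \<and> (\<forall>g. g \<notin> carrier_vec n \<longrightarrow> y g = \<zero>\<^bsub>A\<^esub>) \<and>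
        finite {g. y g \<noteq> \<zero>\<^bsub>A\<^esub>} \<and> a = (\<Oplus>\<^bsub>A\<^esub>g\<in>{g. y g \<noteq> \<zero>\<^bsub>A\<^esub>}. y g) \<Longrightarrow> y = x"
      by (elim ex1E) blast
    note xc = in_carrier[OF x(1,2)]
    show ?case
    proof (rule ex1I[of _ "\<lambda>g. \<phi> (x g)"], intro conjI)
      show "\<forall>g\<in>carrier_vec n. \<phi> (x g) \<in> \<phi> ` \<A> g" using x by auto
      show "\<forall>g. g \<notin> carrier_vec n \<longrightarrow> \<phi> (x g) = \<zero>\<^bsub>B\<^esub>" using x zero by auto
      show "finite {g. \<phi> (x g) \<noteq> \<zero>\<^bsub>B\<^esub>}" using x xc by (simp add: supp)
      show "b = (\<Oplus>\<^bsub>B\<^esub>g\<in>{g. \<phi> (x g) \<noteq> \<zero>\<^bsub>B\<^esub>}. \<phi> (x g))"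
        unfolding supp[OF xc] a(2) by (subst x(4)) (intro sum x(3) xc)
    next
      fix y assume y: "(\<forall>g\<in>carrier_vec n. y g \<in> \<phi> ` \<A> g) \<and> (\<forall>g. g \<notin> carrier_vec n \<longrightarrow> y g = \<zero>\<^bsub>B\<^esub>) \<and>
        finite {g. y g \<noteq> \<zero>\<^bsub>B\<^esub>} \<and> b = (\<Oplus>\<^bsub>B\<^esub>g\<in>{g. y g \<noteq> \<zero>\<^bsub>B\<^esub>}. y g)"
      then have "\<forall>g\<in>carrier_vec n. \<exists>z\<in>\<A> g. y g = \<phi> z" by auto
      then obtain z0 where z0: "\<And>g. g \<in> carrier_vec n \<Longrightarrow> z0 g \<in> \<A> g \<and> y g = \<phi> (z0 g)" by metis
      define z where "z g = (if g \<in> carrier_vec n then z0 g else \<zero>\<^bsub>A\<^esub>)" for g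
      have z: "\<forall>g\<in>carrier_vec n. z g \<in> \<A> g" "\<forall>g. g \<notin> carrier_vec n \<longrightarrow> z g = \<zero>\<^bsub>A\<^esub>"
        using z0 by (auto simp: z_def)
      have yz: "y = (\<lambda>g. \<phi> (z g))" using y z0 zero by (auto simp: z_def)
      note zc = in_carrier[OF z]
      have "b = (\<Oplus>\<^bsub>B\<^esub>g\<in>{g. z g \<noteq> \<zero>\<^bsub>A\<^esub>}. \<phi> (z g))" and fin: "finite {g. z g \<noteq> \<zero>\<^bsub>A\<^esub>}"
        using y by (simp_all add: yz supp[OF zc])
      then have "\<phi> a = \<phi> (\<Oplus>\<^bsub>A\<^esub>g\<in>{g. z g \<noteq> \<zero>\<^bsub>A\<^esub>}. z g)" using a by (simp add: sum zc)
      then have "a = (\<Oplus>\<^bsub>A\<^esub>g\<in>{g. z g \<noteq> \<zero>\<^bsub>A\<^esub>}. z g)"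
        using a zc by (subst (asm) inj) (auto intro!: A.finsum_closed)
      with z fin have "z = x" by (intro unique) blast
      then show "y = (\<lambda>g. \<phi> (x g))" using yz by simp
    qed
  qed
qed

section \<open>Special edges: disjoint lines and cycles\<close>

context LPA_weighted_graph
begin

abbreviation "descendants \<equiv> tree_set E (head E ` weighted_edges E w)"

text \<open>
  The range of a weighted edge is going to emit the reversed edge and nothing else. So an edge that
  it emits in \<open>E\<close> has to be reversed too, and so on along all paths from the range.
\<close>

definition special :: "'e \<Rightarrow> bool" where
  "special e \<longleftrightarrow> e \<in> arcs E \<and> (1 < w e \<or> tail E e \<in> descendants)"

lemma reachable_arc:
  assumes "e \<in> arcs E" shows "tail E e \<rightarrow>\<^bsub>E\<^esub> head E e"
  using assms by (auto simp: arcs_ends_conv)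

lemma specialE:
  assumes "special e"
  obtains e' where "e' \<in> weighted_edges E w" "e = e' \<or> head E e' \<rightarrow>\<^sup>*\<^bsub>E\<^esub> tail E e"
    "head E e' \<rightarrow>\<^sup>*\<^bsub>E\<^esub> head E e"
proof (cases "1 < w e")
  case True
  with assms show ?thesis by (intro that[of e]) (auto simp: special_def weighted_edges_def)
next
  case False
  with assms obtain e' where "e' \<in> weighted_edges E w" "head E e' \<rightarrow>\<^sup>*\<^bsub>E\<^esub> tail E e"
    by (auto simp: special_def tree_set_def tree_def)
  with assms reachable_arc[of e] show ?thesis
    by (intro that[of e']) (auto simp: special_def intro: reachable_adj_trans)
qed

lemma special_weighted: "e \<in> arcs E \<Longrightarrow> 1 < w e \<Longrightarrow> special e"
  by (simp add: special_def)

lemma special_tail_unique: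
  assumes "special e" "special f" "tail E e = tail E f"
  shows "e = f"
proof (cases "tail E e \<in> descendants")
  case True
  then show ?thesis using assms LPA2[of "tail E e" e f] by (auto simp: special_def)
next
  case False
  then show ?thesis using assms LPA1[of "tail E e" e f] by (auto simp: special_def weighted_edges_def)
qed

lemma special_after_special:
  assumes "special e" "f \<in> arcs E" "tail E f = head E e"
  shows "special f"
proof -
  from assms(1) obtain e' where "e' \<in> weighted_edges E w" "head E e' \<rightarrow>\<^sup>*\<^bsub>E\<^esub> head E e"
    by (metis specialE)
  with assms(2,3) show ?thesis by (auto simp: special_def tree_set_def tree_def)
qed

lemma arc_unique_in_tree:
  assumes "g \<in> weighted_edges E w" "head E g \<rightarrow>\<^sup>*\<^bsub>E\<^esub> tail E e" "e \<in> arcs E" "f \<in> arcs E" "tail E e = tail E f"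
  shows "e = f"
  using assms by (intro special_tail_unique) (auto simp: special_def tree_set_def tree_def)

text \<open>
  By (LPA2) a path that starts at the range of a weighted edge never has a choice.
\<close>

lemma reachable_linear:
  assumes "g \<in> weighted_edges E w" "head E g \<rightarrow>\<^sup>*\<^bsub>E\<^esub> y" "head E g \<rightarrow>\<^sup>*\<^bsub>E\<^esub> z"
  shows "y \<rightarrow>\<^sup>*\<^bsub>E\<^esub> z \<or> z \<rightarrow>\<^sup>*\<^bsub>E\<^esub> y"
  using assms(2)
proof (induction rule: reachable_induct)
  case base
  then show ?case using assms(3) by blast
next
  case (step x y)
  then show ?case
  proof (elim disjE)
    assume "x \<rightarrow>\<^sup>*\<^bsub>E\<^esub> z"
    then show ?thesis
    proof (cases rule: converse_reachable_cases)
      case base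
      then show ?thesis using step by auto
    next
      case (step x')
      then have "x' = y"
        using arc_unique_in_tree[OF assms(1)] \<open>head E g \<rightarrow>\<^sup>*\<^bsub>E\<^esub> x\<close> \<open>x \<rightarrow>\<^bsub>E\<^esub> y\<close>
        by (fastforce simp: arcs_ends_conv)
      then show ?thesis using step by blast
    qed
  next
    assume "z \<rightarrow>\<^sup>*\<^bsub>E\<^esub> x"
    then show ?thesis using step by (meson reachable_adj_trans)
  qed
qed

lemma walks_linear:
  assumes "g \<in> weighted_edges E w" "head E g \<rightarrow>\<^sup>*\<^bsub>E\<^esub> x" "awalk x p y" "awalk x q z"
  shows "(\<exists>r. q = p @ r) \<or> (\<exists>r. p = q @ r)"
  using assms(2-4)
proof (induction p arbitrary: x q)
  case (Cons e p)
  show ?case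
  proof (cases q)
    case (Cons f q')
    have ef: "e \<in> arcs E" "f \<in> arcs E" "tail E e = x" "tail E f = x"
      "awalk (head E e) p y" "awalk (head E f) q' z"
      using Cons.prems Cons by (auto simp: awalk_Cons_iff)
    then have "e = f" using arc_unique_in_tree[OF assms(1)] Cons.prems(1) by metis
    have "head E g \<rightarrow>\<^sup>*\<^bsub>E\<^esub> head E e"
      using Cons.prems(1) reachable_arc[of e] ef by (auto intro: reachable_adj_trans)
    with Cons.IH[of "head E e" q'] ef \<open>e = f\<close> show ?thesis by (auto simp: Cons)
  qed auto
qed auto

text \<open>
  Of the two paths without repetitions from \<open>x\<close> to the sources of \<open>e\<close> and \<open>f\<close>, one is an initial
  segment of the other by (LPA2). If it is a proper one, the longer path continues through its edge
  back to \<open>x\<close>, which is a repetition.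
\<close>

lemma no_second_entry:
  assumes g: "g \<in> weighted_edges E w" and gx: "head E g \<rightarrow>\<^sup>*\<^bsub>E\<^esub> x"
    and e: "e \<in> arcs E" "head E e = x" and f: "f \<in> arcs E" "head E f = x"
    and xe: "x \<rightarrow>\<^sup>*\<^bsub>E\<^esub> tail E e" and xf: "x \<rightarrow>\<^sup>*\<^bsub>E\<^esub> tail E f"
  shows "e = f"
proof -
  have prefix: "e = f" if "e \<in> arcs E" "head E e = x" "f \<in> arcs E" "head E f = x"
    "awalk x p (tail E e)" "apath x q (tail E f)" "q = p @ r" for e f p q r
  proof (cases r)
    case Nil
    with that(7) have "p = q" by simp
    then have "tail E e = tail E f"
      using awalk_ends[of x p "tail E e" x "tail E f"] that(5) awalkI_apath[OF that(6)] by auto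
    then show ?thesis
      using arc_unique_in_tree[OF g] gx that by (metis awalkI_apath reachable_awalkI reachable_trans)
  next
    case (Cons d r')
    have q: "awalk x q (tail E f)" by (rule awalkI_apath[OF that(6)])
    then have "awalk (awlast x p) (d # r') (tail E f)"
      by (simp add: that(7) Cons)
    then have d: "d \<in> arcs E" "tail E d = tail E e"
      by (simp_all add: awalk_Cons_iff awlast_of_awalk[OF that(5)])
    have "head E g \<rightarrow>\<^sup>*\<^bsub>E\<^esub> tail E e"
      using gx that(5) by (meson reachable_awalkI reachable_trans)
    then have "d = e" using arc_unique_in_tree[OF g] that d by metis
    then have "q = (p @ [e]) @ r'" using that Cons by simp
    with that(6) have "apath x (p @ [e]) (awlast x (p @ [e]))"
      by (metis apath_append_iff)
    moreover have "awlast x (p @ [e]) = x" by (simp add: that(2) awalk_verts_conv)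
    ultimately show ?thesis using apath_nonempty_ends[of x "p @ [e]" x] by simp
  qed
  obtain p where p: "apath x p (tail E e)" using xe by (auto simp: reachable_apath)
  obtain q where q: "apath x q (tail E f)" using xf by (auto simp: reachable_apath)
  from walks_linear[OF g gx awalkI_apath[OF p] awalkI_apath[OF q]] show ?thesis
    using prefix[OF e f awalkI_apath[OF p] q] prefix[OF f e awalkI_apath[OF q] p] by blast
qed

text \<open>
  A path from \<open>x\<close> to the source of \<open>f\<close> and \<open>f\<close> itself form a cycle, which contains \<open>g\<close> by (LPA4).
\<close>

lemma weighted_edge_on_cycle:
  assumes g: "g \<in> weighted_edges E w" and gx: "head E g \<rightarrow>\<^sup>*\<^bsub>E\<^esub> x"
    and f: "f \<in> arcs E" "head E f = x" and xf: "x \<rightarrow>\<^sup>*\<^bsub>E\<^esub> tail E f"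
  shows "x \<rightarrow>\<^sup>*\<^bsub>E\<^esub> tail E g" "x \<rightarrow>\<^sup>*\<^bsub>E\<^esub> head E g"
proof -
  obtain p where p: "apath x p (tail E f)" using xf by (auto simp: reachable_apath)
  have walk: "awalk x (p @ [f]) x" using p f by (auto simp: apath_def awalk_simps dest: awalk_ends)
  have "distinct (map (tail E) (p @ [f]))"
    using p unfolding apath_def by (cases p rule: rev_cases) (auto simp: awalk_verts_conv awalk_simps)
  with walk have "cycle_based_at E x (p @ [f])" by (simp add: cycle_based_at_def)
  then have "g \<in> set (p @ [f])" using LPA4[OF g, of x "p @ [f]"] gx by (simp add: tree_def)
  then obtain a b where "p @ [f] = a @ g # b" by (meson split_list)
  with walk have "awalk x (a @ [g] @ b) x" by simp
  then have "awalk x a (tail E g)" "awalk (tail E g) [g] (head E g)"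
    by (auto simp: awalk_simps)
  then show "x \<rightarrow>\<^sup>*\<^bsub>E\<^esub> tail E g" "x \<rightarrow>\<^sup>*\<^bsub>E\<^esub> head E g"
    by (metis reachable_awalkI reachable_trans)+
qed

text \<open>
  By (LPA3) the two edges lie on one line that starts with a weighted edge \<open>g\<close>. If they are
  different, this line meets their common range \<open>x\<close> twice and so runs into a cycle through \<open>x\<close>. By
  (LPA4) this cycle contains \<open>g\<close>, hence the whole line; but on a cycle that cannot be
  left, \<open>x\<close> has only one predecessor.
\<close>

lemma special_head_unique:
  assumes "special e" "special f" "head E e = head E f"
  shows "e = f"
proof -
  define x where "x = head E e"
  have x: "head E e = x" "head E f = x" using assms by (auto simp: x_def)
  have arcs: "e \<in> arcs E" "f \<in> arcs E" using assms by (auto simp: special_def)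
  \<comment> \<open>Both edges lie on the line that starts with \<open>g\<close>, and \<open>f\<close> is not \<open>g\<close> itself unless \<open>g\<close> is on a cycle.\<close>
  have main: "e = f" if g: "g \<in> weighted_edges E w" and e: "e \<in> arcs E" "head E e = x" and f: "f \<in> arcs E" "head E f = x"
    and ge: "e = g \<or> head E g \<rightarrow>\<^sup>*\<^bsub>E\<^esub> tail E e" and gf: "head E g \<rightarrow>\<^sup>*\<^bsub>E\<^esub> tail E f" for g e f
  proof -
    have gx: "head E g \<rightarrow>\<^sup>*\<^bsub>E\<^esub> x"
      using gf f reachable_arc[of f] by (auto intro: reachable_adj_trans)
    have step: "b = c \<or> head E b \<rightarrow>\<^sup>*\<^bsub>E\<^esub> tail E c"
      if bc: "b \<in> arcs E" "c \<in> arcs E" "tail E b \<rightarrow>\<^sup>*\<^bsub>E\<^esub> tail E c" "head E g \<rightarrow>\<^sup>*\<^bsub>E\<^esub> tail E b" for b c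
      using bc(3)
    proof (cases rule: converse_reachable_cases)
      case base
      then show ?thesis using arc_unique_in_tree[OF g] bc by blast
    next
      case (step y)
      then have "y = head E b"
        using arc_unique_in_tree[OF g] bc by (fastforce simp: arcs_ends_conv)
      then show ?thesis using step by simp
    qed
    have "e = f \<or> x \<rightarrow>\<^sup>*\<^bsub>E\<^esub> tail E e \<or> x \<rightarrow>\<^sup>*\<^bsub>E\<^esub> tail E f"
      using ge
    proof
      assume "e = g"
      then show ?thesis using gf e by auto
    next
      assume "head E g \<rightarrow>\<^sup>*\<^bsub>E\<^esub> tail E e"
      then show ?thesis using reachable_linear[OF g _ gf] step[of e f] step[of f e] e f gf by metis
    qed
    then show ?thesis
    proof (elim disjE)
      assume xe: "x \<rightarrow>\<^sup>*\<^bsub>E\<^esub> tail E e"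
      note weighted_edge_on_cycle[OF g gx e xe]
      then show ?thesis using no_second_entry[OF g gx e f xe] gf by (meson reachable_trans)
    next
      assume xf: "x \<rightarrow>\<^sup>*\<^bsub>E\<^esub> tail E f"
      note on_cycle = weighted_edge_on_cycle[OF g gx f xf]
      then have "x \<rightarrow>\<^sup>*\<^bsub>E\<^esub> tail E e" using ge by (auto intro: reachable_trans)
      then show ?thesis using no_second_entry[OF g gx e f _ xf] by blast
    qed
  qed
  from assms(1) obtain e' where e': "e' \<in> weighted_edges E w" "e = e' \<or> head E e' \<rightarrow>\<^sup>*\<^bsub>E\<^esub> tail E e"
    "head E e' \<rightarrow>\<^sup>*\<^bsub>E\<^esub> x" using x by (metis specialE)
  from assms(2) obtain f' where f': "f' \<in> weighted_edges E w" "f = f' \<or> head E f' \<rightarrow>\<^sup>*\<^bsub>E\<^esub> tail E f"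
    "head E f' \<rightarrow>\<^sup>*\<^bsub>E\<^esub> x" using x by (metis specialE)
  have "x \<in> tree E (head E e') \<inter> tree E (head E f')" using e' f' by (simp add: tree_def)
  then have "in_line E e' f'" using LPA3[OF e'(1) f'(1)] by blast
  then consider "e' = f'" | "head E e' \<rightarrow>\<^sup>*\<^bsub>E\<^esub> tail E f'" | "head E f' \<rightarrow>\<^sup>*\<^bsub>E\<^esub> tail E e'"
    by (auto simp: in_line_def)
  then show ?thesis
  proof cases
    case 1
    then show ?thesis
      using main[OF e'(1) arcs(1) x(1) arcs(2) x(2)] main[OF e'(1) arcs(2) x(2) arcs(1) x(1)] e' f' by metis
  next
    case 2
    have "f' \<in> arcs E" using f' by (simp add: weighted_edges_def)
    then have "head E e' \<rightarrow>\<^sup>*\<^bsub>E\<^esub> head E f'" using 2 reachable_arc by (meson reachable_adj_trans)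
    then have "head E e' \<rightarrow>\<^sup>*\<^bsub>E\<^esub> tail E f" using 2 f'(2) by (meson reachable_trans)
    then show ?thesis using main[OF e'(1) arcs(1) x(1) arcs(2) x(2) e'(2)] by blast
  next
    case 3
    have "e' \<in> arcs E" using e' by (simp add: weighted_edges_def)
    then have "head E f' \<rightarrow>\<^sup>*\<^bsub>E\<^esub> head E e'" using 3 reachable_arc by (meson reachable_adj_trans)
    then have "head E f' \<rightarrow>\<^sup>*\<^bsub>E\<^esub> tail E e" using 3 e'(2) by (meson reachable_trans)
    then show ?thesis using main[OF f'(1) arcs(2) x(2) arcs(1) x(1) f'(2)] by blast
  qed
qed

end

section \<open>Calculating in weighted Leavitt path algebras\<close>

lemma pcong_mult_left: "pcong X R p q \<Longrightarrow> pcong X R (r * p) (r * q)"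
  by (rule pcong_mult) simp_all

lemma pcong_mult_right: "pcong X R p q \<Longrightarrow> pcong X R (p * r) (q * r)"
  by (rule pcong_mult) simp_all

lemma pcong_mult_0:
  "pcong X R p 0 \<Longrightarrow> pcong X R (p * q) 0"
  "pcong X R q 0 \<Longrightarrow> pcong X R (p * q) 0"
  using pcong_mult_right[of X R p 0 q] pcong_mult_left[of X R q 0 p] by simp_all

lemma pcong_diff_0: "pcong X R p q \<Longrightarrow> pcong X R (p - q) 0"
  using pcong_diff[of X R p q q q] by simp

lemma pcong_sum_0: "(\<And>i. i \<in> S \<Longrightarrow> pcong X R (f i) 0) \<Longrightarrow> pcong X R (sum f S) 0"
  using pcong_sum[of S X R f "\<lambda>_. 0"] by simp

lemma pcong_sum_single:
  assumes "finite S" "k \<in> S" "pcong X R (f k) g" "\<And>i. i \<in> S \<Longrightarrow> i \<noteq> k \<Longrightarrow> pcong X R (f i) 0"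
  shows "pcong X R (sum f S) g"
proof -
  have "pcong X R (\<Sum>i\<in>S. f i) (\<Sum>i\<in>S. if i = k then g else 0)"
    using assms by (intro pcong_sum) auto
  then show ?thesis using assms by simp
qed

lemma pcong_mult_sums_diagonal:
  assumes "finite S" "\<And>i j. i \<in> S \<Longrightarrow> j \<in> S \<Longrightarrow> i \<noteq> j \<Longrightarrow> pcong X R (f i * g j) 0"
  shows "pcong X R (sum f S * sum g S) (\<Sum>i\<in>S. f i * g i)"
  unfolding sum_product using assms by (intro pcong_sum pcong_sum_single) auto

lemma pcong_mult_orthogonal:
  assumes "pcong X R (x * p) x" "pcong X R (q * y) y" "pcong X R (p * q) 0"
  shows "pcong X R (x * y) 0"
proof -
  have "pcong X R (x * y) ((x * p) * (q * y))" 
    using assms(1,2)[THEN pcong_sym] by (rule pcong_mult)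
  also have "\<dots> = x * ((p * q) * y)" by (simp add: mult.assoc)
  also have "pcong X R \<dots> 0"
    by (rule pcong_mult_0(2)[OF pcong_mult_0(1)[OF assms(3)]])
  finally show ?thesis .
qed

text \<open>
  The parameter \<open>K\<close> fixes the field once and for all, so that all congruences below are
  between elements of the same free algebra.
\<close>

locale weighted_digraph = wf_digraph E
  for E :: "('v, 'e) pre_digraph" and w :: "'e \<Rightarrow> nat" and K :: "'k :: field itself" +
  assumes row_finite: "row_finite E"
begin

abbreviation cong :: "(('v, 'e) gen, 'k) free \<Rightarrow> (('v, 'e) gen, 'k) free \<Rightarrow> bool"
  where "cong \<equiv> pcong (wlpa_gens E w) (wlpa_relations E w)"

lemma cong_relation: "p - q \<in> wlpa_relations E w \<Longrightarrow> cong p q"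
  by (rule pcong_relation[OF wlpa_relations_subset[OF wf_digraph_axioms]])

lemma finite_out_arcs [simp]: "finite (out_arcs E v)"
proof (cases "v \<in> verts E")
  case True
  then show ?thesis using row_finite by (simp add: row_finite_def)
next
  case False
  then have "out_arcs E v = {}" by auto
  then show ?thesis by simp
qed

text \<open>
  The letters of vertices outside the graph are congruent to 0, so this holds for all \<open>u\<close> and \<open>v\<close>.
\<close>

lemma vert_vert: "cong (vert u * vert v) (if u = v then vert u else 0)"
proof (cases "u \<in> verts E \<and> v \<in> verts E")
  case True
  then show ?thesis using wlpa_relations.vertices[of u E v w] by (intro cong_relation) auto
next
  case False
  then have *: "cong (vert u) 0 \<or> cong (vert v) 0"
    by (auto simp: wlpa_gens_def intro: pcong_letter_outside)
  then have "cong (vert u * vert v) 0" by (auto intro: pcong_mult_0)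
  also have "cong 0 (if u = v then vert u else 0)" using * by (auto intro: pcong_sym)
  finally show ?thesis .
qed

lemma tail_edge: "e \<in> arcs E \<Longrightarrow> cong (vert (tail E e) * edge w e i) (edge w e i)"
  using wlpa_relations.source_edge[of e E i w]
  by (cases "1 \<le> i \<and> i \<le> w e") (auto simp: edge_def intro: cong_relation)

lemma edge_head: "e \<in> arcs E \<Longrightarrow> cong (edge w e i * vert (head E e)) (edge w e i)"
  using wlpa_relations.edge_range[of e E i w]
  by (cases "1 \<le> i \<and> i \<le> w e") (auto simp: edge_def intro: cong_relation)

lemma head_ghost: "e \<in> arcs E \<Longrightarrow> cong (vert (head E e) * ghost w e i) (ghost w e i)"
  using wlpa_relations.range_ghost[of e E i w]
  by (cases "1 \<le> i \<and> i \<le> w e") (auto simp: ghost_def intro: cong_relation)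

lemma ghost_tail: "e \<in> arcs E \<Longrightarrow> cong (ghost w e i * vert (tail E e)) (ghost w e i)"
  using wlpa_relations.ghost_source[of e E i w]
  by (cases "1 \<le> i \<and> i \<le> w e") (auto simp: ghost_def intro: cong_relation)

lemma sum_ghost_edge:
  assumes "e \<in> arcs E" "f \<in> arcs E" "tail E e = tail E f"
  shows "cong (\<Sum>i=1..vertex_weight E w (tail E e). ghost w e i * edge w f i)
    (if e = f then vert (head E e) else 0)"
proof -
  have "regular E (tail E e)" using assms by (auto simp: regular_def)
  with assms show ?thesis
    by (intro cong_relation wlpa_relations.ghost_edge) auto
qed

lemma sum_edge_ghost:
  assumes "v \<in> verts E" "out_arcs E v \<noteq> {}" "1 \<le> i" "i \<le> vertex_weight E w v"
    "1 \<le> j" "j \<le> vertex_weight E w v"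
  shows "cong (\<Sum>e\<in>out_arcs E v. edge w e i * ghost w e j) (if i = j then vert v else 0)"
  using assms by (intro cong_relation wlpa_relations.edge_ghost) (auto simp: regular_def)

end

text \<open>
  This is what the isomorphism uses of condition (LPA): the special edges form disjoint lines and
  cycles, and a vertex that receives a special edge emits no other ones. An edge that is not special
  is called ordinary; it has weight 1.
\<close>

locale special_arcs = weighted_digraph E w K
  for E :: "('v, 'e) pre_digraph" and w :: "'e \<Rightarrow> nat" and K :: "'k :: field itself" +
  fixes special :: "'e \<Rightarrow> bool"
  assumes weight_pos: "e \<in> arcs E \<Longrightarrow> 1 \<le> w e"
    and special_arc: "special e \<Longrightarrow> e \<in> arcs E"
    and special_weighted: "\<lbrakk>e \<in> arcs E; 1 < w e\<rbrakk> \<Longrightarrow> special e"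
    and special_tail_unique: "\<lbrakk>special e; special f; tail E e = tail E f\<rbrakk> \<Longrightarrow> e = f"
    and special_head_unique: "\<lbrakk>special e; special f; head E e = head E f\<rbrakk> \<Longrightarrow> e = f"
    and special_after_special: "\<lbrakk>special e; f \<in> arcs E; tail E f = head E e\<rbrakk> \<Longrightarrow> special f"
begin

notation cong (infix "\<approx>" 50)

abbreviation X :: "'e \<Rightarrow> nat \<Rightarrow> (('v, 'e) gen, 'k) free" where "X \<equiv> edge w"
abbreviation Y :: "'e \<Rightarrow> nat \<Rightarrow> (('v, 'e) gen, 'k) free" where "Y \<equiv> ghost w"

definition ordinary_out :: "'v \<Rightarrow> 'e set" where
  "ordinary_out v = {e \<in> out_arcs E v. \<not> special e}"

definition emits_special :: "'v \<Rightarrow> bool" where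
  "emits_special v \<longleftrightarrow> (\<exists>e. special e \<and> tail E e = v)"

definition special_out :: "'v \<Rightarrow> 'e" where
  "special_out v = (THE e. special e \<and> tail E e = v)"

lemma special_out_tail [simp]: "special e \<Longrightarrow> special_out (tail E e) = e"
  unfolding special_out_def using special_tail_unique by blast

lemma emits_special_tail [simp]: "special e \<Longrightarrow> emits_special (tail E e)"
  by (auto simp: emits_special_def)

lemma emits_specialE:
  assumes "emits_special v"
  obtains e where "special e" "tail E e = v" "special_out v = e" "e \<in> arcs E"
  using assms special_arc by (auto simp: emits_special_def)

lemma finite_ordinary_out [simp]: "finite (ordinary_out v)"
  by (rule finite_subset[OF _ finite_out_arcs[of v]]) (auto simp: ordinary_out_def)

lemma ordinary_weight: "e \<in> arcs E \<Longrightarrow> \<not> special e \<Longrightarrow> w e = 1"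
  using special_weighted[of e] weight_pos[of e] by linarith

lemma out_arcs_special:
  assumes "special d"
  shows "out_arcs E (tail E d) = insert d (ordinary_out (tail E d))" "d \<notin> ordinary_out (tail E d)"
  using assms special_tail_unique[of _ d] special_arc by (auto simp: ordinary_out_def)

lemma out_arcs_no_special: "\<not> emits_special v \<Longrightarrow> out_arcs E v = ordinary_out v"
  by (auto simp: ordinary_out_def emits_special_def)

lemma vertex_weight_special:
  assumes "special d"
  shows "vertex_weight E w (tail E d) = w d"
proof -
  have "Max (w ` insert d (ordinary_out (tail E d))) = w d"
  proof (rule Max_eqI)
    fix k assume "k \<in> w ` insert d (ordinary_out (tail E d))"
    then show "k \<le> w d"
      using weight_pos[OF special_arc[OF assms]] by (auto simp: ordinary_out_def ordinary_weight)
  qed auto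
  then show ?thesis by (simp add: vertex_weight_def out_arcs_special(1)[OF assms])
qed

lemma vertex_weight_no_special:
  assumes "\<not> emits_special v" "e \<in> out_arcs E v"
  shows "vertex_weight E w v = 1"
proof -
  have "w ` out_arcs E v = {1}"
    using assms ordinary_weight by (force simp: emits_special_def)
  then show ?thesis using assms(2) by (auto simp: vertex_weight_def)
qed

lemma ordinary_edge_0: "e \<in> arcs E \<Longrightarrow> \<not> special e \<Longrightarrow> i \<noteq> 1 \<Longrightarrow> X e i = 0 \<and> Y e i = 0"
  by (auto simp: edge_def ghost_def ordinary_weight)

text \<open>
  The other edges emitted by the source of \<open>d\<close> have weight 1, and contribute nothing to the relation
  when one of the two indices exceeds 1.
\<close>

lemma special_edge_ghost:
  assumes "special d" "1 \<le> i" "i \<le> w d" "1 \<le> j" "j \<le> w d" "i \<noteq> 1 \<or> j \<noteq> 1"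
  shows "X d i * Y d j \<approx> (if i = j then vert (tail E d) else 0)"
proof -
  have d: "d \<in> arcs E" using assms(1) by (rule special_arc)
  have "(\<Sum>e\<in>out_arcs E (tail E d). X e i * Y e j) = X d i * Y d j"
    unfolding out_arcs_special(1)[OF assms(1)]
  proof (subst sum.insert)
    have "(\<Sum>e\<in>ordinary_out (tail E d). X e i * Y e j) = 0"
      using assms(6) ordinary_edge_0[of _ i] ordinary_edge_0[of _ j]
      by (intro sum.neutral) (auto simp: ordinary_out_def)
    then show "X d i * Y d j + (\<Sum>e\<in>ordinary_out (tail E d). X e i * Y e j) = X d i * Y d j"
      by simp
  qed (auto simp: out_arcs_special[OF assms(1)])
  moreover have "(\<Sum>e\<in>out_arcs E (tail E d). X e i * Y e j) \<approx> (if i = j then vert (tail E d) else 0)"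
    using assms d by (intro sum_edge_ghost) (auto simp: vertex_weight_special)
  ultimately show ?thesis by metis
qed

lemma special_edge_ghost_1:
  assumes "special d"
  shows "X d 1 * Y d 1 + (\<Sum>f\<in>ordinary_out (tail E d). X f 1 * Y f 1) \<approx> vert (tail E d)"
proof -
  have d: "d \<in> arcs E" "1 \<le> w d" using assms special_arc weight_pos by blast+
  have "(\<Sum>e\<in>out_arcs E (tail E d). X e 1 * Y e 1) \<approx> vert (tail E d)"
    using sum_edge_ghost[of "tail E d" 1 1] assms d
    by (simp add: vertex_weight_special out_arcs_special(1))
  then show ?thesis by (simp add: out_arcs_special[OF assms])
qed

lemma ordinary_edge_ghost_1:
  assumes "\<not> emits_special v" "ordinary_out v \<noteq> {}"
  shows "(\<Sum>f\<in>ordinary_out v. X f 1 * Y f 1) \<approx> vert v"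
proof -
  obtain e where e: "e \<in> out_arcs E v" using assms by (auto simp: ordinary_out_def)
  then have "v \<in> verts E" by auto
  then show ?thesis
    using sum_edge_ghost[of v 1 1] assms vertex_weight_no_special[OF assms(1) e]
    by (simp add: out_arcs_no_special)
qed

text \<open>
  Only the index 1 counts when one of the edges has weight 1. The bilinear expression \<open>g\<close> is left
  open because it also stands for the product of the images under a substitution.
\<close>

lemma sum_over_weights:
  fixes g :: "(('v, 'e) gen, 'k) free \<Rightarrow> (('v, 'e) gen, 'k) free \<Rightarrow> 'z :: comm_monoid_add"
  assumes "e \<in> arcs E" "f \<in> arcs E" "tail E e = tail E f" "\<not> special e \<or> \<not> special f"
    and g: "\<And>p. g p 0 = 0" "\<And>p. g 0 p = 0"
  shows "(\<Sum>i=1..vertex_weight E w (tail E e). g (Y e i) (X f i)) = g (Y e 1) (X f 1)"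
proof -
  have "1 \<le> vertex_weight E w (tail E e)"
  proof (cases "emits_special (tail E e)")
    case True
    then obtain d where "special d" "tail E d = tail E e" "d \<in> arcs E" by (elim emits_specialE)
    then show ?thesis using vertex_weight_special[of d] weight_pos by simp
  next
    case False
    then show ?thesis using vertex_weight_no_special[OF False, of e] assms by simp
  qed
  moreover have "g (Y e i) (X f i) = 0" if "i \<noteq> 1" for i
    using assms(1,2,4) ordinary_edge_0[of e i] ordinary_edge_0[of f i] g that by auto
  ultimately show ?thesis
    by (subst sum.remove[of _ 1]) (auto intro!: sum.neutral)
qed

lemma ghost_edge_1:
  assumes "e \<in> arcs E" "f \<in> arcs E" "tail E e = tail E f" "\<not> special e \<or> \<not> special f"
  shows "Y e 1 * X f 1 \<approx> (if e = f then vert (head E e) else 0)"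
  using sum_ghost_edge[OF assms(1-3)] sum_over_weights[OF assms, of "(*)"] by simp

lemma special_sum_ghost_edge:
  assumes "special d"
  shows "(\<Sum>i=1..w d. Y d i * X d i) \<approx> vert (head E d)"
  using sum_ghost_edge[of d d] assms special_arc by (simp add: vertex_weight_special)

text \<open>
  Multiply \<open>d\<^sub>1 d\<^sub>1\<^sup>* + \<Sum> f f\<^sup>* = v\<close> by \<open>d\<^sub>1\<^sup>*\<close> from the left, or by \<open>d\<^sub>1\<close> from the right: the terms
  with an ordinary edge \<open>f\<close> vanish.
\<close>

lemma special_partial_isometry:
  assumes "special d"
  shows "Y d 1 * (X d 1 * Y d 1) \<approx> Y d 1" "(X d 1 * Y d 1) * X d 1 \<approx> X d 1"
proof -
  have d: "d \<in> arcs E" using assms by (rule special_arc)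
  let ?s = "\<Sum>f\<in>ordinary_out (tail E d). X f 1 * Y f 1"
  have f: "Y d 1 * X f 1 \<approx> 0" "Y f 1 * X d 1 \<approx> 0" if "f \<in> ordinary_out (tail E d)" for f
    using ghost_edge_1[of d f] ghost_edge_1[of f d] that d assms
    by (auto simp: ordinary_out_def split: if_splits)
  have "Y d 1 * ?s = (\<Sum>f\<in>ordinary_out (tail E d). (Y d 1 * X f 1) * Y f 1)"
    by (simp add: sum_distrib_left mult.assoc)
  also have "\<dots> \<approx> 0" using f by (blast intro: pcong_sum_0 pcong_mult_0(1))
  finally have "Y d 1 * (X d 1 * Y d 1) + 0 \<approx> Y d 1 * (X d 1 * Y d 1) + Y d 1 * ?s"
    by (rule pcong_add[OF pcong_refl pcong_sym])
  also have "\<dots> = Y d 1 * (X d 1 * Y d 1 + ?s)" by (simp add: distrib_left)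
  also have "\<dots> \<approx> Y d 1 * vert (tail E d)" by (intro pcong_mult_left special_edge_ghost_1 assms)
  also have "\<dots> \<approx> Y d 1" by (rule ghost_tail[OF d])
  finally show "Y d 1 * (X d 1 * Y d 1) \<approx> Y d 1" by simp
  have "?s * X d 1 = (\<Sum>f\<in>ordinary_out (tail E d). X f 1 * (Y f 1 * X d 1))"
    by (simp add: sum_distrib_right mult.assoc)
  also have "\<dots> \<approx> 0" using f by (blast intro: pcong_sum_0 pcong_mult_0(2))
  finally have "(X d 1 * Y d 1) * X d 1 + 0 \<approx> (X d 1 * Y d 1) * X d 1 + ?s * X d 1"
    by (rule pcong_add[OF pcong_refl pcong_sym])
  also have "\<dots> = (X d 1 * Y d 1 + ?s) * X d 1" by (simp add: distrib_right)
  also have "\<dots> \<approx> vert (tail E d) * X d 1" by (intro pcong_mult_right special_edge_ghost_1 assms)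
  also have "\<dots> \<approx> X d 1" by (rule tail_edge[OF d])
  finally show "(X d 1 * Y d 1) * X d 1 \<approx> X d 1" by simp
qed


section \<open>Pieces of vertices\<close>

text \<open>
  Piece 1 of \<open>v\<close> stands for the idempotent \<open>d\<^sub>1 d\<^sub>1\<^sup>*\<close>, where \<open>d\<close> is the special edge emitted by \<open>v\<close>,
  and piece 0 for its complement in \<open>v\<close>. If \<open>v\<close> emits a special edge, the complement is the sum of
  all \<open>f f\<^sup>*\<close> with \<open>f\<close> ordinary; so it is 0, and must not become a vertex, if there are no ordinary
  edges at \<open>v\<close>.
\<close>

definition pieces :: "'v \<Rightarrow> nat set" where
  "pieces v = {j. j = 0 \<and> (ordinary_out v \<noteq> {} \<or> \<not> emits_special v) \<or> j = 1 \<and> emits_special v}"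

definition special_part :: "'v \<Rightarrow> (('v, 'e) gen, 'k) free" where
  "special_part v = (if emits_special v then X (special_out v) 1 * Y (special_out v) 1 else 0)"

definition piece :: "'v \<Rightarrow> nat \<Rightarrow> (('v, 'e) gen, 'k) free" where
  "piece v j = (if j = 1 then special_part v else vert v - special_part v)"

text \<open>
  A vertex that receives a special edge emits no ordinary edge, hence has a single piece; this is
  the index of that piece.
\<close>

definition main_piece :: "'v \<Rightarrow> nat" where
  "main_piece v = (if emits_special v then 1 else 0)"

lemma finite_pieces [simp]: "finite (pieces v)"
  by (rule finite_subset[of _ "{0, 1}"]) (auto simp: pieces_def)

lemma pieces_less: "j \<in> pieces v \<Longrightarrow> j < 2"
  by (auto simp: pieces_def)

lemma pieces_head_special: "special d \<Longrightarrow> pieces (head E d) = {main_piece (head E d)}"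
  using special_after_special[of d] by (auto simp: pieces_def main_piece_def ordinary_out_def)

lemma special_part_tail: "special d \<Longrightarrow> special_part (tail E d) = X d 1 * Y d 1"
  by (simp add: special_part_def)

lemma special_part_idem: "special_part v * special_part v \<approx> special_part v"
proof (cases "emits_special v")
  case True
  then obtain d where d: "special d" "tail E d = v" by (elim emits_specialE)
  have "(X d 1 * Y d 1) * (X d 1 * Y d 1) = X d 1 * (Y d 1 * (X d 1 * Y d 1))"
    by (simp add: mult.assoc)
  also have "\<dots> \<approx> X d 1 * Y d 1" by (intro pcong_mult_left special_partial_isometry d)
  finally show ?thesis using d special_part_tail[of d] by simp
qed (simp add: special_part_def)

lemma vert_special_part: "vert v * special_part v \<approx> special_part v" "special_part v * vert v \<approx> special_part v"
proof -
  show "vert v * special_part v \<approx> special_part v"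
  proof (cases "emits_special v")
    case True
    then obtain d where d: "special d" "tail E d = v" "d \<in> arcs E" by (elim emits_specialE)
    have "vert v * (X d 1 * Y d 1) = (vert v * X d 1) * Y d 1" by (simp add: mult.assoc)
    also have "\<dots> \<approx> X d 1 * Y d 1" using tail_edge[of d 1] d by (intro pcong_mult_right) auto
    finally show ?thesis using d special_part_tail[of d] by simp
  qed (simp add: special_part_def)
  show "special_part v * vert v \<approx> special_part v"
  proof (cases "emits_special v")
    case True
    then obtain d where d: "special d" "tail E d = v" "d \<in> arcs E" by (elim emits_specialE)
    have "(X d 1 * Y d 1) * vert v = X d 1 * (Y d 1 * vert v)" by (simp add: mult.assoc)
    also have "\<dots> \<approx> X d 1 * Y d 1" using ghost_tail[of d 1] d by (intro pcong_mult_left) auto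
    finally show ?thesis using d special_part_tail[of d] by simp
  qed (simp add: special_part_def)
qed

lemma vert_idem: "vert v * vert v \<approx> vert v"
  using vert_vert[of v v] by simp

lemma vert_piece: "vert v * piece v j \<approx> piece v j" "piece v j * vert v \<approx> piece v j"
proof -
  have "vert v * (vert v - special_part v) \<approx> vert v - special_part v" "(vert v - special_part v) * vert v \<approx> vert v - special_part v"
    using pcong_diff[OF vert_idem[of v] vert_special_part(1)[of v]] pcong_diff[OF vert_idem[of v] vert_special_part(2)[of v]]
    by (simp_all add: algebra_simps)
  then show "vert v * piece v j \<approx> piece v j" "piece v j * vert v \<approx> piece v j"
    using vert_special_part[of v] by (simp_all add: piece_def)
qed

lemma piece_piece_same:
  assumes "i < 2" "j < 2"
  shows "piece v i * piece v j \<approx> (if i = j then piece v i else 0)"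
proof -
  have 1: "special_part v * (vert v - special_part v) \<approx> 0" "(vert v - special_part v) * special_part v \<approx> 0"
    using pcong_diff[OF vert_special_part(2)[of v] special_part_idem[of v]] pcong_diff[OF vert_special_part(1)[of v] special_part_idem[of v]]
    by (simp_all add: algebra_simps)
  have "vert v * (vert v - special_part v) - special_part v * (vert v - special_part v) \<approx> (vert v - special_part v) - 0"
    using pcong_diff[OF vert_piece(1)[of v 0] 1(1)] by (simp add: piece_def)
  then have 2: "(vert v - special_part v) * (vert v - special_part v) \<approx> vert v - special_part v"
    by (simp add: algebra_simps)
  show ?thesis
    using assms 1 2 special_part_idem[of v] by (auto simp: piece_def less_2_cases_iff)
qed

lemma piece_piece:
  assumes "i < 2" "j < 2"
  shows "piece u i * piece v j \<approx> (if u = v \<and> i = j then piece u i else 0)"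
proof (cases "u = v")
  case False
  have "piece u i * piece v j \<approx> 0"
    by (rule pcong_mult_orthogonal[OF vert_piece(2) vert_piece(1)])
      (use vert_vert[of u v] False in simp)
  with False show ?thesis by simp
qed (use piece_piece_same[OF assms] in auto)

lemma sum_pieces: "(\<Sum>j\<in>pieces v. piece v j) \<approx> vert v"
proof (cases "emits_special v")
  case False
  then have "pieces v = {0}" by (auto simp: pieces_def)
  then show ?thesis using False by (simp add: piece_def special_part_def)
next
  case True
  then obtain d where d: "special d" "tail E d = v" by (elim emits_specialE)
  show ?thesis
  proof (cases "ordinary_out v = {}")
    case True
    then have "pieces v = {1}" using \<open>emits_special v\<close> by (auto simp: pieces_def)
    then show ?thesis
      using special_edge_ghost_1[OF d(1)] d True special_part_tail[OF d(1)] by (simp add: piece_def)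
  next
    case False
    then have "pieces v = {0, 1}" using \<open>emits_special v\<close> by (auto simp: pieces_def)
    then show ?thesis by (simp add: piece_def)
  qed
qed

lemma main_piece_head_special: "special d \<Longrightarrow> piece (head E d) (main_piece (head E d)) \<approx> vert (head E d)"
  using sum_pieces[of "head E d"] pieces_head_special[of d] by simp

lemma piece_0_conv_sum:
  assumes "ordinary_out v \<noteq> {}"
  shows "(\<Sum>f\<in>ordinary_out v. X f 1 * Y f 1) \<approx> piece v 0"
proof (cases "emits_special v")
  case True
  then obtain d where d: "special d" "tail E d = v" by (elim emits_specialE)
  from pcong_diff[OF special_edge_ghost_1[OF d(1)] pcong_refl[of _ _ "X d 1 * Y d 1"]]
  show ?thesis using d special_part_tail[OF d(1)] by (simp add: piece_def)
next
  case False
  then show ?thesis using ordinary_edge_ghost_1[OF False assms] by (simp add: piece_def special_part_def)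
qed

lemma piece_0_ordinary:
  assumes "e \<in> arcs E" "\<not> special e"
  shows "piece (tail E e) 0 * X e 1 \<approx> X e 1" "Y e 1 * piece (tail E e) 0 \<approx> Y e 1"
proof -
  have vanish: "special_part (tail E e) * X e 1 \<approx> 0" "Y e 1 * special_part (tail E e) \<approx> 0"
  proof -
    show "special_part (tail E e) * X e 1 \<approx> 0"
    proof (cases "emits_special (tail E e)")
      case True
      then obtain d where d: "special d" "tail E d = tail E e" "d \<in> arcs E" by (elim emits_specialE)
      have "d \<noteq> e" using d assms by auto
      then have "Y d 1 * X e 1 \<approx> 0" using ghost_edge_1[of d e] d assms by simp
      then have "X d 1 * (Y d 1 * X e 1) \<approx> 0" by (rule pcong_mult_0(2))
      then show ?thesis using special_part_tail[OF d(1)] d by (simp add: mult.assoc)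
    qed (simp add: special_part_def)
    show "Y e 1 * special_part (tail E e) \<approx> 0"
    proof (cases "emits_special (tail E e)")
      case True
      then obtain d where d: "special d" "tail E d = tail E e" "d \<in> arcs E" by (elim emits_specialE)
      have "d \<noteq> e" using d assms by auto
      then have "Y e 1 * X d 1 \<approx> 0" using ghost_edge_1[of e d] d assms by simp
      then have "(Y e 1 * X d 1) * Y d 1 \<approx> 0" by (rule pcong_mult_0(1))
      then show ?thesis using special_part_tail[OF d(1)] d by (simp add: mult.assoc)
    qed (simp add: special_part_def)
  qed
  show "piece (tail E e) 0 * X e 1 \<approx> X e 1"
    using pcong_diff[OF tail_edge[OF assms(1), of 1] vanish(1)] by (simp add: piece_def algebra_simps)
  show "Y e 1 * piece (tail E e) 0 \<approx> Y e 1"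
    using pcong_diff[OF ghost_tail[OF assms(1), of 1] vanish(2)] by (simp add: piece_def algebra_simps)
qed

text \<open>
  An ordinary edge is cut at its range. A special edge will be reversed, so it is cut at its source:
  \<open>e\<^sub>1\<close> starts at piece 1, because \<open>(e\<^sub>1 e\<^sub>1\<^sup>*) e\<^sub>1 = e\<^sub>1\<close>, whereas \<open>e\<^sub>i\<close> with \<open>i > 1\<close> meets every piece,
  because \<open>e\<^sub>i e\<^sub>i\<^sup>*\<close> is the whole vertex.
\<close>

definition copies :: "'e \<Rightarrow> nat \<Rightarrow> nat set" where
  "copies e i = (if \<not> special e then pieces (head E e) else if i = 1 then {1} else pieces (tail E e))"

lemma finite_copies [simp]: "finite (copies e i)"
  by (simp add: copies_def)

lemma copies_less: "j \<in> copies e i \<Longrightarrow> j < 2"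
  by (auto simp: copies_def pieces_less split: if_splits)

lemma copies_special_subset: "special e \<Longrightarrow> copies e i \<subseteq> pieces (tail E e)"
  by (auto simp: copies_def pieces_def)

lemma sum_copies_special:
  assumes "special d" "1 \<le> i" "i \<le> w d"
  shows "(\<Sum>j\<in>copies d i. piece (tail E d) j) * X d i \<approx> X d i"
    and "Y d i * (\<Sum>j\<in>copies d i. piece (tail E d) j) \<approx> Y d i"
proof -
  have d: "d \<in> arcs E" using assms by (simp add: special_arc)
  show "(\<Sum>j\<in>copies d i. piece (tail E d) j) * X d i \<approx> X d i"
  proof (cases "i = 1")
    case True
    then show ?thesis using special_partial_isometry(2)[OF assms(1)] special_part_tail[OF assms(1)] assms
      by (simp add: copies_def piece_def)
  next
    case False
    then have "(\<Sum>j\<in>copies d i. piece (tail E d) j) * X d i \<approx> vert (tail E d) * X d i"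
      using assms by (intro pcong_mult_right) (simp add: copies_def sum_pieces)
    also have "\<dots> \<approx> X d i" by (rule tail_edge[OF d])
    finally show ?thesis .
  qed
  show "Y d i * (\<Sum>j\<in>copies d i. piece (tail E d) j) \<approx> Y d i"
  proof (cases "i = 1")
    case True
    then show ?thesis using special_partial_isometry(1)[OF assms(1)] special_part_tail[OF assms(1)] assms
      by (simp add: copies_def piece_def)
  next
    case False
    then have "Y d i * (\<Sum>j\<in>copies d i. piece (tail E d) j) \<approx> Y d i * vert (tail E d)"
      using assms by (intro pcong_mult_left) (simp add: copies_def sum_pieces)
    also have "\<dots> \<approx> Y d i" by (rule ghost_tail[OF d])
    finally show ?thesis .
  qed
qed

lemma piece_edge_ghost_piece:
  assumes d: "special d" and i: "1 \<le> i" "i \<le> w d" and i': "1 \<le> i'" "i' \<le> w d"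
    and j: "j \<in> copies d i" "j' \<in> copies d i'"
  shows "piece (tail E d) j * (X d i * Y d i') * piece (tail E d) j'
    \<approx> (if i = i' \<and> j = j' then piece (tail E d) j else 0)"
proof -
  let ?\<pi> = "piece (tail E d)"
  have less: "j < 2" "j' < 2" using j by (auto intro: copies_less)
  consider "i \<noteq> i'" | "i = i'" "i = 1" | "i = i'" "i \<noteq> 1" by blast
  then show ?thesis
  proof cases
    case 1
    then have "X d i * Y d i' \<approx> 0"
      using special_edge_ghost[OF d i i'] by auto
    then have "?\<pi> j * (X d i * Y d i') * ?\<pi> j' \<approx> 0"
      by (intro pcong_mult_0(1)[OF pcong_mult_0(2)])
    then show ?thesis using 1 by simp
  next
    case 2
    then have [simp]: "i = 1" "i' = 1" "j = 1" "j' = 1" using j d by (auto simp: copies_def)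
    have "(special_part (tail E d) * special_part (tail E d)) * special_part (tail E d) \<approx> special_part (tail E d) * special_part (tail E d)"
      by (intro pcong_mult_right special_part_idem)
    also have "\<dots> \<approx> special_part (tail E d)" by (rule special_part_idem)
    finally show ?thesis by (simp add: piece_def special_part_tail[OF d])
  next
    case 3
    then have "X d i * Y d i' \<approx> vert (tail E d)"
      using special_edge_ghost[OF d i i'] by simp
    then have "?\<pi> j * (X d i * Y d i') * ?\<pi> j' \<approx> ?\<pi> j * vert (tail E d) * ?\<pi> j'"
      by (intro pcong_mult_right pcong_mult_left)
    also have "\<dots> \<approx> ?\<pi> j * ?\<pi> j'" by (intro pcong_mult_right vert_piece)
    also have "\<dots> \<approx> (if j = j' then ?\<pi> j else 0)" using less by (rule piece_piece_same)
    finally show ?thesis using 3 by simp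
  qed
qed

end

context special_arcs
begin

section \<open>The unweighted graph\<close>

text \<open>
  The copy \<open>j\<close> of \<open>e\<^sub>i\<close> is the edge \<open>(e, 2 * i + j)\<close>, from which \<open>i\<close> and \<open>j\<close> are recovered
  by division, since \<open>j < 2\<close>.
\<close>

definition F :: "('v \<times> nat, 'e \<times> nat) pre_digraph" where
  "F = \<lparr>verts = {(v, j). v \<in> verts E \<and> j \<in> pieces v},
        arcs = {(e, m). e \<in> arcs E \<and> 1 \<le> m div 2 \<and> m div 2 \<le> w e \<and> m mod 2 \<in> copies e (m div 2)},
        tail = (\<lambda>(e, m). if special e then (head E e, main_piece (head E e)) else (tail E e, 0)),
        head = (\<lambda>(e, m). if special e then (tail E e, m mod 2) else (head E e, m mod 2))\<rparr>"

lemma verts_F [simp]: "(v, j) \<in> verts F \<longleftrightarrow> v \<in> verts E \<and> j \<in> pieces v"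
  by (simp add: F_def)

lemma tail_F [simp]:
  "tail F (e, m) = (if special e then (head E e, main_piece (head E e)) else (tail E e, 0))"
  by (simp add: F_def)

lemma head_F [simp]: "head F (e, m) = (if special e then tail E e else head E e, m mod 2)"
  by (simp add: F_def)

definition valid :: "'e \<Rightarrow> nat \<Rightarrow> nat \<Rightarrow> bool" where
  "valid e i j \<longleftrightarrow> e \<in> arcs E \<and> 1 \<le> i \<and> i \<le> w e \<and> j \<in> copies e i"

lemma valid_less: "valid e i j \<Longrightarrow> j < 2"
  by (auto simp: valid_def intro: copies_less)

lemma index_eq_iff: "j < 2 \<Longrightarrow> j' < 2 \<Longrightarrow> 2 * i + j = 2 * i' + j' \<longleftrightarrow> i = i' \<and> j = (j' :: nat)"
  by presburger

lemma valid_in_arcs_F: "valid e i j \<Longrightarrow> (e, 2 * i + j) \<in> arcs F"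
  using valid_less[of e i j] by (simp add: F_def valid_def)

lemma arcs_FE:
  assumes "x \<in> arcs F"
  obtains e i j where "x = (e, 2 * i + j)" "valid e i j"
proof -
  obtain e m where x: "x = (e, m)" by force
  show ?thesis
    using assms by (intro that[of e "m div 2" "m mod 2"]) (simp_all add: F_def x valid_def)
qed

lemma valid_ordinary: "valid e i j \<Longrightarrow> \<not> special e \<Longrightarrow> i = 1"
  using ordinary_weight[of e] by (simp add: valid_def)

lemma main_piece_in_pieces: "special d \<Longrightarrow> main_piece (head E d) \<in> pieces (head E d)"
  by (simp add: pieces_head_special)

lemma ordinary_0_in_pieces: "e \<in> arcs E \<Longrightarrow> \<not> special e \<Longrightarrow> 0 \<in> pieces (tail E e)"
  by (auto simp: pieces_def ordinary_out_def)

lemma wf_F: "wf_digraph F"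
proof
  fix x assume "x \<in> arcs F"
  then obtain e i j where x: "x = (e, 2 * i + j)" "valid e i j" by (rule arcs_FE)
  then have e: "e \<in> arcs E" "j \<in> copies e i" and j: "j < 2" 
    using valid_less[OF x(2)] by (auto simp: valid_def)
  show "tail F x \<in> verts F"
    using e by (simp add: x main_piece_in_pieces ordinary_0_in_pieces)
  show "head F x \<in> verts F"
    using e j copies_special_subset[of e i] by (auto simp: x copies_def)
qed

lemma out_arcs_F_special:
  assumes d: "special d"
  shows "out_arcs F (head E d, main_piece (head E d)) =
    (\<lambda>(i, j). (d, 2 * i + j)) ` (SIGMA i:{1..w d}. copies d i)" (is "?L = ?R")
proof (intro equalityI subsetI)
  fix x assume "x \<in> ?L"
  then obtain e i j where x: "x = (e, 2 * i + j)" "valid e i j"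
    and t: "tail F x = (head E d, main_piece (head E d))" by (auto elim: arcs_FE)
  have "special e" using t x special_after_special[OF d, of e] by (auto simp: valid_def split: if_splits)
  then have "e = d" using t x special_head_unique[OF _ d] by simp
  then show "x \<in> ?R" using x by (auto simp: valid_def)
next
  fix x assume "x \<in> ?R"
  then obtain i j where "x = (d, 2 * i + j)" "valid d i j"
    using special_arc[OF d] by (auto simp: valid_def)
  then show "x \<in> ?L" using d valid_in_arcs_F by simp
qed

lemma out_arcs_F_ordinary:
  assumes "ordinary_out v \<noteq> {}"
  shows "out_arcs F (v, 0) = (\<lambda>(f, j). (f, 2 * 1 + j)) ` (SIGMA f:ordinary_out v. copies f 1)"
    (is "?L = ?R")
proof (intro equalityI subsetI)
  fix x assume "x \<in> ?L"
  then obtain e i j where x: "x = (e, 2 * i + j)" "valid e i j" and t: "tail F x = (v, 0)"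
    by (auto elim: arcs_FE)
  have e: "\<not> special e"
    using t x assms special_after_special[of e] by (auto simp: ordinary_out_def)
  moreover have "i = 1" using valid_ordinary[OF x(2) e] .
  ultimately show "x \<in> ?R" using x t by (auto simp: valid_def ordinary_out_def)
next
  fix x assume "x \<in> ?R"
  then obtain f j where "x = (f, 2 * 1 + j)" "valid f 1 j" "f \<in> ordinary_out v"
    using weight_pos by (auto simp: valid_def ordinary_out_def)
  then show "x \<in> ?L" using valid_in_arcs_F[of f 1 j] by (auto simp: ordinary_out_def)
qed

lemma out_arcs_F_cases:
  assumes "x \<in> out_arcs F p"
  obtains (special) d where "special d" "p = (head E d, main_piece (head E d))"
    | (ordinary) v where "ordinary_out v \<noteq> {}" "p = (v, 0)"
proof -
  from assms obtain e i j where x: "x = (e, 2 * i + j)" "valid e i j" and t: "tail F x = p"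
    by (auto elim: arcs_FE)
  show ?thesis
  proof (cases "special e")
    case True
    then show ?thesis using x t by (intro special[of e]) auto
  next
    case False
    then show ?thesis using x t
      by (intro ordinary[of "tail E e"]) (auto simp: valid_def ordinary_out_def)
  qed
qed

lemma row_finite_F: "row_finite F"
  unfolding row_finite_def
proof
  fix p assume "p \<in> verts F"
  show "finite (out_arcs F p)"
  proof (rule ccontr)
    assume inf: "infinite (out_arcs F p)"
    then obtain x where "x \<in> out_arcs F p" by (metis finite.emptyI equals0I)
    then show False
      by (cases rule: out_arcs_F_cases)
        (use inf in \<open>auto simp: out_arcs_F_special out_arcs_F_ordinary\<close>)
  qed
qed

lemma sum_out_arcs_F_special:
  assumes "special d"
  shows "sum g (out_arcs F (head E d, main_piece (head E d))) =
    (\<Sum>i=1..w d. \<Sum>j\<in>copies d i. g (d, 2 * i + j))"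
proof -
  have "inj_on (\<lambda>(i, j). (d, 2 * i + j)) (SIGMA i:{1..w d}. copies d i)"
    using copies_less[of _ d] by (intro inj_onI) (clarsimp simp: index_eq_iff)
  then show ?thesis unfolding out_arcs_F_special[OF assms]
    by (simp add: sum.reindex sum.Sigma case_prod_unfold)
qed

lemma sum_out_arcs_F_ordinary:
  assumes "ordinary_out v \<noteq> {}"
  shows "sum g (out_arcs F (v, 0)) = (\<Sum>f\<in>ordinary_out v. \<Sum>j\<in>copies f 1. g (f, 2 * 1 + j))"
proof -
  have "inj_on (\<lambda>(f, j). (f, 2 * 1 + j)) (SIGMA f:ordinary_out v. copies f 1)"
    by (intro inj_onI) auto
  then show ?thesis unfolding out_arcs_F_ordinary[OF assms]
    by (simp add: sum.reindex sum.Sigma case_prod_unfold)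
qed

interpretation F: weighted_digraph F "\<lambda>_. 1" K
  by (intro weighted_digraph.intro wf_F weighted_digraph_axioms.intro row_finite_F)

abbreviation congF :: "(('v \<times> nat, 'e \<times> nat) gen, 'k) free \<Rightarrow> (('v \<times> nat, 'e \<times> nat) gen, 'k) free \<Rightarrow> bool"
    (infix "\<simeq>" 50)
  where "congF \<equiv> pcong (wlpa_gens F (\<lambda>_. 1)) (wlpa_relations F (\<lambda>_. 1))"

lemma edge_1: "edge (\<lambda>_. 1) x 1 = letter (Edge x 1)" "ghost (\<lambda>_. 1) x 1 = letter (Ghost x 1)"
  by (simp_all add: edge_def ghost_def)

lemma vertex_weight_F: "out_arcs F p \<noteq> {} \<Longrightarrow> vertex_weight F (\<lambda>_. 1) p = 1"
  by (simp add: vertex_weight_def image_constant_conv)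

lemma F_ghost_edge:
  assumes "x \<in> arcs F" "y \<in> arcs F" "tail F x = tail F y"
  shows "letter (Ghost x 1) * letter (Edge y 1) \<simeq> (if x = y then vert (head F x) else 0)"
proof -
  have "x \<in> out_arcs F (tail F x)" using assms(1) by simp
  then have "out_arcs F (tail F x) \<noteq> {}" by blast
  then show ?thesis using F.sum_ghost_edge[OF assms]
    by (simp add: vertex_weight_F edge_1 del: One_nat_def)
qed

lemma F_edge_ghost:
  assumes "p \<in> verts F" "out_arcs F p \<noteq> {}"
  shows "(\<Sum>x\<in>out_arcs F p. letter (Edge x 1) * letter (Ghost x 1)) \<simeq> vert p"
  using F.sum_edge_ghost[OF assms, of 1 1] vertex_weight_F[OF assms(2)]
  by (simp add: edge_1 del: One_nat_def)

text \<open>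
  The generators of \<open>L\<^sub>K(F)\<close> are renamed after the elements \<open>e\<^sub>i\<close> (\<open>fwd\<close>) and \<open>e\<^sub>i\<^sup>*\<close> (\<open>bwd\<close>) from which
  they come, with \<open>src\<close> and \<open>tgt\<close> the pieces at the source and the range of \<open>e\<close> in \<open>E\<close>. This treats
  reversed and ordinary edges alike.
\<close>

definition fwd :: "'e \<Rightarrow> nat \<Rightarrow> nat \<Rightarrow> (('v \<times> nat, 'e \<times> nat) gen, 'k) free" where
  "fwd e i j = letter (if special e then Ghost (e, 2 * i + j) 1 else Edge (e, 2 * i + j) 1)"

definition bwd :: "'e \<Rightarrow> nat \<Rightarrow> nat \<Rightarrow> (('v \<times> nat, 'e \<times> nat) gen, 'k) free" where
  "bwd e i j = letter (if special e then Edge (e, 2 * i + j) 1 else Ghost (e, 2 * i + j) 1)"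

definition src :: "'e \<Rightarrow> nat \<Rightarrow> nat" where
  "src e j = (if special e then j else 0)"

definition tgt :: "'e \<Rightarrow> nat \<Rightarrow> nat" where
  "tgt e j = (if special e then main_piece (head E e) else j)"

lemma src_in_pieces: "valid e i j \<Longrightarrow> src e j \<in> pieces (tail E e)"
  using copies_special_subset[of e i] ordinary_0_in_pieces[of e] by (auto simp: src_def valid_def)

lemma tgt_in_pieces: "valid e i j \<Longrightarrow> tgt e j \<in> pieces (head E e)"
  using main_piece_in_pieces[of e] by (auto simp: tgt_def valid_def copies_def)

lemma
  assumes "valid e i j"
  shows src_fwd: "vert (tail E e, src e j) * fwd e i j \<simeq> fwd e i j"
    and fwd_tgt: "fwd e i j * vert (head E e, tgt e j) \<simeq> fwd e i j"
    and tgt_bwd: "vert (head E e, tgt e j) * bwd e i j \<simeq> bwd e i j"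
    and bwd_src: "bwd e i j * vert (tail E e, src e j) \<simeq> bwd e i j"
proof -
  note x = valid_in_arcs_F[OF assms] and j = valid_less[OF assms]
  note rels = F.tail_edge[OF x, of 1] F.edge_head[OF x, of 1] F.head_ghost[OF x, of 1] F.ghost_tail[OF x, of 1]
  note unf = fwd_def bwd_def src_def tgt_def
  show "vert (tail E e, src e j) * fwd e i j \<simeq> fwd e i j"
    using rels j by (cases "special e") (simp_all add: unf edge_1 del: One_nat_def)
  show "fwd e i j * vert (head E e, tgt e j) \<simeq> fwd e i j"
    using rels j by (cases "special e") (simp_all add: unf edge_1 del: One_nat_def)
  show "vert (head E e, tgt e j) * bwd e i j \<simeq> bwd e i j"
    using rels j by (cases "special e") (simp_all add: unf edge_1 del: One_nat_def)
  show "bwd e i j * vert (tail E e, src e j) \<simeq> bwd e i j"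
    using rels j by (cases "special e") (simp_all add: unf edge_1 del: One_nat_def)
qed

lemma F_vert_idem: "vert p * vert p \<simeq> vert p"
  using F.vert_vert[of p p] by simp

lemma F_vert_vert_0: "p \<noteq> q \<Longrightarrow> vert p * vert q \<simeq> 0"
  using F.vert_vert[of p q] by simp

lemma F_vert_mult_other: "vert p * y \<simeq> y \<Longrightarrow> q \<noteq> p \<Longrightarrow> vert q * y \<simeq> 0"
  by (rule pcong_mult_orthogonal[OF F_vert_idem _ F_vert_vert_0])

lemma F_mult_vert_other: "y * vert p \<simeq> y \<Longrightarrow> q \<noteq> p \<Longrightarrow> y * vert q \<simeq> 0"
  by (rule pcong_mult_orthogonal[OF _ F_vert_idem F_vert_vert_0]) auto

definition vsum :: "'v \<Rightarrow> (('v \<times> nat, 'e \<times> nat) gen, 'k) free" where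
  "vsum v = (\<Sum>k\<in>pieces v. vert (v, k))"

lemma vsum_mult:
  assumes "k \<in> pieces v" "vert (v, k) * y \<simeq> y"
  shows "vsum v * y \<simeq> y"
  unfolding vsum_def sum_distrib_right
  using assms by (intro pcong_sum_single[of _ k] F_vert_mult_other[OF assms(2)]) auto

lemma mult_vsum:
  assumes "k \<in> pieces v" "y * vert (v, k) \<simeq> y"
  shows "y * vsum v \<simeq> y"
  unfolding vsum_def sum_distrib_left
  using assms by (intro pcong_sum_single[of _ k] F_mult_vert_other[OF assms(2)]) auto

lemma vsum_vsum: "vsum u * vsum v \<simeq> (if u = v then vsum u else 0)"
proof (cases "u = v")
  case True
  have "vsum u * vsum u \<simeq> (\<Sum>k\<in>pieces u. vert (u, k) * vert (u, k))"
    unfolding vsum_def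
  proof (rule pcong_mult_sums_diagonal)
    fix i j assume "i \<noteq> (j :: nat)"
    then show "vert (u, i) * vert (u, j) \<simeq> 0" using F.vert_vert[of "(u, i)" "(u, j)"] by simp
  qed simp
  also have "\<dots> \<simeq> vsum u" unfolding vsum_def by (intro pcong_sum F_vert_idem)
  finally show ?thesis using True by simp
next
  case False
  have "vsum u * vsum v \<simeq> 0" unfolding vsum_def sum_product
  proof (intro pcong_sum_0)
    fix i j show "vert (u, i) * vert (v, j) \<simeq> 0"
      using False F.vert_vert[of "(u, i)" "(v, j)"] by simp
  qed
  with False show ?thesis by simp
qed

lemma bwd_fwd_other_src:
  assumes "valid e i j" "valid f i' j'" "src e j \<noteq> src f j'"
  shows "bwd e i j * fwd f i' j' \<simeq> 0"
  by (rule pcong_mult_orthogonal[OF bwd_src[OF assms(1)] src_fwd[OF assms(2)] F_vert_vert_0])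
    (use assms(3) in simp)

lemma fwd_bwd_other_tgt:
  assumes "valid e i j" "valid f i' j'" "tgt e j \<noteq> tgt f j'"
  shows "fwd e i j * bwd f i' j' \<simeq> 0"
  by (rule pcong_mult_orthogonal[OF fwd_tgt[OF assms(1)] tgt_bwd[OF assms(2)] F_vert_vert_0])
    (use assms(3) in simp)

lemma fwd_bwd_special:
  assumes "special d" "valid d i j" "valid d i' j'"
  shows "fwd d i j * bwd d i' j' \<simeq> (if i = i' \<and> j = j' then vert (tail E d, j) else 0)"
  using F_ghost_edge[OF valid_in_arcs_F[OF assms(2)] valid_in_arcs_F[OF assms(3)]]
    valid_less[OF assms(2)] valid_less[OF assms(3)] assms(1)
  by (cases "i = i' \<and> j = j'") (auto simp: fwd_def bwd_def index_eq_iff)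

lemma bwd_fwd_ordinary:
  assumes "valid e 1 j" "valid f 1 j'" "\<not> special e" "\<not> special f" "tail E e = tail E f"
  shows "bwd e 1 j * fwd f 1 j' \<simeq> (if e = f \<and> j = j' then vert (head E e, j) else 0)"
  using F_ghost_edge[OF valid_in_arcs_F[OF assms(1)] valid_in_arcs_F[OF assms(2)]]
    valid_less[OF assms(1)] assms(3-)
  by (cases "e = f \<and> j = j'") (auto simp: fwd_def bwd_def)

lemma sum_bwd_fwd_special:
  assumes "special d"
  shows "(\<Sum>i=1..w d. \<Sum>j\<in>copies d i. bwd d i j * fwd d i j) \<simeq> vsum (head E d)"
proof -
  have d: "d \<in> arcs E" using assms by (rule special_arc)
  have "valid d 1 1" using d assms weight_pos[OF d] by (simp add: valid_def copies_def)
  then have "out_arcs F (head E d, main_piece (head E d)) \<noteq> {}"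
    using in_out_arcs_conv[of "(d, 2 * 1 + 1)" F] valid_in_arcs_F[of d 1 1] assms by fastforce
  from F_edge_ghost[OF _ this] show ?thesis
    using d assms by (simp add: vsum_def pieces_head_special sum_out_arcs_F_special fwd_def bwd_def)
qed

lemma sum_fwd_bwd_ordinary:
  assumes "ordinary_out v \<noteq> {}"
  shows "(\<Sum>f\<in>ordinary_out v. \<Sum>j\<in>copies f 1. fwd f 1 j * bwd f 1 j) \<simeq> vert (v, 0)"
proof -
  obtain e where e: "e \<in> arcs E" "\<not> special e" "tail E e = v" using assms by (auto simp: ordinary_out_def)
  then have v: "(v, 0) \<in> verts F" using ordinary_0_in_pieces[of e] by auto
  have "e \<in> ordinary_out v" "copies e 1 \<noteq> {}"
    using e by (auto simp: ordinary_out_def copies_def pieces_def)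
  then have "out_arcs F (v, 0) \<noteq> {}"
    unfolding out_arcs_F_ordinary[OF assms] image_is_empty by blast
  from F_edge_ghost[OF v this]
  have "(\<Sum>f\<in>ordinary_out v. \<Sum>j\<in>copies f 1. letter (Edge (f, 2 * 1 + j) 1) * letter (Ghost (f, 2 * 1 + j) 1))
      \<simeq> vert (v, 0)"
    unfolding sum_out_arcs_F_ordinary[OF assms] .
  also have "(\<Sum>f\<in>ordinary_out v. \<Sum>j\<in>copies f 1. letter (Edge (f, 2 * 1 + j) 1) * letter (Ghost (f, 2 * 1 + j) 1))
      = (\<Sum>f\<in>ordinary_out v. \<Sum>j\<in>copies f 1. fwd f 1 j * bwd f 1 j)"
    by (intro sum.cong) (auto simp: fwd_def bwd_def ordinary_out_def)
  finally show ?thesis .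
qed


section \<open>The homomorphism to the unweighted algebra\<close>

fun to_unweighted :: "('v, 'e) gen \<Rightarrow> (('v \<times> nat, 'e \<times> nat) gen, 'k) free" where
  "to_unweighted (Vert v) = vsum v"
| "to_unweighted (Edge e i) = (\<Sum>j\<in>copies e i. fwd e i j)"
| "to_unweighted (Ghost e i) = (\<Sum>j\<in>copies e i. bwd e i j)"

lemma to_unweighted_edge: "substitute to_unweighted (X e i) = (if 1 \<le> i \<and> i \<le> w e then \<Sum>j\<in>copies e i. fwd e i j else 0)"
  by (simp add: edge_def)

lemma to_unweighted_ghost: "substitute to_unweighted (Y e i) = (if 1 \<le> i \<and> i \<le> w e then \<Sum>j\<in>copies e i. bwd e i j else 0)"
  by (simp add: ghost_def)

lemma to_unweighted_closed:
  assumes "x \<in> wlpa_gens E w"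
  shows "to_unweighted x \<in> free_algebra (wlpa_gens F (\<lambda>_. 1))"
proof -
  have "fwd e i j \<in> free_algebra (wlpa_gens F (\<lambda>_. 1))" "bwd e i j \<in> free_algebra (wlpa_gens F (\<lambda>_. 1))"
    if "valid e i j" for e i j
    using valid_in_arcs_F[OF that] by (auto simp: fwd_def bwd_def wlpa_gens_def)
  moreover have "vsum v \<in> free_algebra (wlpa_gens F (\<lambda>_. 1))" if "v \<in> verts E" for v
    unfolding vsum_def using that by (intro free_algebra_sum) (auto simp: wlpa_gens_def)
  ultimately show ?thesis
    using assms by (auto simp: wlpa_gens_def valid_def intro!: free_algebra_sum)
qed

text \<open>
  For an ordinary edge this is the relation \<open>f\<^sup>* f = r(f)\<close> of \<open>F\<close>, summed over the pieces of the range.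
  For a special edge the roles are exchanged: it is the relation \<open>\<Sum> f f\<^sup>* = x\<close> of \<open>F\<close> at the range
  \<open>x\<close>, which emits the reversed copies and nothing else. The products of a special
  and an ordinary edge vanish because the two edges start at different pieces of their common source.
\<close>

lemma to_unweighted_ghost_edge:
  assumes e: "e \<in> arcs E" and f: "f \<in> arcs E" and tails: "tail E e = tail E f"
  shows "(\<Sum>i=1..vertex_weight E w (tail E e). substitute to_unweighted (Y e i) * substitute to_unweighted (X f i))
    \<simeq> (if e = f then vsum (head E e) else 0)"
proof (cases "special e \<and> special f")
  case True
  then have [simp]: "f = e" using special_tail_unique tails by metis
  have "(\<Sum>i=1..w e. substitute to_unweighted (Y e i) * substitute to_unweighted (X e i))
      = (\<Sum>i=1..w e. (\<Sum>j\<in>copies e i. bwd e i j) * (\<Sum>j\<in>copies e i. fwd e i j))"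
    by (intro sum.cong) (auto simp: to_unweighted_edge to_unweighted_ghost)
  also have "\<dots> \<simeq> (\<Sum>i=1..w e. \<Sum>j\<in>copies e i. bwd e i j * fwd e i j)"
  proof (intro pcong_sum pcong_mult_sums_diagonal)
    fix i j j' assume "i \<in> {1..w e}" "j \<in> copies e i" "j' \<in> copies e i" "j \<noteq> j'"
    then show "bwd e i j * fwd e i j' \<simeq> 0"
      using e True by (intro bwd_fwd_other_src) (auto simp: valid_def src_def)
  qed simp
  also have "\<dots> \<simeq> vsum (head E e)" using True by (intro sum_bwd_fwd_special) simp
  finally show ?thesis using True by (simp add: vertex_weight_special)
next
  case False
  then have ns: "\<not> special e \<or> \<not> special f" by blast
  have valid: "valid e 1 j" if "j \<in> copies e 1" for j using that e weight_pos[OF e] by (simp add: valid_def)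
  have valid': "valid f 1 j" if "j \<in> copies f 1" for j using that f weight_pos[OF f] by (simp add: valid_def)
  have "(\<Sum>i=1..vertex_weight E w (tail E e). substitute to_unweighted (Y e i) * substitute to_unweighted (X f i))
      = substitute to_unweighted (Y e 1) * substitute to_unweighted (X f 1)"
    using sum_over_weights[OF e f tails ns, of "\<lambda>p q. substitute to_unweighted p * substitute to_unweighted q"] by simp
  also have "\<dots> = (\<Sum>j\<in>copies e 1. bwd e 1 j) * (\<Sum>j\<in>copies f 1. fwd f 1 j)"
    using weight_pos[OF e] weight_pos[OF f] by (simp add: to_unweighted_edge to_unweighted_ghost)
  also have "\<dots> \<simeq> (if e = f then vsum (head E e) else 0)"
  proof (cases "e = f")
    case True
    with ns have "\<not> special e" by simp
    have "(\<Sum>j\<in>copies e 1. bwd e 1 j) * (\<Sum>j\<in>copies e 1. fwd e 1 j) \<simeq> (\<Sum>j\<in>copies e 1. bwd e 1 j * fwd e 1 j)"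
    proof (rule pcong_mult_sums_diagonal)
      fix i j assume "i \<in> copies e 1" "j \<in> copies e 1" "i \<noteq> j"
      then show "bwd e 1 i * fwd e 1 j \<simeq> 0"
        using bwd_fwd_ordinary[of e i e j] valid \<open>\<not> special e\<close> by simp
    qed simp
    also have "\<dots> \<simeq> (\<Sum>j\<in>copies e 1. vert (head E e, j))"
    proof (rule pcong_sum)
      fix i assume "i \<in> copies e 1"
      then show "bwd e 1 i * fwd e 1 i \<simeq> vert (head E e, i)"
        using bwd_fwd_ordinary[of e i e i] valid \<open>\<not> special e\<close> by simp
    qed
    also have "\<dots> = vsum (head E e)" using \<open>\<not> special e\<close> by (simp add: copies_def vsum_def)
    finally show ?thesis using True by simp
  next
    case False
    have "(\<Sum>j\<in>copies e 1. bwd e 1 j) * (\<Sum>j\<in>copies f 1. fwd f 1 j) \<simeq> 0"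
      unfolding sum_product
    proof (intro pcong_sum_0)
      fix i j assume ij: "i \<in> copies e 1" "j \<in> copies f 1"
      show "bwd e 1 i * fwd f 1 j \<simeq> 0"
      proof (cases "special e \<or> special f")
        case True
        then have "src e i \<noteq> src f j" using ij ns by (auto simp: src_def copies_def)
        then show ?thesis using valid[OF ij(1)] valid'[OF ij(2)] by (intro bwd_fwd_other_src)
      next
        case False
        then show ?thesis
          using bwd_fwd_ordinary[OF valid[OF ij(1)] valid'[OF ij(2)]] tails \<open>e \<noteq> f\<close> by simp
      qed
    qed
    then show ?thesis using False by simp
  qed
  finally show ?thesis .
qed

text \<open>
  The ordinary edges add up to piece 0 of \<open>v\<close>, and the special edge contributes piece 1.
\<close>

lemma to_unweighted_edge_ghost_1:
  assumes v: "v \<in> verts E" "out_arcs E v \<noteq> {}"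
  shows "(\<Sum>e\<in>out_arcs E v. substitute to_unweighted (X e 1) * substitute to_unweighted (Y e 1)) \<simeq> vsum v"
proof -
  let ?t = "\<lambda>e. substitute to_unweighted (X e 1) * substitute to_unweighted (Y e 1)"
  have t: "?t e = (\<Sum>j\<in>copies e 1. fwd e 1 j) * (\<Sum>j\<in>copies e 1. bwd e 1 j)" if "e \<in> arcs E" for e
    using weight_pos[OF that] by (simp add: to_unweighted_edge to_unweighted_ghost)
  have ordinary: "sum ?t (ordinary_out v) \<simeq> (if ordinary_out v = {} then 0 else vert (v, 0))"
  proof (cases "ordinary_out v = {}")
    case False
    have "sum ?t (ordinary_out v) \<simeq> (\<Sum>e\<in>ordinary_out v. \<Sum>j\<in>copies e 1. fwd e 1 j * bwd e 1 j)"
    proof (rule pcong_sum)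
      fix e assume "e \<in> ordinary_out v"
      then have e: "e \<in> arcs E" "\<not> special e" by (auto simp: ordinary_out_def)
      show "?t e \<simeq> (\<Sum>j\<in>copies e 1. fwd e 1 j * bwd e 1 j)"
        unfolding t[OF e(1)]
      proof (rule pcong_mult_sums_diagonal)
        fix i j assume "i \<in> copies e 1" "j \<in> copies e 1" "i \<noteq> j"
        then show "fwd e 1 i * bwd e 1 j \<simeq> 0"
          using e weight_pos[OF e(1)] by (intro fwd_bwd_other_tgt) (auto simp: valid_def tgt_def)
      qed simp
    qed
    also have "\<dots> \<simeq> vert (v, 0)" by (rule sum_fwd_bwd_ordinary[OF False])
    finally show ?thesis using False by simp
  qed simp
  show ?thesis
  proof (cases "emits_special v")
    case True
    then obtain d where d: "special d" "tail E d = v" "d \<in> arcs E" by (elim emits_specialE)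
    have "valid d 1 1" using d weight_pos[OF d(3)] by (simp add: valid_def copies_def)
    then have "?t d \<simeq> vert (v, 1)"
      using fwd_bwd_special[of d 1 1 1 1] d t[OF d(3)] by (simp add: copies_def)
    from pcong_add[OF this ordinary]
    have "sum ?t (out_arcs E v) \<simeq> vert (v, 1) + (if ordinary_out v = {} then 0 else vert (v, 0))"
      using out_arcs_special[OF d(1)] d(2) by simp
    also have "\<dots> = vsum v"
    proof -
      have "pieces v = (if ordinary_out v = {} then {1} else {1, 0})"
        using True by (auto simp: pieces_def)
      then show ?thesis by (simp add: vsum_def)
    qed
    finally show ?thesis .
  next
    case False
    then have "pieces v = {0}" "out_arcs E v = ordinary_out v"
      using out_arcs_no_special by (auto simp: pieces_def)
    then show ?thesis using ordinary v by (simp add: vsum_def)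
  qed
qed

lemma to_unweighted_edge_ghost:
  assumes v: "v \<in> verts E" "out_arcs E v \<noteq> {}"
    and i: "1 \<le> i" "i \<le> vertex_weight E w v" and j: "1 \<le> j" "j \<le> vertex_weight E w v"
  shows "(\<Sum>e\<in>out_arcs E v. substitute to_unweighted (X e i) * substitute to_unweighted (Y e j))
    \<simeq> (if i = j then vsum v else 0)"
proof (cases "i = 1 \<and> j = 1")
  case True
  then show ?thesis using to_unweighted_edge_ghost_1[OF v] by simp
next
  case False
  have "emits_special v"
    using False i j v vertex_weight_no_special[of v] by (metis ex_in_conv le_antisym)
  then obtain d where d: "special d" "tail E d = v" "d \<in> arcs E" by (elim emits_specialE)
  then have w: "vertex_weight E w v = w d" using vertex_weight_special by blast
  have valid: "valid d i k" if "k \<in> copies d i" for k using that i w d by (simp add: valid_def)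
  have valid': "valid d j k" if "k \<in> copies d j" for k using that j w d by (simp add: valid_def)
  have "(\<Sum>e\<in>ordinary_out v. substitute to_unweighted (X e i) * substitute to_unweighted (Y e j)) = 0"
    using False by (intro sum.neutral) (auto simp: to_unweighted_edge to_unweighted_ghost ordinary_out_def ordinary_weight)
  then have "(\<Sum>e\<in>out_arcs E v. substitute to_unweighted (X e i) * substitute to_unweighted (Y e j))
      = substitute to_unweighted (X d i) * substitute to_unweighted (Y d j)"
    using out_arcs_special[OF d(1)] d(2) by simp
  also have "\<dots> = (\<Sum>k\<in>copies d i. fwd d i k) * (\<Sum>k\<in>copies d j. bwd d j k)"
    using i j w by (simp add: to_unweighted_edge to_unweighted_ghost)
  also have "\<dots> \<simeq> (if i = j then vsum v else 0)"
  proof (cases "i = j")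
    case True
    have "(\<Sum>k\<in>copies d i. fwd d i k) * (\<Sum>k\<in>copies d i. bwd d i k) \<simeq> (\<Sum>k\<in>copies d i. fwd d i k * bwd d i k)"
    proof (rule pcong_mult_sums_diagonal)
      fix k l assume "k \<in> copies d i" "l \<in> copies d i" "k \<noteq> l"
      then show "fwd d i k * bwd d i l \<simeq> 0"
        using fwd_bwd_special[OF d(1) valid valid, of k l] by simp
    qed simp
    also have "\<dots> \<simeq> (\<Sum>k\<in>copies d i. vert (v, k))"
    proof (rule pcong_sum)
      fix k assume "k \<in> copies d i"
      then show "fwd d i k * bwd d i k \<simeq> vert (v, k)"
        using fwd_bwd_special[OF d(1) valid valid, of k k] d by simp
    qed
    also have "\<dots> = vsum v" using d True False by (simp add: vsum_def copies_def)
    finally show ?thesis using True by simp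
  next
    case neq: False
    have "(\<Sum>k\<in>copies d i. fwd d i k) * (\<Sum>k\<in>copies d j. bwd d j k) \<simeq> 0"
      unfolding sum_product
    proof (intro pcong_sum_0)
      fix k l assume "k \<in> copies d i" "l \<in> copies d j"
      then show "fwd d i k * bwd d j l \<simeq> 0"
        using fwd_bwd_special[OF d(1) valid valid', of k l] neq by simp
    qed
    then show ?thesis using neq by simp
  qed
  finally show ?thesis .
qed

lemma vsum_fwd: "valid e i j \<Longrightarrow> vsum (tail E e) * fwd e i j \<simeq> fwd e i j"
  using vsum_mult[OF src_in_pieces src_fwd] by blast

lemma fwd_vsum: "valid e i j \<Longrightarrow> fwd e i j * vsum (head E e) \<simeq> fwd e i j"
  using mult_vsum[OF tgt_in_pieces fwd_tgt] by blast

lemma vsum_bwd: "valid e i j \<Longrightarrow> vsum (head E e) * bwd e i j \<simeq> bwd e i j"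
  using vsum_mult[OF tgt_in_pieces tgt_bwd] by blast

lemma bwd_vsum: "valid e i j \<Longrightarrow> bwd e i j * vsum (tail E e) \<simeq> bwd e i j"
  using mult_vsum[OF src_in_pieces bwd_src] by blast

lemma to_unweighted_relations:
  assumes "r \<in> wlpa_relations E w"
  shows "substitute to_unweighted r \<simeq> 0"
  using assms
proof cases
  case (vertices u v)
  then show ?thesis using pcong_diff_0[OF vsum_vsum[of u v]] by (cases "u = v") simp_all
next
  case (source_edge e i)
  have "vsum (tail E e) * (\<Sum>j\<in>copies e i. fwd e i j) \<simeq> (\<Sum>j\<in>copies e i. fwd e i j)"
    unfolding sum_distrib_left using source_edge by (intro pcong_sum vsum_fwd) (simp add: valid_def)
  then show ?thesis using source_edge by (simp add: to_unweighted_edge pcong_diff_0)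
next
  case (edge_range e i)
  have "(\<Sum>j\<in>copies e i. fwd e i j) * vsum (head E e) \<simeq> (\<Sum>j\<in>copies e i. fwd e i j)"
    unfolding sum_distrib_right using edge_range by (intro pcong_sum fwd_vsum) (simp add: valid_def)
  then show ?thesis using edge_range by (simp add: to_unweighted_edge pcong_diff_0)
next
  case (range_ghost e i)
  have "vsum (head E e) * (\<Sum>j\<in>copies e i. bwd e i j) \<simeq> (\<Sum>j\<in>copies e i. bwd e i j)"
    unfolding sum_distrib_left using range_ghost by (intro pcong_sum vsum_bwd) (simp add: valid_def)
  then show ?thesis using range_ghost by (simp add: to_unweighted_ghost pcong_diff_0)
next
  case (ghost_source e i)
  have "(\<Sum>j\<in>copies e i. bwd e i j) * vsum (tail E e) \<simeq> (\<Sum>j\<in>copies e i. bwd e i j)"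
    unfolding sum_distrib_right using ghost_source by (intro pcong_sum bwd_vsum) (simp add: valid_def)
  then show ?thesis using ghost_source by (simp add: to_unweighted_ghost pcong_diff_0)
next
  case (ghost_edge v e f)
  then have "tail E e = v" "tail E f = v" "e \<in> arcs E" "f \<in> arcs E" by auto
  then show ?thesis
    using pcong_diff_0[OF to_unweighted_ghost_edge[of e f]] unfolding ghost_edge(1)
    by (cases "e = f") simp_all
next
  case (edge_ghost v i j)
  then have "v \<in> verts E" "out_arcs E v \<noteq> {}" by (auto simp: regular_def)
  then show ?thesis
    using pcong_diff_0[OF to_unweighted_edge_ghost[of v i j]] edge_ghost unfolding edge_ghost(1)
    by (cases "i = j") simp_all
qed

section \<open>The homomorphism from the unweighted algebra\<close>

text \<open>
  The copies of an edge are obtained by cutting it down to the pieces of its range or, for a special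
  edge, of its source.
\<close>

fun to_weighted :: "('v \<times> nat, 'e \<times> nat) gen \<Rightarrow> (('v, 'e) gen, 'k) free" where
  "to_weighted (Vert (v, j)) = piece v j"
| "to_weighted (Edge (e, m) _) = (if special e then Y e (m div 2) * piece (tail E e) (m mod 2)
     else X e (m div 2) * piece (head E e) (m mod 2))"
| "to_weighted (Ghost (e, m) _) = (if special e then piece (tail E e) (m mod 2) * X e (m div 2)
     else piece (head E e) (m mod 2) * Y e (m div 2))"

lemma to_weighted_edge:
  "j < 2 \<Longrightarrow> to_weighted (Edge (e, 2 * i + j) k) =
    (if special e then Y e i * piece (tail E e) j else X e i * piece (head E e) j)"
  "j < 2 \<Longrightarrow> to_weighted (Ghost (e, 2 * i + j) k) =
    (if special e then piece (tail E e) j * X e i else piece (head E e) j * Y e i)"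
  by simp_all

lemma piece_idem: "j < 2 \<Longrightarrow> piece v j * piece v j \<approx> piece v j"
  using piece_piece_same[of j j v] by simp

lemma edge_ghost_closed:
  "e \<in> arcs E \<Longrightarrow> X e i \<in> free_algebra (wlpa_gens E w)"
  "e \<in> arcs E \<Longrightarrow> Y e i \<in> free_algebra (wlpa_gens E w)"
  by (auto simp: edge_def ghost_def wlpa_gens_def free_algebra_closed(1))

lemma piece_closed:
  assumes "v \<in> verts E"
  shows "piece v j \<in> free_algebra (wlpa_gens E w)"
proof -
  have "special_part v \<in> free_algebra (wlpa_gens E w)"
  proof (cases "emits_special v")
    case True
    then obtain d where d: "special d" "tail E d = v" "d \<in> arcs E" by (elim emits_specialE)
    then show ?thesis
      using special_part_tail[OF d(1)] by (simp add: free_algebra_closed(3) edge_ghost_closed)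
  qed (simp add: special_part_def free_algebra_closed(1))
  moreover have "vert v \<in> free_algebra (wlpa_gens E w)" using assms by (simp add: wlpa_gens_def)
  ultimately show ?thesis by (simp add: piece_def free_algebra_diff)
qed

lemma to_weighted_closed:
  assumes "y \<in> wlpa_gens F (\<lambda>_. 1)"
  shows "to_weighted y \<in> free_algebra (wlpa_gens E w)"
proof -
  have arc: "to_weighted (Edge x 1) \<in> free_algebra (wlpa_gens E w)" "to_weighted (Ghost x 1) \<in> free_algebra (wlpa_gens E w)"
    if "x \<in> arcs F" for x
  proof -
    obtain e m where x: "x = (e, m)" by force
    have "e \<in> arcs E" using that by (simp add: F_def x)
    then show "to_weighted (Edge x 1) \<in> free_algebra (wlpa_gens E w)" "to_weighted (Ghost x 1) \<in> free_algebra (wlpa_gens E w)"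
      by (simp_all add: x free_algebra_closed(3) edge_ghost_closed piece_closed)
  qed
  show ?thesis
    using assms arc by (auto simp: wlpa_gens_def[of F] piece_closed)
qed

lemma to_weighted_tail_edge:
  assumes "valid e i j"
  shows "to_weighted (Vert (tail F (e, 2 * i + j))) * to_weighted (Edge (e, 2 * i + j) 1) \<approx> to_weighted (Edge (e, 2 * i + j) 1)"
    and "to_weighted (Ghost (e, 2 * i + j) 1) * to_weighted (Vert (tail F (e, 2 * i + j))) \<approx> to_weighted (Ghost (e, 2 * i + j) 1)"
proof -
  have j: "j < 2" and e: "e \<in> arcs E" using assms by (auto simp: valid_def intro: copies_less)
  show "to_weighted (Vert (tail F (e, 2 * i + j))) * to_weighted (Edge (e, 2 * i + j) 1) \<approx> to_weighted (Edge (e, 2 * i + j) 1)"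
  proof (cases "special e")
    case True
    have "piece (head E e) (main_piece (head E e)) * Y e i \<approx> vert (head E e) * Y e i"
      by (rule pcong_mult_right[OF main_piece_head_special[OF True]])
    also have "\<dots> \<approx> Y e i" by (rule head_ghost[OF e])
    finally have "(piece (head E e) (main_piece (head E e)) * Y e i) * piece (tail E e) j
      \<approx> Y e i * piece (tail E e) j" by (rule pcong_mult_right)
    then show ?thesis using True j by (simp add: mult.assoc)
  next
    case False
    have "(piece (tail E e) 0 * X e 1) * piece (head E e) j \<approx> X e 1 * piece (head E e) j"
      by (rule pcong_mult_right[OF piece_0_ordinary(1)[OF e False]])
    then show ?thesis using False j valid_ordinary[OF assms False] by (simp add: mult.assoc)
  qed
  show "to_weighted (Ghost (e, 2 * i + j) 1) * to_weighted (Vert (tail F (e, 2 * i + j))) \<approx> to_weighted (Ghost (e, 2 * i + j) 1)"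
  proof (cases "special e")
    case True
    have "X e i * piece (head E e) (main_piece (head E e)) \<approx> X e i * vert (head E e)"
      by (rule pcong_mult_left[OF main_piece_head_special[OF True]])
    also have "\<dots> \<approx> X e i" by (rule edge_head[OF e])
    finally have "piece (tail E e) j * (X e i * piece (head E e) (main_piece (head E e)))
      \<approx> piece (tail E e) j * X e i" by (rule pcong_mult_left)
    then show ?thesis using True j by (simp add: mult.assoc)
  next
    case False
    have "piece (head E e) j * (Y e 1 * piece (tail E e) 0) \<approx> piece (head E e) j * Y e 1"
      by (rule pcong_mult_left[OF piece_0_ordinary(2)[OF e False]])
    then show ?thesis using False j valid_ordinary[OF assms False] by (simp add: mult.assoc)
  qed
qed

lemma to_weighted_edge_head:
  assumes "valid e i j"
  shows "to_weighted (Edge (e, 2 * i + j) 1) * to_weighted (Vert (head F (e, 2 * i + j))) \<approx> to_weighted (Edge (e, 2 * i + j) 1)"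
    and "to_weighted (Vert (head F (e, 2 * i + j))) * to_weighted (Ghost (e, 2 * i + j) 1) \<approx> to_weighted (Ghost (e, 2 * i + j) 1)"
proof -
  have j: "j < 2" using assms by (rule valid_less)
  have right: "(y * piece v j) * piece v j \<approx> y * piece v j" for y v
    using pcong_mult_left[OF piece_idem[OF j]] by (simp add: mult.assoc)
  have left: "piece v j * (piece v j * y) \<approx> piece v j * y" for y v
    using pcong_mult_right[OF piece_idem[OF j]] by (simp add: mult.assoc)
  show "to_weighted (Edge (e, 2 * i + j) 1) * to_weighted (Vert (head F (e, 2 * i + j))) \<approx> to_weighted (Edge (e, 2 * i + j) 1)"
    using j right by simp
  show "to_weighted (Vert (head F (e, 2 * i + j))) * to_weighted (Ghost (e, 2 * i + j) 1) \<approx> to_weighted (Ghost (e, 2 * i + j) 1)"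
    using j left by simp
qed

lemma to_weighted_ghost_edge:
  assumes e: "valid e i j" and f: "valid f i' j'"
    and tails: "tail F (e, 2 * i + j) = tail F (f, 2 * i' + j')"
  shows "to_weighted (Ghost (e, 2 * i + j) 1) * to_weighted (Edge (f, 2 * i' + j') 1)
    \<approx> (if (e, 2 * i + j) = (f, 2 * i' + j') then to_weighted (Vert (head F (e, 2 * i + j))) else 0)"
proof -
  have j: "j < 2" "j' < 2" using e f valid_less by blast+
  have arcs: "e \<in> arcs E" "f \<in> arcs E" using e f by (auto simp: valid_def)
  have same: "special f" if "special e" "tail F (e, m) = tail F (f, m')" "f \<in> arcs E" for e f m m'
    using that special_after_special[of e f] by (auto split: if_splits)
  show ?thesis
  proof (cases "special e")
    case True
    then have "special f" using same tails arcs by blast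
    then have [simp]: "f = e" using True tails special_head_unique[of f e] by simp
    have "piece (tail E e) j * (X e i * Y e i') * piece (tail E e) j'
      \<approx> (if i = i' \<and> j = j' then piece (tail E e) j else 0)"
      using e f True by (intro piece_edge_ghost_piece) (auto simp: valid_def)
    then show ?thesis using True j
      by (cases "i = i' \<and> j = j'") (auto simp: index_eq_iff mult.assoc)
  next
    case False
    then have nf: "\<not> special f" using same[of f "2 * i' + j'" e "2 * i + j"] tails arcs by auto
    note [simp] = valid_ordinary[OF e False] valid_ordinary[OF f nf]
    have "tail E e = tail E f" using tails False nf by simp
    then have *: "Y e 1 * X f 1 \<approx> (if e = f then vert (head E e) else 0)"
      using ghost_edge_1[of e f] arcs False by simp
    have "(piece (head E e) j * (Y e 1 * X f 1)) * piece (head E f) j'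
      \<approx> (piece (head E e) j * (if e = f then vert (head E e) else 0)) * piece (head E f) j'"
      by (rule pcong_mult_right[OF pcong_mult_left[OF *]])
    also have "\<dots> \<approx> (if e = f \<and> j = j' then piece (head E e) j else 0)"
    proof (cases "e = f")
      case True
      have "(piece (head E f) j * vert (head E f)) * piece (head E f) j' \<approx> piece (head E f) j * piece (head E f) j'"
        by (rule pcong_mult_right[OF vert_piece(2)])
      also have "\<dots> \<approx> (if j = j' then piece (head E f) j else 0)" using j by (rule piece_piece_same)
      finally show ?thesis using True by (cases "j = j'") simp_all
    qed simp
    finally show ?thesis using False nf j
      by (cases "e = f \<and> j = j'") (auto simp: mult.assoc)
  qed
qed

text \<open>
  Summed over the copies of an edge, the pieces in the middle of the products add up to an idempotent
  that acts as the identity on the edge; what remains is a relation of the weighted algebra.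
\<close>

lemma to_weighted_edge_ghost:
  assumes "out_arcs F p \<noteq> {}"
  shows "(\<Sum>x\<in>out_arcs F p. to_weighted (Edge x 1) * to_weighted (Ghost x 1)) \<approx> to_weighted (Vert p)"
proof -
  obtain x where "x \<in> out_arcs F p" using assms by blast
  then show ?thesis
  proof (cases rule: out_arcs_F_cases)
    case (special d)
    let ?\<pi> = "piece (tail E d)"
    have d: "d \<in> arcs E" using special by (intro special_arc)
    have "(\<Sum>x\<in>out_arcs F p. to_weighted (Edge x 1) * to_weighted (Ghost x 1))
        = (\<Sum>i=1..w d. \<Sum>j\<in>copies d i. (Y d i * ?\<pi> j) * (?\<pi> j * X d i))"
      unfolding special(2) sum_out_arcs_F_special[OF special(1)]
      by (intro sum.cong refl) (use special(1) copies_less[of _ d] in \<open>simp add: to_weighted_edge del: to_weighted.simps\<close>)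
    also have "\<dots> \<approx> (\<Sum>i=1..w d. Y d i * X d i)"
    proof (rule pcong_sum)
      fix i assume i: "i \<in> {1..w d}"
      have "(\<Sum>j\<in>copies d i. (Y d i * ?\<pi> j) * (?\<pi> j * X d i))
          = (\<Sum>j\<in>copies d i. (Y d i * (?\<pi> j * ?\<pi> j)) * X d i)"
        by (simp add: mult.assoc)
      also have "\<dots> \<approx> (\<Sum>j\<in>copies d i. (Y d i * ?\<pi> j) * X d i)"
        by (intro pcong_sum pcong_mult_right pcong_mult_left piece_idem copies_less)
      also have "\<dots> = (Y d i * (\<Sum>j\<in>copies d i. ?\<pi> j)) * X d i"
        by (simp add: sum_distrib_left sum_distrib_right)
      also have "\<dots> \<approx> Y d i * X d i"
        using i by (intro pcong_mult_right sum_copies_special(2) special(1)) auto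
      finally show "(\<Sum>j\<in>copies d i. (Y d i * ?\<pi> j) * (?\<pi> j * X d i)) \<approx> Y d i * X d i" .
    qed
    also have "\<dots> \<approx> vert (head E d)" by (rule special_sum_ghost_edge[OF special(1)])
    also have "\<dots> \<approx> to_weighted (Vert p)"
      using pcong_sym[OF main_piece_head_special[OF special(1)]] special(2) by simp
    finally show ?thesis .
  next
    case (ordinary v)
    have "(\<Sum>x\<in>out_arcs F p. to_weighted (Edge x 1) * to_weighted (Ghost x 1))
        = (\<Sum>f\<in>ordinary_out v. \<Sum>j\<in>pieces (head E f).
            (X f 1 * piece (head E f) j) * (piece (head E f) j * Y f 1))"
      unfolding ordinary(2) sum_out_arcs_F_ordinary[OF ordinary(1)]
    proof (rule sum.cong[OF refl])
      fix f assume "f \<in> ordinary_out v"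
      then have f: "\<not> special f" by (simp add: ordinary_out_def)
      show "(\<Sum>j\<in>copies f 1. to_weighted (Edge (f, 2 * 1 + j) 1) * to_weighted (Ghost (f, 2 * 1 + j) 1))
          = (\<Sum>j\<in>pieces (head E f). (X f 1 * piece (head E f) j) * (piece (head E f) j * Y f 1))"
      proof (rule sum.cong)
        fix j assume "j \<in> pieces (head E f)"
        then have "j < 2" by (rule pieces_less)
        show "to_weighted (Edge (f, 2 * 1 + j) 1) * to_weighted (Ghost (f, 2 * 1 + j) 1)
            = (X f 1 * piece (head E f) j) * (piece (head E f) j * Y f 1)"
          unfolding to_weighted_edge[OF \<open>j < 2\<close>] using f by simp
      qed (use f in \<open>simp add: copies_def\<close>)
    qed
    also have "\<dots> \<approx> (\<Sum>f\<in>ordinary_out v. X f 1 * Y f 1)"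
    proof (rule pcong_sum)
      fix f assume "f \<in> ordinary_out v"
      then have f: "f \<in> arcs E" by (simp add: ordinary_out_def)
      let ?\<pi> = "piece (head E f)" and ?J = "pieces (head E f)"
      have "(\<Sum>j\<in>?J. (X f 1 * ?\<pi> j) * (?\<pi> j * Y f 1)) = (\<Sum>j\<in>?J. (X f 1 * (?\<pi> j * ?\<pi> j)) * Y f 1)"
        by (simp add: mult.assoc)
      also have "\<dots> \<approx> (\<Sum>j\<in>?J. (X f 1 * ?\<pi> j) * Y f 1)"
        by (intro pcong_sum pcong_mult_right pcong_mult_left piece_idem pieces_less)
      also have "\<dots> = (X f 1 * (\<Sum>j\<in>?J. ?\<pi> j)) * Y f 1"
        by (simp add: sum_distrib_left sum_distrib_right)
      also have "\<dots> \<approx> (X f 1 * vert (head E f)) * Y f 1"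
        by (intro pcong_mult_right pcong_mult_left sum_pieces)
      also have "\<dots> \<approx> X f 1 * Y f 1" by (rule pcong_mult_right[OF edge_head[OF f]])
      finally show "(\<Sum>j\<in>?J. (X f 1 * ?\<pi> j) * (?\<pi> j * Y f 1)) \<approx> X f 1 * Y f 1" .
    qed
    also have "\<dots> \<approx> to_weighted (Vert p)" using piece_0_conv_sum[OF ordinary(1)] ordinary(2) by simp
    finally show ?thesis .
  qed
qed

lemma to_weighted_relations:
  assumes "r \<in> wlpa_relations F (\<lambda>_. 1)"
  shows "substitute to_weighted r \<approx> 0"
  using assms
proof cases
  case (vertices p q)
  obtain u i v j where pq: "p = (u, i)" "q = (v, j)" by force
  have "piece u i * piece v j \<approx> (if u = v \<and> i = j then piece u i else 0)"
    using vertices pq pieces_less by (intro piece_piece) auto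
  from pcong_diff_0[OF this] show ?thesis
    unfolding vertices(1) pq by (cases "u = v \<and> i = j") auto
next
  case (source_edge x k)
  then obtain e i j where x: "x = (e, 2 * i + j)" "valid e i j" by (elim arcs_FE)
  have "k = 1" using source_edge by simp
  with pcong_diff_0[OF to_weighted_tail_edge(1)[OF x(2)]] show ?thesis
    unfolding source_edge(1) x(1) by (simp only: edge_1 substitute_diff substitute_mult substitute_letter)
next
  case (edge_range x k)
  then obtain e i j where x: "x = (e, 2 * i + j)" "valid e i j" by (elim arcs_FE)
  have "k = 1" using edge_range by simp
  with pcong_diff_0[OF to_weighted_edge_head(1)[OF x(2)]] show ?thesis
    unfolding edge_range(1) x(1) by (simp only: edge_1 substitute_diff substitute_mult substitute_letter)
next
  case (range_ghost x k)
  then obtain e i j where x: "x = (e, 2 * i + j)" "valid e i j" by (elim arcs_FE)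
  have "k = 1" using range_ghost by simp
  with pcong_diff_0[OF to_weighted_edge_head(2)[OF x(2)]] show ?thesis
    unfolding range_ghost(1) x(1) by (simp only: edge_1 substitute_diff substitute_mult substitute_letter)
next
  case (ghost_source x k)
  then obtain e i j where x: "x = (e, 2 * i + j)" "valid e i j" by (elim arcs_FE)
  have "k = 1" using ghost_source by simp
  with pcong_diff_0[OF to_weighted_tail_edge(2)[OF x(2)]] show ?thesis
    unfolding ghost_source(1) x(1) by (simp only: edge_1 substitute_diff substitute_mult substitute_letter)
next
  case (ghost_edge p x y)
  then have "x \<in> arcs F" "y \<in> arcs F" and tails: "tail F x = p" "tail F y = p"
    by (simp_all del: tail_F)
  then obtain e i j f i' j' where x: "x = (e, 2 * i + j)" "valid e i j"
    and y: "y = (f, 2 * i' + j')" "valid f i' j'"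
    by (elim arcs_FE) blast
  have "vertex_weight F (\<lambda>_. 1) p = 1" using ghost_edge by (intro vertex_weight_F) auto
  then have "substitute to_weighted r = to_weighted (Ghost x 1) * to_weighted (Edge y 1) - (if x = y then to_weighted (Vert (head F x)) else 0)"
    unfolding ghost_edge(1) by (simp only: atLeastAtMost_singleton) (simp add: edge_1 del: One_nat_def to_weighted.simps)
  also have "\<dots> \<approx> 0"
    using pcong_diff_0[OF to_weighted_ghost_edge[OF x(2) y(2)]] tails by (simp only: x(1) y(1))
  finally show ?thesis .
next
  case (edge_ghost p i j)
  then have ne: "out_arcs F p \<noteq> {}" by (simp add: regular_def)
  then have "i = 1" "j = 1" using edge_ghost by (simp_all add: vertex_weight_F del: One_nat_def)
  then have "substitute to_weighted r = (\<Sum>x\<in>out_arcs F p. to_weighted (Edge x 1) * to_weighted (Ghost x 1)) - to_weighted (Vert p)"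
    unfolding edge_ghost(1) by (simp add: edge_1 del: One_nat_def to_weighted.simps)
  also have "\<dots> \<approx> 0" by (rule pcong_diff_0[OF to_weighted_edge_ghost[OF ne]])
  finally show ?thesis .
qed


section \<open>The two homomorphisms are mutually inverse\<close>

lemma to_weighted_to_unweighted:
  assumes "x \<in> wlpa_gens E w"
  shows "substitute to_weighted (to_unweighted x) \<approx> letter x"
proof -
  consider (vert) v where "x = Vert v" | (edge) e i where "x = Edge e i" "e \<in> arcs E" "1 \<le> i" "i \<le> w e"
    | (ghost) e i where "x = Ghost e i" "e \<in> arcs E" "1 \<le> i" "i \<le> w e"
    using assms by (auto simp: wlpa_gens_def)
  then show ?thesis
  proof cases
    case vert
    then show ?thesis using sum_pieces by (simp add: vsum_def)
  next
    case edge
    show ?thesis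
    proof (cases "special e")
      case True
      have "substitute to_weighted (to_unweighted x) = (\<Sum>j\<in>copies e i. piece (tail E e) j) * X e i"
        unfolding edge(1) to_unweighted.simps substitute_sum sum_distrib_right
        by (intro sum.cong refl) (use True copies_less[of _ e i] in \<open>simp add: fwd_def to_weighted_edge del: to_weighted.simps\<close>)
      also have "\<dots> \<approx> X e i" using True edge by (intro sum_copies_special(1))
      also have "X e i = letter x" using edge by (simp add: edge_def)
      finally show ?thesis .
    next
      case False
      have "substitute to_weighted (to_unweighted x) = X e i * (\<Sum>j\<in>pieces (head E e). piece (head E e) j)"
        unfolding edge(1) to_unweighted.simps substitute_sum sum_distrib_left
        by (intro sum.cong) (use False pieces_less in \<open>auto simp: fwd_def copies_def to_weighted_edge simp del: to_weighted.simps\<close>)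
      also have "\<dots> \<approx> X e i * vert (head E e)" by (intro pcong_mult_left sum_pieces)
      also have "\<dots> \<approx> X e i" by (rule edge_head[OF edge(2)])
      also have "X e i = letter x" using edge by (simp add: edge_def)
      finally show ?thesis .
    qed
  next
    case ghost
    show ?thesis
    proof (cases "special e")
      case True
      have "substitute to_weighted (to_unweighted x) = Y e i * (\<Sum>j\<in>copies e i. piece (tail E e) j)"
        unfolding ghost(1) to_unweighted.simps substitute_sum sum_distrib_left
        by (intro sum.cong refl) (use True copies_less[of _ e i] in \<open>simp add: bwd_def to_weighted_edge del: to_weighted.simps\<close>)
      also have "\<dots> \<approx> Y e i" using True ghost by (intro sum_copies_special(2))
      also have "Y e i = letter x" using ghost by (simp add: ghost_def)
      finally show ?thesis .
    next
      case False
      have "substitute to_weighted (to_unweighted x) = (\<Sum>j\<in>pieces (head E e). piece (head E e) j) * Y e i"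
        unfolding ghost(1) to_unweighted.simps substitute_sum sum_distrib_right
        by (intro sum.cong) (use False pieces_less in \<open>auto simp: bwd_def copies_def to_weighted_edge simp del: to_weighted.simps\<close>)
      also have "\<dots> \<approx> vert (head E e) * Y e i" by (intro pcong_mult_right sum_pieces)
      also have "\<dots> \<approx> Y e i" by (rule head_ghost[OF ghost(2)])
      also have "Y e i = letter x" using ghost by (simp add: ghost_def)
      finally show ?thesis .
    qed
  qed
qed

text \<open>
  Piece 1 is the image of \<open>d\<^sub>1 d\<^sub>1\<^sup>*\<close> because \<open>d\<^sub>1\<close> has a single copy, and piece 0 is what is left of the
  vertex.
\<close>

lemma to_unweighted_piece:
  assumes "j \<in> pieces v"
  shows "substitute to_unweighted (piece v j) \<simeq> vert (v, j)"
proof (cases "emits_special v")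
  case True
  then obtain d where d: "special d" "tail E d = v" "d \<in> arcs E" by (elim emits_specialE)
  have "valid d 1 1" using d weight_pos[OF d(3)] by (simp add: valid_def copies_def)
  then have image: "substitute to_unweighted (special_part v) \<simeq> vert (v, 1)"
    using fwd_bwd_special[of d 1 1 1 1] d special_part_tail[OF d(1)] weight_pos[OF d(3)]
    by (simp add: to_unweighted_edge to_unweighted_ghost copies_def)
  show ?thesis
  proof (cases "j = 1")
    case True
    then show ?thesis using image by (simp add: piece_def)
  next
    case False
    then have "pieces v = {0, 1}" "j = 0" using assms True by (auto simp: pieces_def)
    then have "vsum v = vert (v, 0) + vert (v, 1)" by (simp add: vsum_def)
    then show ?thesis
      using pcong_diff[OF pcong_refl[of _ _ "vsum v"] image] \<open>j = 0\<close> by (simp add: piece_def)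
  qed
next
  case False
  then have "pieces v = {0}" "j = 0" using assms by (auto simp: pieces_def)
  then show ?thesis using False by (simp add: piece_def special_part_def vsum_def)
qed

lemma sum_fwd_vert:
  assumes "valid e i j"
  shows "\<not> special e \<Longrightarrow> (\<Sum>k\<in>copies e i. fwd e i k) * vert (head E e, j) \<simeq> fwd e i j"
    and "\<not> special e \<Longrightarrow> vert (head E e, j) * (\<Sum>k\<in>copies e i. bwd e i k) \<simeq> bwd e i j"
    and "special e \<Longrightarrow> vert (tail E e, j) * (\<Sum>k\<in>copies e i. fwd e i k) \<simeq> fwd e i j"
    and "special e \<Longrightarrow> (\<Sum>k\<in>copies e i. bwd e i k) * vert (tail E e, j) \<simeq> bwd e i j"
proof -
  have j: "j \<in> copies e i" using assms by (simp add: valid_def)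
  have valid: "valid e i k" if "k \<in> copies e i" for k using assms that by (simp add: valid_def)
  show "(\<Sum>k\<in>copies e i. fwd e i k) * vert (head E e, j) \<simeq> fwd e i j" if "\<not> special e"
    unfolding sum_distrib_right
  proof (rule pcong_sum_single[OF finite_copies j])
    show "fwd e i j * vert (head E e, j) \<simeq> fwd e i j"
      using fwd_tgt[OF assms] that by (simp add: tgt_def)
  next
    fix k assume "k \<in> copies e i" "k \<noteq> j"
    then show "fwd e i k * vert (head E e, j) \<simeq> 0"
      using F_mult_vert_other[OF fwd_tgt[OF valid], of k "(head E e, j)"] that by (simp add: tgt_def)
  qed
  show "vert (head E e, j) * (\<Sum>k\<in>copies e i. bwd e i k) \<simeq> bwd e i j" if "\<not> special e"
    unfolding sum_distrib_left
  proof (rule pcong_sum_single[OF finite_copies j])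
    show "vert (head E e, j) * bwd e i j \<simeq> bwd e i j"
      using tgt_bwd[OF assms] that by (simp add: tgt_def)
  next
    fix k assume "k \<in> copies e i" "k \<noteq> j"
    then show "vert (head E e, j) * bwd e i k \<simeq> 0"
      using F_vert_mult_other[OF tgt_bwd[OF valid], of k "(head E e, j)"] that by (simp add: tgt_def)
  qed
  show "vert (tail E e, j) * (\<Sum>k\<in>copies e i. fwd e i k) \<simeq> fwd e i j" if "special e"
    unfolding sum_distrib_left
  proof (rule pcong_sum_single[OF finite_copies j])
    show "vert (tail E e, j) * fwd e i j \<simeq> fwd e i j"
      using src_fwd[OF assms] that by (simp add: src_def)
  next
    fix k assume "k \<in> copies e i" "k \<noteq> j"
    then show "vert (tail E e, j) * fwd e i k \<simeq> 0"
      using F_vert_mult_other[OF src_fwd[OF valid], of k "(tail E e, j)"] that by (simp add: src_def)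
  qed
  show "(\<Sum>k\<in>copies e i. bwd e i k) * vert (tail E e, j) \<simeq> bwd e i j" if "special e"
    unfolding sum_distrib_right
  proof (rule pcong_sum_single[OF finite_copies j])
    show "bwd e i j * vert (tail E e, j) \<simeq> bwd e i j"
      using bwd_src[OF assms] that by (simp add: src_def)
  next
    fix k assume "k \<in> copies e i" "k \<noteq> j"
    then show "bwd e i k * vert (tail E e, j) \<simeq> 0"
      using F_mult_vert_other[OF bwd_src[OF valid], of k "(tail E e, j)"] that by (simp add: src_def)
  qed
qed

lemma to_unweighted_to_weighted:
  assumes "y \<in> wlpa_gens F (\<lambda>_. 1)"
  shows "substitute to_unweighted (to_weighted y) \<simeq> letter y"
proof -
  consider (vert) v j where "y = Vert (v, j)" "j \<in> pieces v"
    | (edge) x where "y = Edge x 1" "x \<in> arcs F"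
    | (ghost) x where "y = Ghost x 1" "x \<in> arcs F"
    using assms by (auto simp: wlpa_gens_def)
  then show ?thesis
  proof cases
    case vert
    then show ?thesis using to_unweighted_piece by simp
  next
    case edge
    from edge(2) obtain e i j where x: "x = (e, 2 * i + j)" "valid e i j" by (rule arcs_FE)
    have j: "j < 2" using x by (intro valid_less)
    have i: "1 \<le> i" "i \<le> w e" using x by (auto simp: valid_def)
    show ?thesis
    proof (cases "special e")
      case True
      have "substitute to_unweighted (to_weighted y) = (\<Sum>k\<in>copies e i. bwd e i k) * substitute to_unweighted (piece (tail E e) j)"
        using True i j by (simp add: edge(1) x(1) to_weighted_edge to_unweighted_ghost del: to_weighted.simps)
      also have "\<dots> \<simeq> (\<Sum>k\<in>copies e i. bwd e i k) * vert (tail E e, j)"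
        using x(2) True copies_special_subset[of e i]
        by (intro pcong_mult_left to_unweighted_piece) (auto simp: valid_def)
      also have "\<dots> \<simeq> bwd e i j" by (rule sum_fwd_vert(4)[OF x(2) True])
      also have "bwd e i j = letter y" using True by (simp add: edge(1) x(1) bwd_def)
      finally show ?thesis .
    next
      case False
      have "substitute to_unweighted (to_weighted y) = (\<Sum>k\<in>copies e i. fwd e i k) * substitute to_unweighted (piece (head E e) j)"
        using False i j by (simp add: edge(1) x(1) to_weighted_edge to_unweighted_edge del: to_weighted.simps)
      also have "\<dots> \<simeq> (\<Sum>k\<in>copies e i. fwd e i k) * vert (head E e, j)"
        using x(2) False by (intro pcong_mult_left to_unweighted_piece) (auto simp: valid_def copies_def)
      also have "\<dots> \<simeq> fwd e i j" by (rule sum_fwd_vert(1)[OF x(2) False])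
      also have "fwd e i j = letter y" using False by (simp add: edge(1) x(1) fwd_def)
      finally show ?thesis .
    qed
  next
    case ghost
    from ghost(2) obtain e i j where x: "x = (e, 2 * i + j)" "valid e i j" by (rule arcs_FE)
    have j: "j < 2" using x by (intro valid_less)
    have i: "1 \<le> i" "i \<le> w e" using x by (auto simp: valid_def)
    show ?thesis
    proof (cases "special e")
      case True
      have "substitute to_unweighted (to_weighted y) = substitute to_unweighted (piece (tail E e) j) * (\<Sum>k\<in>copies e i. fwd e i k)"
        using True i j by (simp add: ghost(1) x(1) to_weighted_edge to_unweighted_edge del: to_weighted.simps)
      also have "\<dots> \<simeq> vert (tail E e, j) * (\<Sum>k\<in>copies e i. fwd e i k)"
        using x(2) True copies_special_subset[of e i]
        by (intro pcong_mult_right to_unweighted_piece) (auto simp: valid_def)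
      also have "\<dots> \<simeq> fwd e i j" by (rule sum_fwd_vert(3)[OF x(2) True])
      also have "fwd e i j = letter y" using True by (simp add: ghost(1) x(1) fwd_def)
      finally show ?thesis .
    next
      case False
      have "substitute to_unweighted (to_weighted y) = substitute to_unweighted (piece (head E e) j) * (\<Sum>k\<in>copies e i. bwd e i k)"
        using False i j by (simp add: ghost(1) x(1) to_weighted_edge to_unweighted_ghost del: to_weighted.simps)
      also have "\<dots> \<simeq> vert (head E e, j) * (\<Sum>k\<in>copies e i. bwd e i k)"
        using x(2) False by (intro pcong_mult_right to_unweighted_piece) (auto simp: valid_def copies_def)
      also have "\<dots> \<simeq> bwd e i j" by (rule sum_fwd_vert(2)[OF x(2) False])
      also have "bwd e i j = letter y" using False by (simp add: ghost(1) x(1) bwd_def)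
      finally show ?thesis .
    qed
  qed
qed

theorem algebra_iso_wlpa_lpa: "algebra_iso (wlpa K E w) (lpa K F) \<noteq> {}"
  unfolding lpa_def wlpa_def wlpa_ideal_def
  using to_unweighted_closed to_weighted_closed to_unweighted_relations to_weighted_relations to_weighted_to_unweighted to_unweighted_to_weighted
  by (rule presentation_iso[OF wlpa_relations_subset[OF wf_digraph_axioms] wlpa_relations_subset[OF wf_F]])

end


section \<open>The standard grading\<close>

lemma keys_letter [simp]: "Poly_Mapping.keys (letter x :: ('x, 'k :: field) free) = {FWord [x]}"
  by (simp add: letter_def)

lemma letter_mult_letter: "letter x * letter y = (Poly_Mapping.single (FWord [x, y]) 1 :: ('x, 'k :: field) free)"
  by (simp add: letter_def mult_single plus_fword_def)

definition homogeneous_of :: "('a \<Rightarrow> 'g) \<Rightarrow> 'g \<Rightarrow> ('a \<Rightarrow>\<^sub>0 'b :: zero) \<Rightarrow> bool" where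
  "homogeneous_of d g p \<longleftrightarrow> (\<forall>u\<in>Poly_Mapping.keys p. d u = g)"

lemma homogeneous_of_0 [simp]: "homogeneous_of d g 0"
  by (simp add: homogeneous_of_def)

lemma homogeneous_of_diff:
  fixes p q :: "'a \<Rightarrow>\<^sub>0 'b :: ab_group_add"
  shows "homogeneous_of d g p \<Longrightarrow> homogeneous_of d g q \<Longrightarrow> homogeneous_of d g (p - q)"
  by (auto simp: homogeneous_of_def in_keys_iff lookup_minus)

lemma homogeneous_of_sum:
  fixes f :: "'i \<Rightarrow> 'a \<Rightarrow>\<^sub>0 'b :: comm_monoid_add"
  shows "(\<And>i. i \<in> S \<Longrightarrow> homogeneous_of d g (f i)) \<Longrightarrow> homogeneous_of d g (sum f S)"
proof (induction S rule: infinite_finite_induct)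
  case (insert i S)
  then show ?case using keys_add[of "f i" "sum f S"] by (auto simp: homogeneous_of_def)
qed simp_all

lemma homogeneous_presentation_wlpa:
  assumes "wf_digraph E"
  shows "homogeneous_presentation (wlpa_gens E w) (wlpa_relations E w :: (('v, 'e) gen, 'k :: field) free set)
    n (gen_degree n) (word_degree n)"
proof
  show "wlpa_relations E w \<subseteq> (free_algebra (wlpa_gens E w) :: (('v, 'e) gen, 'k) free set)"
    using assms by (rule wlpa_relations_subset)
next
  fix x :: "('v, 'e) gen"
  show "gen_degree n x \<in> carrier_vec n" by (cases x) auto
next
  fix u :: "('v, 'e) gen fword"
  show "word_degree n u = foldr (\<lambda>x g. gen_degree n x + g) (letters u) (0\<^sub>v n)"
    by (simp add: word_degree_def)
next
  fix r :: "(('v, 'e) gen, 'k) free" assume "r \<in> wlpa_relations E w"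
  then have "\<exists>g. homogeneous_of (word_degree n) g r"
  proof cases
    case (vertices u v)
    have "homogeneous_of (word_degree n) (0\<^sub>v n) r" unfolding vertices(1)
      by (rule homogeneous_of_diff)
        (simp_all add: homogeneous_of_def letter_mult_letter word_degree_def)
    then show ?thesis ..
  next
    case (source_edge e i)
    then show ?thesis unfolding source_edge(1)
      by (intro exI[of _ "unit_vec n (i - 1)"] homogeneous_of_diff)
        (auto simp: edge_def homogeneous_of_def letter_mult_letter word_degree_def)
  next
    case (edge_range e i)
    then show ?thesis unfolding edge_range(1)
      by (intro exI[of _ "unit_vec n (i - 1)"] homogeneous_of_diff)
        (auto simp: edge_def homogeneous_of_def letter_mult_letter word_degree_def)
  next
    case (range_ghost e i)
    then show ?thesis unfolding range_ghost(1)
      by (intro exI[of _ "- unit_vec n (i - 1)"] homogeneous_of_diff)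
        (auto simp: ghost_def homogeneous_of_def letter_mult_letter word_degree_def)
  next
    case (ghost_source e i)
    then show ?thesis unfolding ghost_source(1)
      by (intro exI[of _ "- unit_vec n (i - 1)"] homogeneous_of_diff)
        (auto simp: ghost_def homogeneous_of_def letter_mult_letter word_degree_def)
  next
    case (ghost_edge v e f)
    have "- unit_vec n k + unit_vec n k = (0\<^sub>v n :: int vec)" for k
      by (rule uminus_l_inv_vec) simp
    then show ?thesis unfolding ghost_edge(1)
      by (intro exI[of _ "0\<^sub>v n"] homogeneous_of_diff homogeneous_of_sum)
        (auto simp: edge_def ghost_def homogeneous_of_def letter_mult_letter word_degree_def)
  next
    case (edge_ghost v i j)
    have *: "unit_vec n k + - unit_vec n k = (0\<^sub>v n :: int vec)" for k
      by (rule uminus_r_inv_vec) simp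
    show ?thesis unfolding edge_ghost(1)
      by (intro exI[of _ "unit_vec n (i - 1) + - unit_vec n (j - 1)"] homogeneous_of_diff homogeneous_of_sum)
        (auto simp: edge_def ghost_def homogeneous_of_def letter_mult_letter word_degree_def *)
  qed
  then show "\<exists>g. \<forall>u\<in>Poly_Mapping.keys r. word_degree n u = g"
    by (simp only: homogeneous_of_def)
qed

lemma graded_algebra_standard_grading:
  fixes K :: "'k :: field itself"
  assumes "wf_digraph E"
  shows "graded_algebra n (wlpa K E w) (standard_grading K E w n)"
proof -
  interpret homogeneous_presentation "wlpa_gens E w" "wlpa_relations E w :: (_, 'k) free set"
    n "gen_degree n" "word_degree n"
    using assms by (rule homogeneous_presentation_wlpa)
  have "standard_grading K E w n = component"
    by (rule ext) (simp add: standard_grading_def component_def wlpa_ideal_def)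
  then show ?thesis using graded_algebra_quotient by (simp add: wlpa_def wlpa_ideal_def)
qed

theorem theorem4p20:
  fixes K :: "'k :: field itself"
    and E :: "('v, 'e) pre_digraph"
    and w :: "'e \<Rightarrow> nat"
    and n :: nat
  assumes "LPA_weighted_graph E w"
    and "weight_sup E w = enat n"
  shows "\<exists>(F :: ('v \<times> nat, 'e \<times> nat) pre_digraph) \<F>.
           wf_digraph F \<and> row_finite F \<and>
           graded_algebra n (lpa K F) \<F> \<and>
           graded_isomorphic n (wlpa K E w) (standard_grading K E w n) (lpa K F) \<F>"
proof -
  interpret LPA_weighted_graph E w by fact
  interpret S: special_arcs E w K special
  proof
    show "row_finite E" by (rule row_finite)
    show "1 \<le> w e" if "e \<in> arcs E" for e using that by (rule weight_pos)
    show "e \<in> arcs E" if "special e" for e using that by (simp add: special_def)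
  qed (fact special_weighted special_tail_unique special_head_unique special_after_special)+
  obtain \<phi> where \<phi>: "\<phi> \<in> algebra_iso (wlpa K E w) (lpa K S.F)"
    using S.algebra_iso_wlpa_lpa by blast
  let ?\<F> = "\<lambda>g. \<phi> ` standard_grading K E w n g"
  have "assoc_algebra (lpa K S.F)"
    unfolding lpa_def by (rule assoc_algebra_wlpa[OF S.wf_F])
  then have "graded_algebra n (lpa K S.F) ?\<F>"
    using graded_algebra_transport[OF graded_algebra_standard_grading[OF wf_digraph_axioms] _ \<phi>] by blast
  moreover have "graded_isomorphic n (wlpa K E w) (standard_grading K E w n) (lpa K S.F) ?\<F>"
    using \<phi> unfolding graded_isomorphic_def by blast
  ultimately show ?thesis using S.wf_F S.row_finite_F by blast
qed


end
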